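(* Let $1\le p<q<\infty$ and $\omega\in A^{\rho,\infty}_{p,q}(\mathbb R^d)$, and let $f\in L^1_{\mathrm{loc}}(\mathbb R^d)$ be real-valued. Then the following statements are true. (1) Each of the following two conditions is equivalent to $f\in\mathrm{BMO}_{\rho,\infty}(\mathbb R^d)$: (1a) there exist a constant $C>0$ and some $\mathcal N>0$ such that for every cube $\mathcal Q=Q(x_0,r)\subset\mathbb R^d$, $$\bigg(\frac{1}{\omega^q(\mathcal Q)}\int_{\mathcal Q}|f(x)-f_{\mathcal Q}|^q\,\omega(x)^q\,dx\bigg)^{1/q}\le C\bigg(1+\frac{r}{\rho(x_0)}\bigg)^{\mathcal N};$$ (1b) there exist a constant $C>0$ and some $\mathcal N>0$ such that for every cube $\mathcal Q=Q(x_0,r)\subset\mathbb R^d$, $$\frac{|\mathcal Q|^{1/p-1/q}}{[\omega^p(\mathcal Q)]^{1/p}}\bigg(\int_{\mathcal Q}|f(x)-f_{\mathcal Q}|^q\,\omega(x)^q\,dx\bigg)^{1/q}\le C\bigg(1+\frac{r}{\rho(x_0)}\bigg)^{\mathcal N}.$$ (2) Let $0<\beta<1$. Each of the following two conditions is equivalent to $f\in\mathrm{Lip}_\beta^{\rho,\infty}(\mathbb R^d)$: (2a) there exist a constant $C>0$ and some $\mathcal N'>0$ such that for every ball $\mathcal B=B(x_0,r)\subset\mathbb R^d$, $$\frac{1}{|\mathcal B|^{\beta/d}}\bigg(\frac{1}{\omega^q(\mathcal B)}\int_{\mathcal B}|f(x)-f_{\mathcal B}|^q\,\omega(x)^q\,dx\bigg)^{1/q}\le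 C\bigg(1+\frac{r}{\rho(x_0)}\bigg)^{\mathcal N'};$$ (2b) there exist a constant $C>0$ and some $\mathcal N'>0$ such that for every ball $\mathcal B=B(x_0,r)\subset\mathbb R^d$, $$\frac{|\mathcal B|^{1/p-1/q-\beta/d}}{[\omega^p(\mathcal B)]^{1/p}}\bigg(\int_{\mathcal B}|f(x)-f_{\mathcal B}|^q\,\omega(x)^q\,dx\bigg)^{1/q}\le C\bigg(1+\frac{r}{\rho(x_0)}\bigg)^{\mathcal N'}.$$
   Context: Setting: $d\ge 3$, and $V:\mathbb R^d\to[0,\infty)$ is locally integrable, not identically zero, and belongs to the reverse Hölder class $RH_s(\mathbb R^d)$ for some $s\ge d/2$, i.e. there is a constant $C>0$ with $\big(\frac1{|B|}\int_B V^s\big)^{1/s}\le C\,\frac1{|B|}\int_B V$ for every ball $B$ (usual modification if $s=\infty$). $B(x,r)$ is the open ball with center $x$ and radius $r$; $Q(x_0,r)$ is the cube centered at $x_0$ with sidelength $r$ and sides parallel to the axes. The critical radius function is $$\rho(x):=\sup\Big\{r>0:\ \frac{1}{r^{d-2}}\int_{B(x,r)}V(y)\,dy\le 1\Big\},\qquad x\in\mathbb R^d,$$ which satisfies $0<\rho(x)<\infty$. Weights: a weight is a nonnegative locally integrable function $\omega$ on $\mathbb R^d$, not a.e. zero; for $\gamma>0$, $\omega^\gamma(E):=\int_E\omega(x)^\gamma\,dx$. Let $p'$ denote the conjugate exponent, $1/p+1/p'=1$. For $0<\theta<\infty$ and $1<p,q<\infty$, $\omega\in A_{p,q}^{\rho,\theta}(\mathbb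 R^d)$ means that there is $C>0$ such that for all balls $B=B(x_0,r)$ $$\Big(\frac1{|B|}\int_B\omega^q\Big)^{1/q}\Big(\frac1{|B|}\int_B\omega^{-p'}\Big)^{1/p'}\le C\Big(1+\frac r{\rho(x_0)}\Big)^{\theta},$$ and, for $1<q<\infty$, $\omega\in A_{1,q}^{\rho,\theta}(\mathbb R^d)$ means that there is $C>0$ with $\big(\frac1{|B|}\int_B\omega^q\big)^{1/q}\le C\big(1+\frac r{\rho(x_0)}\big)^{\theta}\operatorname{ess\,inf}_{B}\omega$ for all balls $B=B(x_0,r)$. $A_{p,q}^{\rho,\infty}(\mathbb R^d):=\bigcup_{\theta>0}A_{p,q}^{\rho,\theta}(\mathbb R^d)$. Function spaces: $f_E:=\frac1{|E|}\int_E f$. For $0<\theta<\infty$, $\mathrm{BMO}_{\rho,\theta}(\mathbb R^d)$ is the set of real-valued $f\in L^1_{\mathrm{loc}}(\mathbb R^d)$ with $\sup_{Q=Q(x_0,r)}\big(1+\frac r{\rho(x_0)}\big)^{-\theta}\frac1{|Q|}\int_Q|f-f_Q|\,dx<\infty$ (supremum over all cubes), and for $0<\beta<1$, $\mathrm{Lip}_\beta^{\rho,\theta}(\mathbb R^d)$ is the set of real-valued $f\in L^1_{\mathrm{loc}}(\mathbb R^d)$ with $\sup_{B=B(x_0,r)}\big(1+\frac r{\rho(x_0)}\big)^{-\theta}\frac1{|B|^{1+\beta/d}}\int_B|f-f_B|\,dx<\infty$ (supremum over all balls). $\mathrm{BMO}_{\rho,\infty}(\mathbb R^d):=\bigcup_{\theta>0}\mathrm{BMO}_{\rho,\theta}(\mathbb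 R^d)$ and $\mathrm{Lip}_\beta^{\rho,\infty}(\mathbb R^d):=\bigcup_{\theta>0}\mathrm{Lip}_\beta^{\rho,\theta}(\mathbb R^d)$. *)

theory Defs
  imports "HOL-Analysis.Analysis" "HOL-Probability.Essential_Supremum"
begin

text \<open>Throughout, the space \<open>\<real>\<^sup>d\<close> is \<open>real ^ 'n\<close> with \<open>d = CARD('n)\<close>.  Integrals of nonnegative
  functions are nonnegative Lebesgue integrals with values in \<open>[0, \<infinity>]\<close>, so a bound on such an
  integral includes the claim that it is finite.\<close>

text \<open>Real powers on \<open>[0, \<infinity>]\<close>.  The point is the convention \<open>0\<^sup>a = \<infinity>\<close> for \<open>a < 0\<close>, which is needed for
  \<open>\<omega>\<^bsup>-p'\<^esup>\<close> (for real numbers the library sets \<open>0 powr a = 0\<close>).\<close>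

definition epowr :: "ennreal \<Rightarrow> real \<Rightarrow> ennreal"  (infixr "epowr" 80) where
  "t epowr a =
     (if t = top then (if a > 0 then top else if a = 0 then 1 else 0)
      else if t = 0 then (if a > 0 then 0 else if a = 0 then 1 else top)
      else ennreal (enn2real t powr a))"

definition eaverage :: "'a::euclidean_space set \<Rightarrow> ('a \<Rightarrow> ennreal) \<Rightarrow> ennreal" where
  "eaverage E g = (\<integral>\<^sup>+x\<in>E. g x \<partial>lebesgue) / emeasure lebesgue E"

definition average :: "'a::euclidean_space set \<Rightarrow> ('a \<Rightarrow> real) \<Rightarrow> real" where
  "average E f = (LINT x:E|lebesgue. f x) / measure lebesgue E"

definition locally_integrable :: "('a::euclidean_space \<Rightarrow> real) \<Rightarrow> bool" where
  "locally_integrable f \<longleftrightarrow> (\<forall>K. compact K \<longrightarrow> f absolutely_integrable_on K)"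

text \<open>Same filter as in the library's \<^const>\<open>esssup\<close>.\<close>

definition essinf :: "'a measure \<Rightarrow> ('a \<Rightarrow> ennreal) \<Rightarrow> ennreal" where
  "essinf M g = Liminf (ae_filter M) g"

definition cube :: "real ^ 'n \<Rightarrow> real \<Rightarrow> (real ^ 'n) set" where
  "cube x0 r = box (\<chi> i. x0 $ i - r / 2) (\<chi> i. x0 $ i + r / 2)"

text \<open>The exponent \<open>s\<close> ranges over \<open>(0, \<infinity>]\<close>.\<close>

definition reverse_Holder :: "ennreal \<Rightarrow> (real ^ 'n \<Rightarrow> real) \<Rightarrow> bool" where
  "reverse_Holder s V \<longleftrightarrow>
     (\<exists>C>0. \<forall>x r. r > 0 \<longrightarrow>
        (if s = top then esssup (lebesgue_on (ball x r)) (\<lambda>y. ennreal (V y))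
         else eaverage (ball x r) (\<lambda>y. ennreal (V y) epowr enn2real s) epowr (1 / enn2real s))
        \<le> ennreal C * eaverage (ball x r) (\<lambda>y. ennreal (V y)))"

definition critical_radius :: "(real ^ 'n \<Rightarrow> real) \<Rightarrow> real ^ 'n \<Rightarrow> real" where
  "critical_radius V x =
     Sup {r. r > 0 \<and> 1 / r ^ (CARD('n) - 2) * (LINT y:ball x r|lebesgue. V y) \<le> 1}"

definition weight :: "('a::euclidean_space \<Rightarrow> real) \<Rightarrow> bool" where
  "weight w \<longleftrightarrow> (\<forall>x. 0 \<le> w x) \<and> locally_integrable w \<and> \<not> (AE x in lebesgue. w x = 0)"

text \<open>\<open>wpow w \<gamma> E\<close> is \<open>w\<^sup>\<gamma>(E)\<close>.\<close>

definition wpow :: "('a::euclidean_space \<Rightarrow> real) \<Rightarrow> real \<Rightarrow> 'a set \<Rightarrow> ennreal" where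
  "wpow w \<gamma> E = (\<integral>\<^sup>+x\<in>E. ennreal (w x) epowr \<gamma> \<partial>lebesgue)"

text \<open>In the following, \<open>\<rho>\<close> is an arbitrary function in the role of the critical radius function.
  For \<open>p > 1\<close> the conjugate exponent \<open>p'\<close> is \<open>p / (p - 1)\<close>.\<close>

definition A_class ::
  "(real ^ 'n \<Rightarrow> real) \<Rightarrow> real \<Rightarrow> real \<Rightarrow> real \<Rightarrow> (real ^ 'n \<Rightarrow> real) set" where
  "A_class \<rho> \<theta> p q = {w. weight w \<and>
     (\<exists>C>0. \<forall>x0 r. r > 0 \<longrightarrow>
        (if p = 1 then
           eaverage (ball x0 r) (\<lambda>x. ennreal (w x) epowr q) epowr (1 / q)
           \<le> ennreal (C * (1 + r / \<rho> x0) powr \<theta>)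
               * essinf (lebesgue_on (ball x0 r)) (\<lambda>x. ennreal (w x))
         else
           eaverage (ball x0 r) (\<lambda>x. ennreal (w x) epowr q) epowr (1 / q)
             * eaverage (ball x0 r) (\<lambda>x. ennreal (w x) epowr (- (p / (p - 1))))
                 epowr (1 / (p / (p - 1)))
           \<le> ennreal (C * (1 + r / \<rho> x0) powr \<theta>)))}"

definition A_class_infty ::
  "(real ^ 'n \<Rightarrow> real) \<Rightarrow> real \<Rightarrow> real \<Rightarrow> (real ^ 'n \<Rightarrow> real) set" where
  "A_class_infty \<rho> p q = (\<Union>\<theta>\<in>{0<..}. A_class \<rho> \<theta> p q)"

definition BMO :: "(real ^ 'n \<Rightarrow> real) \<Rightarrow> real \<Rightarrow> (real ^ 'n \<Rightarrow> real) set" where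
  "BMO \<rho> \<theta> = {f. locally_integrable f \<and>
     (SUP (x0, r) \<in> UNIV \<times> {0<..}.
        ennreal ((1 + r / \<rho> x0) powr (- \<theta>))
          * eaverage (cube x0 r) (\<lambda>x. ennreal \<bar>f x - average (cube x0 r) f\<bar>)) < top}"

definition BMO_infty :: "(real ^ 'n \<Rightarrow> real) \<Rightarrow> (real ^ 'n \<Rightarrow> real) set" where
  "BMO_infty \<rho> = (\<Union>\<theta>\<in>{0<..}. BMO \<rho> \<theta>)"

definition Lip :: "(real ^ 'n \<Rightarrow> real) \<Rightarrow> real \<Rightarrow> real \<Rightarrow> (real ^ 'n \<Rightarrow> real) set" where
  "Lip \<rho> \<theta> \<beta> = {f. locally_integrable f \<and>
     (SUP (x0, r) \<in> UNIV \<times> {0<..}.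
        ennreal ((1 + r / \<rho> x0) powr (- \<theta>))
          * ((\<integral>\<^sup>+x\<in>ball x0 r. ennreal \<bar>f x - average (ball x0 r) f\<bar> \<partial>lebesgue)
             / emeasure lebesgue (ball x0 r) epowr (1 + \<beta> / real CARD('n)))) < top}"

definition Lip_infty :: "(real ^ 'n \<Rightarrow> real) \<Rightarrow> real \<Rightarrow> (real ^ 'n \<Rightarrow> real) set" where
  "Lip_infty \<rho> \<beta> = (\<Union>\<theta>\<in>{0<..}. Lip \<rho> \<theta> \<beta>)"

text \<open>\<open>wosc w f q E\<close> is \<open>\<integral>\<^sub>E |f - f\<^sub>E|\<^sup>q w\<^sup>q\<close>.\<close>

definition wosc ::
  "('a::euclidean_space \<Rightarrow> real) \<Rightarrow> ('a \<Rightarrow> real) \<Rightarrow> real \<Rightarrow> 'a set \<Rightarrow> ennreal" where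
  "wosc w f q E =
     (\<integral>\<^sup>+x\<in>E. ennreal \<bar>f x - average E f\<bar> epowr q * ennreal (w x) epowr q \<partial>lebesgue)"

end

theory Submission
  imports Defs
begin

text \<open>
  Write \<open>u = 1 + r/\<rho>(x)\<close> for the scale of the cube or ball \<open>E = E(x,r)\<close>.  All three kinds of conditions
  bound an oscillation of \<open>f\<close> over \<open>E\<close> by an unspecified power of \<open>u\<close>, so losing powers of \<open>u\<close> is
  harmless.  Three ingredients link them.

  \<^item> The \<open>A\<^bsub>p,q\<^esub>\<close> condition is used only through a test function inequality
    (\<open>A_class_imp_A_weight\<close>): up to a power of \<open>u\<close>, the average of \<open>g\<close> over a ball \<open>B\<close> times the
    \<open>L\<^sup>q\<close> mean of \<open>\<omega>\<close> is at most the \<open>L\<^sup>p\<close> mean of \<open>g \<omega>\<close>.  The choice \<open>g = |f - f\<^sub>E|\<close> bounds the plain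
    oscillation by the weighted one.  The choice \<open>g = 1\<^sub>E\<close> shows that the \<open>L\<^sup>p\<close> and \<open>L\<^sup>q\<close> means of \<open>\<omega>\<close>
    are comparable, so that the two weighted conditions agree.  The choice \<open>g = 1\<^sub>F\<close>, where \<open>F\<close> fills a
    fixed part of \<open>B\<close>, shows that \<open>F\<close> carries a fixed part of the weight \<open>\<omega>\<^sup>q(B)\<close>.

  \<^item> The plain oscillation bounds the weighted one by a John--Nirenberg inequality with respect to the
    measure \<open>\<omega>\<^sup>q dx\<close> (\<open>weighted_John_Nirenberg\<close>, \<open>weighted_oscillation_le\<close>).  If every set that fills
    half of a dyadic subcube carries at least the fraction \<open>1/\<Lambda>\<close> of its weight, then the stopping
    time argument makes the weight of the level sets decay like \<open>(1 - 1/\<Lambda>)\<^sup>k\<close>.  The \<open>q\<close>-th moment of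
    the oscillation therefore grows like a power of \<open>\<Lambda>\<close>, and \<open>\<Lambda>\<close> is itself a power of \<open>u\<close>.

  \<^item> The subcubes have other centres \<open>y\<close>, so their scales must be bounded by a power of \<open>u\<close>.  This is
    the comparison \<open>1 + r/\<rho>(y) \<le> K u\<^sup>M\<close> for \<open>|x - y| < r\<close> (\<open>critical_radius_comparison\<close>).  It rests on a
    decay \<open>\<integral>\<^bsub>B(y,t)\<^esub> V \<le> D (t/R)\<^bsup>d-2+\<epsilon>\<^esup> \<integral>\<^bsub>B(y,R)\<^esub> V\<close> with a positive \<open>\<epsilon>\<close>, also for the borderline
    exponent \<open>s = d/2\<close> (\<open>reverse_Holder_growth_decay\<close>).

  Since \<open>|B|\<^bsup>\<beta>/d\<^esup>\<close> is a multiple of the \<open>\<beta>\<close>-th power of the radius, the Lipschitz condition bounds the mean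
  oscillation over every dyadic subcube of a cube of side comparable to \<open>r\<close> by \<open>r\<^sup>\<beta>\<close> times a power of
  \<open>u\<close>.  So the Lipschitz case with balls and the \<open>BMO\<close> case with cubes (\<open>\<beta> = 0\<close>) are two instances of
  one argument, carried out in the locale \<open>weighted_shapes\<close>.
\<close>

section \<open>Powers and Hoelder's inequality on the extended half-line\<close>

lemma epowr_0 [simp]: "a > 0 \<Longrightarrow> 0 epowr a = 0"
  and epowr_top [simp]: "a > 0 \<Longrightarrow> top epowr a = top"
  by (auto simp: epowr_def)

lemma epowr_ennreal: "x \<ge> 0 \<Longrightarrow> a > 0 \<Longrightarrow> ennreal x epowr a = ennreal (x powr a)"
  by (auto simp: epowr_def)

lemma epowr_ennreal_pos: "x > 0 \<Longrightarrow> ennreal x epowr a = ennreal (x powr a)"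
  by (auto simp: epowr_def)

lemma epowr_one_left [simp]: "1 epowr a = 1"
  using epowr_ennreal_pos[of 1 a] by simp

lemma epowr_one_right [simp]: "t epowr 1 = t"
  by (cases t) (auto simp: epowr_ennreal)

lemma epowr_zero_right [simp]: "t epowr 0 = 1"
  by (cases t) (auto simp: epowr_def)

lemma epowr_mono: "0 < a \<Longrightarrow> s \<le> t \<Longrightarrow> s epowr a \<le> t epowr a"
  by (cases s; cases t) (auto simp: epowr_ennreal powr_mono2 top_unique)

lemma epowr_mult:
  assumes "0 < a" shows "(s * t) epowr a = s epowr a * t epowr a"
proof (cases s)
  case (real x)
  show ?thesis
  proof (cases t)
    case (real y)
    show ?thesis using assms \<open>0 \<le> x\<close> \<open>0 \<le> y\<close> unfolding \<open>s = ennreal x\<close> \<open>t = ennreal y\<close>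
      by (simp add: epowr_ennreal ennreal_mult[symmetric] powr_mult)
  next
    case top
    then show ?thesis using real assms
      by (cases "x = 0") (auto simp: ennreal_mult_top epowr_ennreal)
  qed
next
  case top
  show ?thesis
  proof (cases t)
    case (real y)
    then show ?thesis using top assms
      by (cases "y = 0") (auto simp: ennreal_top_mult epowr_ennreal)
  qed (use top assms in \<open>auto simp: ennreal_top_mult\<close>)
qed

lemma epowr_epowr: "0 < a \<Longrightarrow> 0 < b \<Longrightarrow> (t epowr a) epowr b = t epowr (a * b)"
  by (cases t) (auto simp: epowr_ennreal powr_powr)

lemma epowr_root_le_iff:
  assumes "0 < q" "s epowr (1 / q) \<le> t" shows "s \<le> t epowr q"
  using epowr_mono[OF assms] assms(1) by (simp add: epowr_epowr)

lemma epowr_le_rootI: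
  assumes "0 < q" "s \<le> t epowr q" shows "s epowr (1 / q) \<le> t"
  using epowr_mono[of "1 / q" s "t epowr q"] assms by (simp add: epowr_epowr)

lemma epowr_eq_0_iff: "0 < a \<Longrightarrow> t epowr a = 0 \<longleftrightarrow> t = 0"
  and epowr_eq_top_iff: "0 < a \<Longrightarrow> t epowr a = top \<longleftrightarrow> t = top"
  by (cases t; auto simp: epowr_ennreal)+

lemma epowr_measurable [measurable]:
  assumes [measurable]: "g \<in> borel_measurable M"
  shows "(\<lambda>x. g x epowr a) \<in> borel_measurable M"
  unfolding epowr_def by measurable

lemma add_epowr_le:
  assumes "0 < q" shows "(s + t) epowr q \<le> ennreal (2 powr q) * (s epowr q + t epowr q)"
proof -
  have "s + t \<le> 2 * max s t"
    by (cases "s \<le> t") (auto simp: mult_2 max_def intro!: add_mono)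
  then have "(s + t) epowr q \<le> (ennreal 2 * max s t) epowr q"
    using assms by (intro epowr_mono) auto
  also have "\<dots> = ennreal (2 powr q) * max s t epowr q"
    using assms by (simp add: epowr_mult epowr_ennreal del: ennreal_numeral)
  also have "\<dots> \<le> ennreal (2 powr q) * (s epowr q + t epowr q)"
    by (intro mult_left_mono) (auto simp: max_def add_increasing add_increasing2)
  finally show ?thesis .
qed

lemma Young_scaled:
  assumes "0 < \<alpha>" "\<alpha> < 1" "0 < U" "0 < V"
  shows "s epowr \<alpha> * t epowr (1 - \<alpha>)
           \<le> ennreal (U powr \<alpha> * V powr (1 - \<alpha>)) * (ennreal (\<alpha> / U) * s + ennreal ((1 - \<alpha>) / V) * t)"
proof (cases "s = top \<or> t = top \<or> s = 0 \<or> t = 0")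
  case True
  have "U powr \<alpha> * V powr (1 - \<alpha>) > 0" "\<alpha> / U > 0" "(1 - \<alpha>) / V > 0" using assms by auto
  then show ?thesis using True assms by (auto simp: ennreal_mult_top)
next
  case False
  then obtain x y where xy: "s = ennreal x" "t = ennreal y" "0 < x" "0 < y"
    by (cases s; cases t) (auto simp: less_le)
  have "x powr \<alpha> * y powr (1 - \<alpha>)
      = U powr \<alpha> * V powr (1 - \<alpha>) * ((x / U) powr \<alpha> * (y / V) powr (1 - \<alpha>))"
    using assms xy by (simp add: powr_divide)
  also have "\<dots> \<le> U powr \<alpha> * V powr (1 - \<alpha>) * (\<alpha> * (x / U) + (1 - \<alpha>) * (y / V))"
    using assms xy by (intro mult_left_mono Youngs_inequality_0) auto
  also have "\<dots> = U powr \<alpha> * V powr (1 - \<alpha>) * (\<alpha> / U * x + (1 - \<alpha>) / V * y)"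
    by simp
  finally show ?thesis using assms xy
    by (simp add: epowr_ennreal ennreal_mult[symmetric] ennreal_plus[symmetric] ennreal_leI
        del: ennreal_plus)
qed

lemma Hoelder_nn_integral:
  assumes [measurable]: "u \<in> borel_measurable M" "v \<in> borel_measurable M"
    and a: "0 < \<alpha>" "\<alpha> < 1"
  shows "(\<integral>\<^sup>+x. u x epowr \<alpha> * v x epowr (1 - \<alpha>) \<partial>M)
           \<le> (\<integral>\<^sup>+x. u x \<partial>M) epowr \<alpha> * (\<integral>\<^sup>+x. v x \<partial>M) epowr (1 - \<alpha>)"
    (is "?I \<le> ?U epowr \<alpha> * ?V epowr (1 - \<alpha>)")
proof (cases "?U = 0 \<or> ?V = 0")
  case True
  then have "AE x in M. u x epowr \<alpha> * v x epowr (1 - \<alpha>) = 0"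
    using a by (auto simp: nn_integral_0_iff_AE)
  then have "?I = 0" by (subst nn_integral_0_iff_AE) auto
  then show ?thesis by simp
next
  case nz: False
  show ?thesis
  proof (cases "?U = top \<or> ?V = top")
    case True
    then have "?U epowr \<alpha> * ?V epowr (1 - \<alpha>) = top"
      using nz a by (auto simp: ennreal_mult_eq_top_iff epowr_eq_0_iff epowr_eq_top_iff)
    then show ?thesis by simp
  next
    case False
    then obtain U V where UV: "?U = ennreal U" "?V = ennreal V" "0 < U" "0 < V"
      using nz by (cases ?U; cases ?V) (auto simp: less_le)
    let ?c = "ennreal (U powr \<alpha> * V powr (1 - \<alpha>))"
    have "?I \<le> (\<integral>\<^sup>+x. ?c * (ennreal (\<alpha> / U) * u x + ennreal ((1 - \<alpha>) / V) * v x) \<partial>M)"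
      by (intro nn_integral_mono Young_scaled a UV)
    also have "\<dots> = ?c * (ennreal (\<alpha> / U) * ?U + ennreal ((1 - \<alpha>) / V) * ?V)"
      by (simp add: nn_integral_cmult nn_integral_add)
    also have "\<dots> = ?c"
      using a UV by (simp add: ennreal_mult[symmetric] ennreal_plus[symmetric] del: ennreal_plus)
    also have "\<dots> = ?U epowr \<alpha> * ?V epowr (1 - \<alpha>)"
      using a UV by (simp add: epowr_ennreal ennreal_mult)
    finally show ?thesis .
  qed
qed

lemma Hoelder_nn_set_integral:
  assumes [measurable]: "u \<in> borel_measurable M" "v \<in> borel_measurable M" "E \<in> sets M"
    and a: "0 < \<alpha>" "\<alpha> < 1"
  shows "(\<integral>\<^sup>+x\<in>E. u x epowr \<alpha> * v x epowr (1 - \<alpha>) \<partial>M)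
           \<le> (\<integral>\<^sup>+x\<in>E. u x \<partial>M) epowr \<alpha> * (\<integral>\<^sup>+x\<in>E. v x \<partial>M) epowr (1 - \<alpha>)"
proof -
  have "(\<integral>\<^sup>+x\<in>E. u x epowr \<alpha> * v x epowr (1 - \<alpha>) \<partial>M)
      = (\<integral>\<^sup>+x. (u x * indicator E x) epowr \<alpha> * (v x * indicator E x) epowr (1 - \<alpha>) \<partial>M)"
    using a by (intro nn_integral_cong) (auto simp: indicator_def)
  also have "\<dots> \<le> (\<integral>\<^sup>+x\<in>E. u x \<partial>M) epowr \<alpha> * (\<integral>\<^sup>+x\<in>E. v x \<partial>M) epowr (1 - \<alpha>)"
    by (intro Hoelder_nn_integral a) measurable
  finally show ?thesis .
qed

text \<open>Hoelder's inequality with one constant factor: the power mean inequality, cleared of denominators.\<close>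

lemma power_mean_nn_set_integral:
  assumes [measurable]: "h \<in> borel_measurable M" "E \<in> sets M" and ab: "0 < a" "a < b"
  shows "(\<integral>\<^sup>+x\<in>E. h x epowr a \<partial>M) epowr (1 / a)
           \<le> emeasure M E epowr (1 / a - 1 / b) * (\<integral>\<^sup>+x\<in>E. h x epowr b \<partial>M) epowr (1 / b)"
proof -
  have q: "0 < a / b" "a / b < 1" using ab by auto
  have "(\<integral>\<^sup>+x\<in>E. h x epowr a \<partial>M) = (\<integral>\<^sup>+x\<in>E. (h x epowr b) epowr (a / b) * 1 epowr (1 - a / b) \<partial>M)"
    using ab by (simp add: epowr_epowr)
  also have "\<dots> \<le> (\<integral>\<^sup>+x\<in>E. h x epowr b \<partial>M) epowr (a / b) * (\<integral>\<^sup>+x\<in>E. 1 \<partial>M) epowr (1 - a / b)"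
    by (intro Hoelder_nn_set_integral q) measurable
  finally have "(\<integral>\<^sup>+x\<in>E. h x epowr a \<partial>M) epowr (1 / a)
      \<le> ((\<integral>\<^sup>+x\<in>E. h x epowr b \<partial>M) epowr (a / b) * emeasure M E epowr (1 - a / b)) epowr (1 / a)"
    using ab by (intro epowr_mono) auto
  also have "\<dots> = (\<integral>\<^sup>+x\<in>E. h x epowr b \<partial>M) epowr (1 / b) * emeasure M E epowr (1 / a - 1 / b)"
    using ab q by (simp add: epowr_mult epowr_epowr) (simp add: diff_divide_distrib)
  finally show ?thesis by (simp add: mult.commute)
qed

section \<open>Averages of locally integrable functions\<close>

abbreviation vol :: "'a::euclidean_space set \<Rightarrow> ennreal" where
  "vol \<equiv> emeasure lebesgue"

abbreviation deviation :: "('a::euclidean_space \<Rightarrow> real) \<Rightarrow> real \<Rightarrow> 'a set \<Rightarrow> ennreal" where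
  "deviation f c S \<equiv> (\<integral>\<^sup>+y\<in>S. ennreal \<bar>f y - c\<bar> \<partial>lebesgue)"

lemma nn_set_integral_abs_eq:
  fixes h :: "'a \<Rightarrow> real"
  assumes "set_integrable M E h"
  shows "(\<integral>\<^sup>+x\<in>E. ennreal \<bar>h x\<bar> \<partial>M) = ennreal (LINT x:E|M. \<bar>h x\<bar>)"
proof -
  have "integrable M (\<lambda>x. \<bar>indicator E x *\<^sub>R h x\<bar>)"
    using assms unfolding set_integrable_def by (rule integrable_abs)
  then have "(\<integral>\<^sup>+x. ennreal \<bar>indicator E x *\<^sub>R h x\<bar> \<partial>M) = ennreal (\<integral>x. \<bar>indicator E x *\<^sub>R h x\<bar> \<partial>M)"
    by (intro nn_integral_eq_integral) auto
  moreover have "(\<integral>\<^sup>+x\<in>E. ennreal \<bar>h x\<bar> \<partial>M) = (\<integral>\<^sup>+x. ennreal \<bar>indicator E x *\<^sub>R h x\<bar> \<partial>M)"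
    by (intro nn_integral_cong) (auto simp: indicator_def)
  moreover have "(LINT x:E|M. \<bar>h x\<bar>) = (\<integral>x. \<bar>indicator E x *\<^sub>R h x\<bar> \<partial>M)"
    unfolding set_lebesgue_integral_def by (intro Bochner_Integration.integral_cong) (auto simp: indicator_def)
  ultimately show ?thesis by simp
qed

text \<open>Cleared of the denominator, so that averages enter estimates of nonnegative integrals without
  any case distinction on finiteness.\<close>

lemma average_diff_le:
  fixes f :: "'a::euclidean_space \<Rightarrow> real"
  assumes E: "E \<in> lmeasurable" "0 < measure lebesgue E" and f: "f absolutely_integrable_on E"
  shows "ennreal \<bar>average E f - c\<bar> * vol E \<le> deviation f c E"
proof -
  let ?m = "measure lebesgue E"
  have c: "(\<lambda>_. c) absolutely_integrable_on E"
    using E by (simp add: absolutely_integrable_on_const)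
  have d: "(\<lambda>x. f x - c) absolutely_integrable_on E"
    using f c by (rule set_integral_diff)
  have "(average E f - c) * ?m = (LINT x:E|lebesgue. f x) - (LINT x:E|lebesgue. c)"
    using E by (simp add: average_def field_simps set_lebesgue_integral_def fmeasurable_def)
  also have "\<dots> = (LINT x:E|lebesgue. f x - c)"
    using f c by (simp add: set_integral_diff)
  finally have "\<bar>average E f - c\<bar> * ?m = \<bar>LINT x:E|lebesgue. f x - c\<bar>"
    using E by (metis abs_mult abs_of_pos)
  also have "\<dots> \<le> (LINT x:E|lebesgue. \<bar>f x - c\<bar>)"
    using set_integral_norm_bound[OF d] by simp
  finally have "ennreal (\<bar>average E f - c\<bar> * ?m) \<le> deviation f c E"
    unfolding nn_set_integral_abs_eq[OF d] by (rule ennreal_leI)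
  then show ?thesis
    using E by (simp add: ennreal_mult emeasure_eq_measure2)
qed

lemma locally_integrable_measurable:
  fixes f :: "'a::euclidean_space \<Rightarrow> real"
  assumes "locally_integrable f"
  shows "f \<in> borel_measurable lebesgue"
proof -
  have "(\<lambda>x. f x) \<in> borel_measurable lebesgue"
  proof (rule borel_measurable_LIMSEQ_real)
    show "(\<lambda>n. indicator (cball 0 (real n)) x *\<^sub>R f x) \<longlonglongrightarrow> f x" for x
    proof (rule tendsto_eventually)
      obtain N where "norm x \<le> real N" using real_arch_simple by blast
      then show "\<forall>\<^sub>F n in sequentially. indicator (cball 0 (real n)) x *\<^sub>R f x = f x"
        by (intro eventually_sequentiallyI[of N]) (auto simp: indicator_def)
    qed
    show "(\<lambda>x. indicator (cball 0 (real n)) x *\<^sub>R f x) \<in> borel_measurable lebesgue" for n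
      using assms unfolding locally_integrable_def set_integrable_def
      by (metis borel_measurable_integrable compact_cball)
  qed
  then show ?thesis by simp
qed

lemma locally_integrable_bounded:
  assumes "locally_integrable f" "E \<in> sets lebesgue" "bounded E"
  shows "f absolutely_integrable_on E"
proof -
  obtain a where "E \<subseteq> cball 0 a" using assms(3) by (auto simp: bounded_iff subset_eq)
  moreover have "f absolutely_integrable_on cball 0 a"
    using assms(1) by (auto simp: locally_integrable_def)
  ultimately show ?thesis
    using assms(2) set_integrable_subset by blast
qed

section \<open>Dyadic cells\<close>

lemma emeasure_lebesgue_cube:
  fixes u :: "real ^ 'n"
  assumes "0 < h"
  shows "vol (cbox u (u + (\<chi> i. h))) = ennreal (h ^ CARD('n))"
    and "vol (box u (u + (\<chi> i. h))) = ennreal (h ^ CARD('n))"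
proof -
  let ?v = "u + (\<chi> i. h)"
  have ne: "cbox u ?v \<noteq> {}" using assms by (simp add: interval_ne_empty_cart)
  show 1: "vol (cbox u ?v) = ennreal (h ^ CARD('n))"
    using content_cbox_cart[OF ne] emeasure_lborel_cbox_finite[of u ?v]
      emeasure_eq_ennreal_measure[of lborel "cbox u ?v"]
    by (simp add: top.not_eq_extremum)
  show "vol (box u ?v) = ennreal (h ^ CARD('n))"
    unfolding 1[symmetric] by (simp add: emeasure_lborel_box_eq emeasure_lborel_cbox_eq)
qed

text \<open>The cells of generation \<open>n\<close> are half-open cubes of side \<open>L / 2\<^sup>n\<close> that partition the whole space;
  one of the cells of generation \<open>0\<close> has its lower corner at \<open>a\<close>.  Describing the cell of \<open>x\<close> by integer
  parts makes both the partition property and the nesting of generations immediate.\<close>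

locale dyadic_grid =
  fixes a :: "real ^ 'n" and L :: real
  assumes L_pos: "0 < L"
begin

definition cell :: "nat \<Rightarrow> real ^ 'n \<Rightarrow> (real ^ 'n) set" where
  "cell n x = {y. \<forall>i. \<lfloor>2 ^ n * ((y $ i - a $ i) / L)\<rfloor> = \<lfloor>2 ^ n * ((x $ i - a $ i) / L)\<rfloor>}"

definition corner :: "nat \<Rightarrow> real ^ 'n \<Rightarrow> real ^ 'n" where
  "corner n x = (\<chi> i. a $ i + L / 2 ^ n * \<lfloor>2 ^ n * ((x $ i - a $ i) / L)\<rfloor>)"

abbreviation root :: "(real ^ 'n) set" where
  "root \<equiv> cell 0 a"

lemma cell_self [simp]: "x \<in> cell n x"
  by (simp add: cell_def)

lemma cell_eq: "y \<in> cell n x \<Longrightarrow> cell n y = cell n x"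
  by (auto simp: cell_def)

lemma cell_Suc_subset: "cell (Suc n) x \<subseteq> cell n x"
proof -
  have "\<lfloor>2 ^ n * t\<rfloor> = \<lfloor>2 ^ Suc n * t\<rfloor> div 2" for t :: real
    using floor_divide_real_eq_div[of 2 "2 ^ Suc n * t"] by simp
  then have "\<lfloor>2 ^ n * s\<rfloor> = \<lfloor>2 ^ n * t\<rfloor>" if "\<lfloor>2 ^ Suc n * s\<rfloor> = \<lfloor>2 ^ Suc n * t\<rfloor>" for s t :: real
    using that by metis
  then show ?thesis unfolding cell_def by blast
qed

lemma cell_antimono: "m \<le> n \<Longrightarrow> cell n x \<subseteq> cell m x"
  by (rule lift_Suc_antimono_le[of "\<lambda>n. cell n x"]) (auto intro: cell_Suc_subset[THEN subsetD])

lemma cell_iff: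
  "y \<in> cell n x \<longleftrightarrow> (\<forall>i. corner n x $ i \<le> y $ i \<and> y $ i < corner n x $ i + L / 2 ^ n)"
proof -
  have "\<lfloor>2 ^ n * ((y $ i - a $ i) / L)\<rfloor> = k \<longleftrightarrow>
      a $ i + L / 2 ^ n * k \<le> y $ i \<and> y $ i < a $ i + L / 2 ^ n * k + L / 2 ^ n" for i and k :: int
    using L_pos by (simp add: floor_eq_iff field_simps)
  then show ?thesis by (simp add: cell_def corner_def)
qed

lemma box_subset_cell: "box (corner n x) (corner n x + (\<chi> i. L / 2 ^ n)) \<subseteq> cell n x"
  by (auto simp: cell_iff mem_box_cart less_imp_le)

lemma cell_subset_cbox: "cell n x \<subseteq> cbox (corner n x) (corner n x + (\<chi> i. L / 2 ^ n))"
  by (auto simp: cell_iff mem_box_cart less_imp_le)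

lemma cell_borel [measurable]: "cell n x \<in> sets borel"
  unfolding cell_def by measurable

lemma cell_lebesgue [measurable]: "cell n x \<in> sets lebesgue"
  using cell_borel by simp

lemma emeasure_cell: "vol (cell n x) = ennreal ((L / 2 ^ n) ^ CARD('n))"
proof (rule antisym)
  have h: "0 < L / 2 ^ n" using L_pos by simp
  show "vol (cell n x) \<le> ennreal ((L / 2 ^ n) ^ CARD('n))"
    unfolding emeasure_lebesgue_cube(1)[OF h, of "corner n x", symmetric]
    by (intro emeasure_mono cell_subset_cbox) auto
  show "ennreal ((L / 2 ^ n) ^ CARD('n)) \<le> vol (cell n x)"
    unfolding emeasure_lebesgue_cube(2)[OF h, of "corner n x", symmetric]
    by (intro emeasure_mono box_subset_cell cell_lebesgue)
qed

lemma measure_cell: "measure lebesgue (cell n x) = (L / 2 ^ n) ^ CARD('n)"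
  using L_pos by (simp add: measure_def emeasure_cell)

lemma cell_lmeasurable: "cell n x \<in> lmeasurable"
  by (simp add: fmeasurable_def emeasure_cell)

lemma bounded_cell: "bounded (cell n x)"
  using bounded_subset[OF bounded_cbox cell_subset_cbox] .

lemma emeasure_cell_Suc: "vol (cell n x) = 2 ^ CARD('n) * vol (cell (Suc n) y)"
proof -
  have "(L / 2 ^ n) ^ CARD('n) = 2 ^ CARD('n) * (L / 2 ^ Suc n) ^ CARD('n)"
    by (simp add: power_mult_distrib[symmetric])
  then show ?thesis using L_pos
    by (simp add: emeasure_cell ennreal_mult ennreal_power[symmetric])
qed

lemma cell_dist:
  assumes "y \<in> cell n x" "z \<in> cell n x"
  shows "dist y z \<le> CARD('n) * (L / 2 ^ n)"
proof -
  have "\<bar>(y - z) $ i\<bar> \<le> L / 2 ^ n" for i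
    using assms by (auto simp: cell_iff abs_le_iff) (smt (verit))+
  then have "(\<Sum>i\<in>UNIV. \<bar>(y - z) $ i\<bar>) \<le> of_nat (card (UNIV :: 'n set)) * (L / 2 ^ n)"
    by (intro sum_bounded_above) auto
  then show ?thesis
    using norm_le_l1_cart[of "y - z"] by (simp add: dist_norm)
qed

lemma countable_cells: "countable (range (cell n))"
proof -
  have "cell n x = (\<lambda>k :: int ^ 'n. {y. \<forall>i. \<lfloor>2 ^ n * ((y $ i - a $ i) / L)\<rfloor> = k $ i})
      (\<chi> i. \<lfloor>2 ^ n * ((x $ i - a $ i) / L)\<rfloor>)" for x
    by (simp add: cell_def)
  then have "range (cell n) \<subseteq> range (\<lambda>k :: int ^ 'n. {y. \<forall>i. \<lfloor>2 ^ n * ((y $ i - a $ i) / L)\<rfloor> = k $ i})"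
    by blast
  then show ?thesis by (rule countable_subset) simp
qed

lemma small_cell:
  assumes "open U" "y \<in> U" shows "\<exists>m\<ge>n. cell m y \<subseteq> U"
proof -
  obtain e where e: "0 < e" "ball y e \<subseteq> U" using assms by (auto simp: open_contains_ball)
  obtain k where k: "CARD('n) * L / e < 2 ^ k" using real_arch_pow[of 2] by auto
  let ?m = "max n k"
  have "CARD('n) * L / e < 2 ^ ?m"
    by (rule less_le_trans[OF k]) (auto intro: power_increasing)
  then have "CARD('n) * (L / 2 ^ ?m) < e"
    using e by (simp add: field_simps)
  then have "cell ?m y \<subseteq> ball y e"
    using cell_dist[of y ?m y] by (fastforce simp: dist_commute)
  then show ?thesis using e by (intro exI[of _ ?m]) auto
qed

text \<open>Two dyadic cells are nested or disjoint, so the maximal ones among the subcells with property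
  \<open>P\<close> of a fixed cell are pairwise disjoint, and they cover all subcells with property \<open>P\<close>.\<close>

lemma maximal_cells:
  obtains T where "countable T" "disjoint T" "\<Union>T = {y \<in> cell n x. \<exists>m\<ge>n. P (cell m y)}"
    "\<forall>C\<in>T. \<exists>m\<ge>n. \<exists>y\<in>cell n x. C = cell m y \<and> P C \<and> (\<forall>j. n \<le> j \<and> j < m \<longrightarrow> \<not> P (cell j y))"
proof
  define S where "S m y \<longleftrightarrow> n \<le> m \<and> y \<in> cell n x \<and> P (cell m y) \<and> (\<forall>j. n \<le> j \<and> j < m \<longrightarrow> \<not> P (cell j y))"
    for m y
  let ?T = "{cell m y | m y. S m y}"
  have "?T \<subseteq> (\<Union>m. range (cell m))" by auto
  then show "countable ?T"
    by (rule countable_subset) (simp add: countable_cells)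
  have eq: "cell m y = cell m' y'" if "S m y" "S m' y'" "m \<le> m'" "z \<in> cell m y" "z \<in> cell m' y'" for m y m' y' z
  proof -
    have "z \<in> cell m y'" using that cell_antimono by blast
    then have "cell m y = cell m y'" using that cell_eq by metis
    moreover from this have "m = m'" using that unfolding S_def by (metis order.not_eq_order_implies_strict)
    ultimately show ?thesis by simp
  qed
  show "disjoint ?T"
  proof (rule disjointI)
    fix C D assume "C \<in> ?T" "D \<in> ?T" "C \<noteq> D"
    then obtain m y m' y' where "C = cell m y" "D = cell m' y'" "S m y" "S m' y'" by auto
    then show "C \<inter> D = {}"
      using eq[of m y m' y'] eq[of m' y' m y] \<open>C \<noteq> D\<close> by (cases "m \<le> m'") auto
  qed
  show "\<Union>?T = {y \<in> cell n x. \<exists>m\<ge>n. P (cell m y)}"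
  proof (intro equalityI subsetI)
    fix z assume "z \<in> \<Union>?T"
    then obtain m y where my: "z \<in> cell m y" "S m y" by auto
    then have "z \<in> cell n y" using cell_antimono unfolding S_def by blast
    then show "z \<in> {y \<in> cell n x. \<exists>m\<ge>n. P (cell m y)}"
      using my cell_eq[of z m y] cell_eq[of y n x] unfolding S_def by auto
  next
    fix z assume "z \<in> {y \<in> cell n x. \<exists>m\<ge>n. P (cell m y)}"
    then have z: "z \<in> cell n x" "\<exists>m. n \<le> m \<and> P (cell m z)" by auto
    let ?m = "LEAST m. n \<le> m \<and> P (cell m z)"
    have "n \<le> ?m \<and> P (cell ?m z)" by (rule LeastI_ex[OF z(2)])
    moreover have "\<not> P (cell j z)" if "n \<le> j" "j < ?m" for j
      using not_less_Least[OF that(2)] that(1) by blast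
    ultimately have "S ?m z" using z(1) unfolding S_def by blast
    then show "z \<in> \<Union>?T" using cell_self by blast
  qed
  show "\<forall>C\<in>?T. \<exists>m\<ge>n. \<exists>y\<in>cell n x. C = cell m y \<and> P C \<and> (\<forall>j. n \<le> j \<and> j < m \<longrightarrow> \<not> P (cell j y))"
    unfolding S_def by blast
qed

end

text \<open>The form in which estimates on the cells of a partition are added up.  The sets \<open>X C\<close> may be
  proper subsets of the cells, and the two measures may differ.\<close>

lemma emeasure_UN_le_mult:
  assumes "countable T" "disjoint T" "sets N = sets M"
    and T: "\<And>C. C \<in> T \<Longrightarrow> C \<in> sets M" "\<And>C. C \<in> T \<Longrightarrow> X C \<in> sets M" "\<And>C. C \<in> T \<Longrightarrow> X C \<subseteq> C"
    and le: "\<And>C. C \<in> T \<Longrightarrow> emeasure M (X C) \<le> k * emeasure N C"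
  shows "emeasure M (\<Union>C\<in>T. X C) \<le> k * emeasure N (\<Union>T)"
proof -
  have dis: "disjoint_family_on (\<lambda>C. C) T" "disjoint_family_on X T"
    using assms(2) T(3) unfolding disjoint_family_on_def disjoint_def by blast+
  have "emeasure M (\<Union>C\<in>T. X C) = (\<integral>\<^sup>+C. emeasure M (X C) \<partial>count_space T)"
    using assms dis by (intro emeasure_UN_countable) auto
  also have "\<dots> \<le> (\<integral>\<^sup>+C. k * emeasure N C \<partial>count_space T)"
    using le by (intro nn_integral_mono) auto
  also have "\<dots> = k * (\<integral>\<^sup>+C. emeasure N C \<partial>count_space T)"
    by (simp add: nn_integral_cmult)
  also have "(\<integral>\<^sup>+C. emeasure N C \<partial>count_space T) = emeasure N (\<Union>C\<in>T. C)"
    using assms dis by (intro emeasure_UN_countable[symmetric]) auto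
  finally show ?thesis by simp
qed

context dyadic_grid
begin

text \<open>Dyadic differentiation.  Suppose that \<open>g > c + \<delta>\<close> on a set \<open>F\<close> none of whose points lies in a cell
  of generation at least \<open>n\<close> with average above \<open>c\<close>.  Take an open set that contains \<open>F\<close> and has
  almost the same measure, and its maximal cells that meet \<open>F\<close>.  They cover \<open>F\<close>, so the integral of
  \<open>g\<close> over their union is at least \<open>(c + \<delta>) |F|\<close>; but it exceeds \<open>c |F|\<close> by arbitrarily little.\<close>

lemma AE_le_if_cell_averages_le:
  assumes g [measurable]: "g \<in> borel_measurable lebesgue"
  shows "AE y in lebesgue. y \<in> cell n x \<longrightarrow>
     (\<forall>m\<ge>n. (\<integral>\<^sup>+z\<in>cell m y. g z \<partial>lebesgue) \<le> ennreal c * vol (cell m y)) \<longrightarrow> g y \<le> ennreal c"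
proof -
  let ?P = "\<lambda>C. \<not> (\<integral>\<^sup>+z\<in>C. g z \<partial>lebesgue) \<le> ennreal c * vol C"
  obtain T where T: "countable T" "disjoint T" "\<Union>T = {y \<in> cell n x. \<exists>m\<ge>n. ?P (cell m y)}"
    "\<forall>C\<in>T. \<exists>m\<ge>n. \<exists>y\<in>cell n x. C = cell m y \<and> ?P C \<and> (\<forall>j. n \<le> j \<and> j < m \<longrightarrow> \<not> ?P (cell j y))"
    by (rule maximal_cells[of n x ?P]) (rule that)
  define G where "G = cell n x - \<Union>T"
  have "\<Union>T \<in> sets lebesgue"
    using T(4) by (intro sets.countable_Union T(1)) auto
  then have G [measurable]: "G \<in> sets lebesgue" by (auto simp: G_def)
  have null: "{y \<in> G. ennreal c + ennreal d < g y} \<in> null_sets lebesgue" if "0 < d" for d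
  proof -
    define F where "F = {y \<in> G. ennreal c + ennreal d < g y}"
    have "F = G \<inter> {y \<in> space lebesgue. ennreal c + ennreal d < g y}" by (auto simp: F_def)
    then have F [measurable]: "F \<in> sets lebesgue" by simp
    have fin: "vol F < top"
    proof -
      have "vol F \<le> vol (cell n x)"
        by (intro emeasure_mono) (auto simp: F_def G_def)
      then show ?thesis by (simp add: emeasure_cell order.strict_trans1)
    qed
    have *: "ennreal d * vol F \<le> ennreal c * ennreal e" if "0 < e" for e
    proof -
      obtain U where U: "open U" "F \<subseteq> U" "vol (U - F) < ennreal e"
        using sets_lebesgue_outer_open[OF F \<open>0 < e\<close>] by metis
      obtain K where K: "countable K" "disjoint K"
        "\<Union>K = {y \<in> cell n x. \<exists>m\<ge>n. cell m y \<subseteq> U \<and> cell m y \<inter> F \<noteq> {}}"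
        "\<forall>C\<in>K. \<exists>m\<ge>n. \<exists>y\<in>cell n x. C = cell m y \<and> (C \<subseteq> U \<and> C \<inter> F \<noteq> {})
              \<and> (\<forall>j. n \<le> j \<and> j < m \<longrightarrow> \<not> (cell j y \<subseteq> U \<and> cell j y \<inter> F \<noteq> {}))"
        by (rule maximal_cells[of n x "\<lambda>C. C \<subseteq> U \<and> C \<inter> F \<noteq> {}"]) (rule that)
      have sets: "C \<in> sets lebesgue" if "C \<in> K" for C using K(4) that by auto
      have UK [measurable]: "\<Union>K \<in> sets lebesgue" by (intro sets.countable_Union K(1)) (auto simp: sets)
      have FK: "F \<subseteq> \<Union>K"
      proof
        fix y assume y: "y \<in> F"
        then obtain m where "n \<le> m" "cell m y \<subseteq> U" using small_cell[OF U(1), of y n] U(2) by auto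
        moreover have "y \<in> cell m y \<inter> F" "y \<in> cell n x" using y by (auto simp: F_def G_def)
        ultimately show "y \<in> \<Union>K" unfolding K(3) by blast
      qed
      have KU: "\<Union>K \<subseteq> U"
      proof
        fix y assume "y \<in> \<Union>K"
        then show "y \<in> U" using cell_self unfolding K(3) by blast
      qed
      have "emeasure (density lebesgue g) (\<Union>C\<in>K. C) \<le> ennreal c * vol (\<Union>K)"
      proof (rule emeasure_UN_le_mult[OF K(1,2)])
        fix C assume C: "C \<in> K"
        obtain m y where my: "n \<le> m" "y \<in> cell n x" "C = cell m y" "C \<inter> F \<noteq> {}"
          using bspec[OF K(4) C] by metis
        then obtain z where z: "z \<in> C" "z \<in> F" by blast
        have "C = cell m z" using z my cell_eq by metis
        moreover have "\<not> ?P (cell m z)" using z(2) my(1) unfolding F_def G_def T(3) by blast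
        ultimately show "emeasure (density lebesgue g) C \<le> ennreal c * vol C"
          by (simp add: emeasure_density)
      qed (auto simp: sets)
      also have "vol (\<Union>K) \<le> vol F + vol (U - F)"
      proof -
        have "vol (\<Union>K) \<le> vol (F \<union> (U - F))"
          using KU U(1) by (intro emeasure_mono) auto
        also have "\<dots> \<le> vol F + vol (U - F)"
          using U(1) by (intro emeasure_subadditive) auto
        finally show ?thesis .
      qed
      also have "\<dots> \<le> vol F + ennreal e"
        using U(3) by (intro add_left_mono) auto
      finally have 1: "emeasure (density lebesgue g) (\<Union>C\<in>K. C) \<le> ennreal c * (vol F + ennreal e)"
        by (simp add: mult_left_mono)
      have "(ennreal c + ennreal d) * vol F = (\<integral>\<^sup>+y\<in>F. (ennreal c + ennreal d) \<partial>lebesgue)"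
        by (simp add: nn_integral_cmult_indicator)
      also have "\<dots> \<le> (\<integral>\<^sup>+y\<in>\<Union>K. g y \<partial>lebesgue)"
        using FK by (intro nn_integral_mono) (auto simp: F_def indicator_def)
      also have "\<dots> = emeasure (density lebesgue g) (\<Union>C\<in>K. C)"
        by (simp add: emeasure_density)
      finally have "(ennreal c + ennreal d) * vol F
          \<le> ennreal c * (vol F + ennreal e)"
        using 1 by (rule order_trans)
      then have "ennreal c * vol F + ennreal d * vol F
          \<le> ennreal c * vol F + ennreal c * ennreal e"
        unfolding distrib_left distrib_right .
      moreover have "ennreal c * vol F \<noteq> top"
        using fin by (auto simp: ennreal_mult_eq_top_iff)
      ultimately show ?thesis
        unfolding ennreal_add_left_cancel_le by simp
    qed
    have le: "ennreal d * vol F \<le> ennreal (max c 0 * e)" if "0 < e" for e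
    proof -
      have "ennreal c = ennreal (max c 0)" by (cases "0 \<le> c") (auto simp: max_def ennreal_neg)
      then show ?thesis using *[OF that] that by (metis ennreal_mult less_imp_le max.cobounded2)
    qed
    have "ennreal d * vol F \<le> 0"
    proof (rule ennreal_le_epsilon)
      fix e :: real assume "0 < e"
      have "t * (e / (t + 1)) \<le> e" if "0 \<le> t" for t
        using that \<open>0 < e\<close> by (simp add: field_simps)
      then have "max c 0 * (e / (max c 0 + 1)) \<le> e" by simp
      moreover have "0 < e / (max c 0 + 1)"
        using \<open>0 < e\<close> by (intro divide_pos_pos) auto
      ultimately show "ennreal d * vol F \<le> 0 + ennreal e"
        using order_trans[OF le ennreal_leI] by simp
    qed
    then show ?thesis using \<open>0 < d\<close> F by (simp add: null_sets_def F_def[symmetric])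
  qed
  have "(\<Union>k. {y \<in> G. ennreal c + ennreal (1 / Suc k) < g y}) \<in> null_sets lebesgue"
    by (intro null_sets_UN null) auto
  then have "AE y in lebesgue. y \<notin> (\<Union>k. {y \<in> G. ennreal c + ennreal (1 / Suc k) < g y})"
    by (rule AE_not_in)
  then show ?thesis
  proof (eventually_elim, intro impI)
    fix y assume y: "y \<notin> (\<Union>k. {y \<in> G. ennreal c + ennreal (1 / Suc k) < g y})" "y \<in> cell n x"
      "\<forall>m\<ge>n. (\<integral>\<^sup>+z\<in>cell m y. g z \<partial>lebesgue) \<le> ennreal c * vol (cell m y)"
    then have "y \<in> G" unfolding G_def T(3) by auto
    then have le: "g y \<le> ennreal c + ennreal (1 / Suc k)" for k using y(1) by (auto simp: not_less)
    show "g y \<le> ennreal c"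
    proof (rule ennreal_le_epsilon)
      fix e :: real assume "0 < e"
      then obtain k where "1 / real (Suc k) < e" using nat_approx_posE by (metis)
      then have "ennreal c + ennreal (1 / Suc k) \<le> ennreal c + ennreal e"
        by (intro add_left_mono ennreal_leI) auto
      then show "g y \<le> ennreal c + ennreal e" using le order_trans by blast
    qed
  qed
qed

end

section \<open>A weighted John--Nirenberg inequality\<close>

context dyadic_grid
begin

lemma cell_subset_root: "y \<in> root \<Longrightarrow> cell n y \<subseteq> root"
  using cell_eq[of y 0 a] cell_antimono[of 0 n y] by auto

text \<open>The induction step is a Calderon--Zygmund decomposition of \<open>Q\<close>: outside the maximal subcells on
  which \<open>|f - f\<^sub>Q|\<close> has average above \<open>2A\<close> the function \<open>|f - f\<^sub>Q|\<close> is at most \<open>2A\<close>, these subcells fill at most half of \<open>Q\<close>, and on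
  each of them the average of \<open>f\<close> differs from \<open>f\<^sub>Q\<close> by at most \<open>\<lambda> = 2\<^bsup>d+1\<^esup> A\<close>.  So the set where
  \<open>|f - f\<^sub>Q| > (k+1)\<lambda>\<close> is covered by the sets where \<open>|f - f\<^bsub>Q'\<^esub>| > k\<lambda>\<close> in these subcells \<open>Q'\<close>, and
  each step gains the factor \<open>b\<close>, which bounds the proportion of the \<open>W\<close>-measure of a cell that
  lies in a set of at most half of its Lebesgue measure.\<close>

lemma weighted_John_Nirenberg:
  fixes f :: "real ^ 'n \<Rightarrow> real"
  assumes f: "locally_integrable f" and A: "0 < A"
    and osc: "\<And>m y. y \<in> root \<Longrightarrow> deviation f (average (cell m y) f) (cell m y)
              \<le> ennreal A * vol (cell m y)"
    and W: "sets W = sets lebesgue" "null_sets lebesgue \<subseteq> null_sets W"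
    and half: "\<And>m y E. y \<in> root \<Longrightarrow> E \<in> sets lebesgue \<Longrightarrow> E \<subseteq> cell m y \<Longrightarrow>
              2 * vol E \<le> vol (cell m y) \<Longrightarrow>
              emeasure W E \<le> b * emeasure W (cell m y)"
    and y: "y \<in> root"
  shows "emeasure W {z \<in> cell n y. real k * (2 ^ (CARD('n) + 1) * A) < \<bar>f z - average (cell n y) f\<bar>}
           \<le> b ^ k * emeasure W (cell n y)"
  using y
proof (induction k arbitrary: n y)
  case 0
  then show ?case using W by (auto intro!: emeasure_mono)
next
  case (Suc k)
  note [measurable] = locally_integrable_measurable[OF f]
  define lam where "lam = 2 ^ (CARD('n) + 1) * A"
  define Q where "Q = cell n y"
  define c where "c = average Q f"
  have Q: "Q \<in> sets lebesgue" by (simp add: Q_def)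
  have lam: "0 < lam" "2 * A \<le> lam"
    using A by (auto simp: lam_def)
  let ?P = "\<lambda>C. \<not> deviation f c C \<le> ennreal (2 * A) * vol C"
  obtain T where T: "countable T" "disjoint T" "\<Union>T = {z \<in> cell n y. \<exists>m\<ge>n. ?P (cell m z)}"
    "\<forall>C\<in>T. \<exists>m\<ge>n. \<exists>x\<in>cell n y. C = cell m x \<and> ?P C \<and> (\<forall>j. n \<le> j \<and> j < m \<longrightarrow> \<not> ?P (cell j x))"
    by (rule maximal_cells[of n y ?P]) (rule that)
  define X where "X C = {z \<in> C. real k * lam < \<bar>f z - average C f\<bar>}" for C
  have TQ: "\<Union>T \<subseteq> Q" unfolding T(3) Q_def by blast
  have oscQ: "deviation f c Q \<le> ennreal A * vol Q"
    using osc[OF Suc.prems] by (simp add: Q_def c_def)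
  have T_sets: "C \<in> sets lebesgue" if "C \<in> T" for C
    using bspec[OF T(4) that] by auto
  have E: "\<Union>T \<in> sets lebesgue"
    by (intro sets.countable_Union T(1)) (auto simp: T_sets)
  have X_sets: "X C \<in> sets lebesgue" if "C \<in> T" for C
  proof -
    have "X C = C \<inter> {z \<in> space lebesgue. real k * lam < \<bar>f z - average C f\<bar>}" by (auto simp: X_def)
    then show ?thesis using T_sets[OF that] by simp
  qed
  have cellT: "\<exists>m x. x \<in> root \<and> C = cell m x \<and> ennreal (2 * A) * vol C
      \<le> deviation f c C \<and> \<bar>average C f - c\<bar> \<le> lam" if CT: "C \<in> T" for C
  proof -
    obtain m x where m: "n \<le> m" "x \<in> cell n y" "C = cell m x" "?P C"
      "\<forall>j. n \<le> j \<and> j < m \<longrightarrow> \<not> ?P (cell j x)"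
      using bspec[OF T(4) CT] by (elim exE bexE conjE) (rule that)
    have x: "x \<in> root" using m(2) cell_subset_root[OF Suc.prems] by blast
    have "m \<noteq> n"
    proof
      assume "m = n"
      then have "C = Q" using m cell_eq by (simp add: Q_def)
      moreover have "ennreal A * vol Q \<le> ennreal (2 * A) * vol Q"
        using A by (intro mult_right_mono ennreal_leI) auto
      ultimately show False using oscQ m(4) by (meson order_trans)
    qed
    then obtain m' where m': "m = Suc m'" "n \<le> m'" using m(1) by (cases m) auto
    have "ennreal \<bar>average C f - c\<bar> * vol C \<le> deviation f c C"
      unfolding m(3) using L_pos cell_lmeasurable
      by (intro average_diff_le locally_integrable_bounded f bounded_cell) (auto simp: measure_cell)
    also have "\<dots> \<le> deviation f c (cell m' x)"
      using cell_Suc_subset[of m' x] unfolding m(3) m'(1)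
      by (intro nn_integral_mono) (auto simp: indicator_def)
    also have "\<dots> \<le> ennreal (2 * A) * vol (cell m' x)"
      using m(5) m' by auto
    also have "\<dots> = ennreal lam * vol C"
    proof -
      have "ennreal lam = ennreal (2 * A) * 2 ^ CARD('n)"
        using A by (simp add: lam_def ennreal_mult ennreal_power[symmetric] mult_ac)
      then show ?thesis
        unfolding m(3) m'(1) emeasure_cell_Suc[of m' x x] by (simp add: mult.assoc)
    qed
    finally have "ennreal \<bar>average C f - c\<bar> * ennreal ((L / 2 ^ m) ^ CARD('n))
        \<le> ennreal lam * ennreal ((L / 2 ^ m) ^ CARD('n))"
      by (simp add: m(3) emeasure_cell)
    then have "\<bar>average C f - c\<bar> \<le> lam"
      using L_pos lam by (simp add: ennreal_mult[symmetric])
    then show ?thesis using x m(3,4) by (intro exI[of _ m] exI[of _ x]) auto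
  qed
  let ?D = "emeasure (density lebesgue (\<lambda>z. ennreal \<bar>f z - c\<bar>))"
  have "vol (\<Union>C\<in>T. C)
      \<le> ennreal (1 / (2 * A)) * ?D (\<Union>T)"
  proof (rule emeasure_UN_le_mult[OF T(1,2)])
    fix C assume C: "C \<in> T"
    have "vol C = ennreal (1 / (2 * A)) * (ennreal (2 * A) * vol C)"
      using A by (simp add: mult.assoc[symmetric] ennreal_mult[symmetric])
    also have "\<dots> \<le> ennreal (1 / (2 * A)) * ?D C"
      using cellT[OF C] T_sets[OF C] by (intro mult_left_mono) (auto simp: emeasure_density)
    finally show "vol C
        \<le> ennreal (1 / (2 * A)) * ?D C" .
  qed (auto simp: T_sets)
  also have "\<dots> \<le> ennreal (1 / (2 * A)) * (ennreal A * vol Q)"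
  proof (intro mult_left_mono)
    have "?D (\<Union>T)
        \<le> ?D Q"
      using TQ Q by (intro emeasure_mono) auto
    also have "\<dots> \<le> ennreal A * vol Q"
      using oscQ Q by (simp add: emeasure_density)
    finally show "?D (\<Union>T) \<le> ennreal A * vol Q" .
  qed simp
  also have "\<dots> = ennreal (1 / 2) * vol Q"
    using A by (simp add: mult.assoc[symmetric] ennreal_mult[symmetric])
  finally have "2 * vol (\<Union>T) \<le> 2 * (ennreal (1 / 2) * vol Q)"
    by (intro mult_left_mono) auto
  also have "2 * (ennreal (1 / 2) * vol Q) = vol Q"
  proof -
    have "2 * ennreal (1 / 2) = 1"
      by (subst ennreal_numeral[symmetric], subst ennreal_mult[symmetric]) auto
    then show ?thesis by (simp add: mult.assoc[symmetric])
  qed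
  finally have WE: "emeasure W (\<Union>T) \<le> b * emeasure W Q"
    unfolding Q_def using TQ E Suc.prems by (intro half) (auto simp: Q_def)
  define N where "N = {z \<in> Q. z \<notin> \<Union>T \<and> lam < \<bar>f z - c\<bar>}"
  have "N = (Q - \<Union>T) \<inter> {z \<in> space lebesgue. lam < \<bar>f z - c\<bar>}" by (auto simp: N_def)
  then have N_sets: "N \<in> sets lebesgue" using Q E by simp
  have "AE z in lebesgue. z \<notin> N"
  proof -
    have "(\<lambda>z. ennreal \<bar>f z - c\<bar>) \<in> borel_measurable lebesgue" by measurable
    from AE_le_if_cell_averages_le[OF this, of n y "2 * A"]
    show ?thesis
    proof eventually_elim
      case (elim z)
      show ?case
      proof
        assume z: "z \<in> N"
        then have "z \<in> cell n y" "\<forall>m\<ge>n. \<not> ?P (cell m z)"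
          using T(3) by (auto simp: N_def Q_def)
        then have "ennreal \<bar>f z - c\<bar> \<le> ennreal (2 * A)" using elim by blast
        then have "\<bar>f z - c\<bar> \<le> 2 * A" using A by (simp add: ennreal_le_iff)
        then show False using z lam by (simp add: N_def)
      qed
    qed
  qed
  then have "N \<in> null_sets lebesgue"
    using N_sets by (simp add: AE_iff_null_sets)
  then have WN: "emeasure W N = 0" using W(2) by blast
  have "{z \<in> Q. real (Suc k) * lam < \<bar>f z - c\<bar>} \<subseteq> N \<union> (\<Union>C\<in>T. X C)"
  proof
    fix z assume z: "z \<in> {z \<in> Q. real (Suc k) * lam < \<bar>f z - c\<bar>}"
    show "z \<in> N \<union> (\<Union>C\<in>T. X C)"
    proof (cases "z \<in> \<Union>T")
      case True
      then obtain C where C: "C \<in> T" "z \<in> C" by blast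
      then have "\<bar>average C f - c\<bar> \<le> lam" using cellT by blast
      moreover have "real k * lam + lam < \<bar>f z - c\<bar>" using z by (simp add: distrib_right)
      ultimately have "real k * lam < \<bar>f z - average C f\<bar>" by linarith
      then show ?thesis using C by (auto simp: X_def)
    next
      case False
      have "1 * lam \<le> real (Suc k) * lam" using lam by (intro mult_right_mono) auto
      then show ?thesis using z False by (auto simp: N_def)
    qed
  qed
  then have "emeasure W {z \<in> Q. real (Suc k) * lam < \<bar>f z - c\<bar>} \<le> emeasure W (N \<union> (\<Union>C\<in>T. X C))"
    using N_sets T(1) X_sets W(1) by (intro emeasure_mono) auto
  also have "\<dots> \<le> emeasure W N + emeasure W (\<Union>C\<in>T. X C)"
    using N_sets T(1) X_sets W(1) by (intro emeasure_subadditive) auto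
  also have "\<dots> \<le> b ^ k * emeasure W (\<Union>T)"
  proof -
    have "emeasure W (\<Union>C\<in>T. X C) \<le> b ^ k * emeasure W (\<Union>T)"
    proof (rule emeasure_UN_le_mult[OF T(1,2)])
      fix C assume C: "C \<in> T"
      obtain m x where mx: "x \<in> root" "C = cell m x" using cellT[OF C] by blast
      show "emeasure W (X C) \<le> b ^ k * emeasure W C"
        using Suc.IH[OF mx(1), of m] mx(2) by (simp add: X_def lam_def)
      show "X C \<subseteq> C" by (auto simp: X_def)
    qed (auto simp: T_sets X_sets W)
    then show ?thesis by (simp add: WN)
  qed
  also have "\<dots> \<le> b ^ k * (b * emeasure W Q)"
    by (intro mult_left_mono WE) simp
  finally show ?case
    by (simp add: Q_def c_def lam_def mult_ac)
qed

end

text \<open>A layer cake bound with layers of height \<open>\<lambda>\<close>: a point with \<open>k \<lambda> < h \<le> (k+1) \<lambda>\<close> is counted by the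
  summand \<open>k\<close>.\<close>

lemma nn_integral_powr_le_level_sets:
  fixes h :: "'a \<Rightarrow> real"
  assumes h [measurable]: "h \<in> borel_measurable M" and Q [measurable]: "Q \<in> sets M"
    and nn: "\<And>x. 0 \<le> h x" and q: "0 < q" and lam: "0 < lam"
  shows "(\<integral>\<^sup>+x\<in>Q. ennreal (h x powr q) \<partial>M)
           \<le> (\<Sum>k. ennreal ((real (Suc k) * lam) powr q) * emeasure M {x \<in> Q. real k * lam < h x})"
proof -
  have sets: "{x \<in> Q. real k * lam < h x} \<in> sets M" for k
  proof -
    have "{x \<in> Q. real k * lam < h x} = Q \<inter> {x \<in> space M. real k * lam < h x}"
      using sets.sets_into_space[OF Q] by auto
    then show ?thesis by simp
  qed
  have "(\<integral>\<^sup>+x\<in>Q. ennreal (h x powr q) \<partial>M)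
      \<le> (\<integral>\<^sup>+x. (\<Sum>k. ennreal ((real (Suc k) * lam) powr q) * indicator {x \<in> Q. real k * lam < h x} x) \<partial>M)"
  proof (intro nn_integral_mono)
    fix x
    let ?F = "\<lambda>k. ennreal ((real (Suc k) * lam) powr q) * indicator {x \<in> Q. real k * lam < h x} x"
    show "ennreal (h x powr q) * indicator Q x \<le> (\<Sum>k. ?F k)"
    proof (cases "x \<in> Q \<and> 0 < h x")
      case True
      define k where "k = nat (\<lceil>h x / lam\<rceil> - 1)"
      have "0 < h x / lam" using True lam by simp
      then have k: "real k = \<lceil>h x / lam\<rceil> - 1" by (simp add: k_def)
      then have "real k < h x / lam" "h x / lam \<le> real (Suc k)" by linarith+
      then have kk: "real k * lam < h x" "h x \<le> real (Suc k) * lam"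
        using lam by (simp_all add: field_simps)
      have "ennreal (h x powr q) * indicator Q x \<le> ?F k"
        using True kk q nn by (auto intro!: ennreal_leI powr_mono2)
      also have "\<dots> = (\<Sum>j\<in>{k}. ?F j)"
        by (simp only: sum.insert finite.emptyI empty_iff not_False_eq_True sum.empty add_0_right)
      also have "\<dots> \<le> (\<Sum>j. ?F j)" by (intro sum_le_suminf) auto
      finally show ?thesis .
    next
      case False
      then have "x \<notin> Q \<or> h x = 0" using nn[of x] by auto
      then show ?thesis by auto
    qed
  qed
  also have "\<dots> = (\<Sum>k. \<integral>\<^sup>+x. ennreal ((real (Suc k) * lam) powr q) * indicator {x \<in> Q. real k * lam < h x} x \<partial>M)"
    using sets by (intro nn_integral_suminf) auto
  also have "\<dots> = (\<Sum>k. ennreal ((real (Suc k) * lam) powr q) * emeasure M {x \<in> Q. real k * lam < h x})"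
    using sets by (simp add: nn_integral_cmult_indicator)
  finally show ?thesis .
qed

text \<open>The factor in front of \<open>\<delta>\<^bsup>-(q+2)\<^esup>\<close> in the estimate of \<open>\<Sum>\<^sub>k (k+1)\<^sup>q (1 - \<delta>)\<^sup>k\<close> below.\<close>

definition moment_const :: "real \<Rightarrow> real" where
  "moment_const q = exp 1 * (q + 2) powr (q + 2) * (\<Sum>k. 1 / (real (Suc k))\<^sup>2)"

lemma summable_inverse_Suc_squares: "summable (\<lambda>k. 1 / (real (Suc k))\<^sup>2)"
proof -
  have "summable (\<lambda>k. inverse ((real k) ^ 2))" by (rule inverse_power_summable) simp
  then have "summable (\<lambda>k. inverse ((real (Suc k)) ^ 2))" by (subst summable_Suc_iff)
  then show ?thesis by (simp add: inverse_eq_divide)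
qed

lemma moment_const_pos: "0 < q \<Longrightarrow> 0 < moment_const q"
  unfolding moment_const_def
  by (intro mult_pos_pos suminf_pos summable_inverse_Suc_squares) auto

text \<open>Since \<open>(1 - \<delta>)\<^sup>k \<le> e\<^bsup>-\<delta>k\<^esup>\<close> and \<open>t\<^bsup>q+2\<^esup> e\<^bsup>-t\<^esup>\<close> is bounded, the summands are at most a constant times
  \<open>\<delta>\<^bsup>-(q+2)\<^esup> (k+1)\<^bsup>-2\<^esup>\<close>.  The growth in \<open>1/\<delta>\<close> is polynomial, which is all that the later estimates
  can absorb.\<close>

lemma powr_geometric_series_le:
  assumes q: "0 < q" and d: "0 < \<delta>" "\<delta> \<le> 1"
  shows "(\<Sum>k. ennreal (real (Suc k) powr q) * ennreal (1 - \<delta>) ^ k) \<le> ennreal (moment_const q * \<delta> powr - (q + 2))"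
proof -
  define a where "a = q + 2"
  have a: "0 < a" using q by (simp add: a_def)
  have exp_bound: "t powr a * exp (- t) \<le> a powr a" if "0 < t" for t
  proof -
    have "t / a \<le> exp (t / a)" using exp_ge_add_one_self[of "t / a"] by linarith
    then have "(t / a) powr a \<le> exp (t / a) powr a" using a that by (intro powr_mono2) auto
    also have "\<dots> = exp t" using a by (simp add: exp_powr_real)
    finally show ?thesis
      using a that by (simp add: powr_divide exp_minus field_simps)
  qed
  let ?K = "exp 1 * a powr a * \<delta> powr - a"
  have summand_le: "real (Suc k) powr q * (1 - \<delta>) ^ k \<le> ?K * (1 / (real (Suc k))\<^sup>2)" for k
  proof -
    let ?s = "real (Suc k)"
    have "(1 - \<delta>) ^ k \<le> exp (- \<delta>) ^ k"
      using d exp_ge_add_one_self[of "- \<delta>"] by (intro power_mono) auto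
    also have "\<dots> = exp \<delta> * exp (- (\<delta> * ?s))"
      by (simp add: exp_of_nat_mult[symmetric] exp_add[symmetric] algebra_simps)
    also have "\<dots> \<le> exp 1 * exp (- (\<delta> * ?s))"
      using d by (intro mult_right_mono) auto
    finally have "?s powr q * (1 - \<delta>) ^ k \<le> ?s powr q * (exp 1 * exp (- (\<delta> * ?s)))"
      by (intro mult_left_mono) auto
    also have "?s powr q * (exp 1 * exp (- (\<delta> * ?s)))
        = \<delta> powr - a * (\<delta> * ?s) powr a * (1 / ?s\<^sup>2) * (exp 1 * exp (- (\<delta> * ?s)))"
    proof -
      have "?s powr q = \<delta> powr - a * (\<delta> * ?s) powr a * (1 / ?s\<^sup>2)"
      proof -
        have "?s powr a = ?s powr q * ?s\<^sup>2" by (simp add: a_def powr_add powr_numeral del: of_nat_Suc)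
        then show ?thesis using d by (simp add: powr_mult powr_minus field_simps del: of_nat_Suc)
      qed
      then show ?thesis by (simp only:)
    qed
    also have "\<delta> powr - a * (\<delta> * ?s) powr a * (1 / ?s\<^sup>2) * (exp 1 * exp (- (\<delta> * ?s)))
        = exp 1 * \<delta> powr - a * (1 / ?s\<^sup>2) * ((\<delta> * ?s) powr a * exp (- (\<delta> * ?s)))"
      by (simp only: mult_ac)
    also have "\<dots> \<le> exp 1 * \<delta> powr - a * (1 / ?s\<^sup>2) * a powr a"
      using d by (intro mult_left_mono exp_bound) auto
    finally show ?thesis by (simp only: mult_ac)
  qed
  have "(\<Sum>k. ennreal (real (Suc k) powr q) * ennreal (1 - \<delta>) ^ k)
      = (\<Sum>k. ennreal (real (Suc k) powr q * (1 - \<delta>) ^ k))"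
    using d by (simp add: ennreal_mult ennreal_power del: of_nat_Suc)
  also have "\<dots> \<le> (\<Sum>k. ennreal (?K * (1 / (real (Suc k))\<^sup>2)))"
    by (intro suminf_le summableI ennreal_leI summand_le)
  also have "\<dots> = ennreal (\<Sum>k. ?K * (1 / (real (Suc k))\<^sup>2))"
    by (intro suminf_ennreal2 summable_mult summable_inverse_Suc_squares) auto
  also have "(\<Sum>k. ?K * (1 / (real (Suc k))\<^sup>2)) = moment_const q * \<delta> powr - (q + 2)"
    by (subst suminf_mult[OF summable_inverse_Suc_squares]) (simp add: moment_const_def a_def mult_ac)
  finally show ?thesis .
qed

context dyadic_grid
begin

text \<open>The complement of a set that fills at most half of a cell carries at least the fraction \<open>1 / \<Lambda>\<close>
  of its weight, so the weights of the level sets decay at the rate \<open>1 - 1 / \<Lambda>\<close>, and summing over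
  the levels loses only a power of \<open>\<Lambda>\<close>.\<close>

lemma weighted_oscillation_le:
  fixes f :: "real ^ 'n \<Rightarrow> real"
  assumes f: "locally_integrable f" and A: "0 < A" and q: "0 < q" and La: "1 \<le> \<Lambda>"
    and osc: "\<And>m y. y \<in> root \<Longrightarrow> deviation f (average (cell m y) f) (cell m y)
              \<le> ennreal A * vol (cell m y)"
    and W: "sets W = sets lebesgue" "null_sets lebesgue \<subseteq> null_sets W" "emeasure W root < top"
    and half: "\<And>m y F. y \<in> root \<Longrightarrow> F \<in> sets lebesgue \<Longrightarrow> F \<subseteq> cell m y \<Longrightarrow>
              vol (cell m y) \<le> 2 * vol F \<Longrightarrow>
              emeasure W (cell m y) \<le> ennreal \<Lambda> * emeasure W F"
  shows "(\<integral>\<^sup>+z\<in>root. ennreal (\<bar>f z - average root f\<bar> powr q) \<partial>W)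
           \<le> ennreal (moment_const q * \<Lambda> powr (q + 2) * (2 ^ (CARD('n) + 1) * A) powr q) * emeasure W root"
proof -
  note [measurable] = locally_integrable_measurable[OF f]
  define lam where "lam = 2 ^ (CARD('n) + 1) * A"
  have lam: "0 < lam" using A by (simp add: lam_def)
  have half': "emeasure W E \<le> ennreal (1 - 1 / \<Lambda>) * emeasure W (cell m y)"
    if "y \<in> root" "E \<in> sets lebesgue" "E \<subseteq> cell m y"
      "2 * vol E \<le> vol (cell m y)" for m y E
  proof -
    let ?F = "cell m y - E"
    have F: "?F \<in> sets lebesgue" using that by auto
    have "emeasure W (cell m y) \<le> emeasure W root"
      using cell_subset_root[OF that(1)] W(1) by (intro emeasure_mono) auto
    then have fin: "emeasure W (cell m y) < top" using W(3) by (rule le_less_trans)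
    have add: "emeasure W (cell m y) = emeasure W E + emeasure W ?F"
      using that F W(1) by (subst plus_emeasure) (auto simp: Un_absorb1)
    obtain x z where xz: "emeasure W E = ennreal x" "emeasure W ?F = ennreal z" "0 \<le> x" "0 \<le> z"
      using fin unfolding add by (cases "emeasure W E"; cases "emeasure W ?F") auto
    have "vol (cell m y) = vol E + vol ?F"
      using that F by (subst plus_emeasure) (auto simp: Un_absorb1)
    moreover obtain s t where st: "vol E = ennreal s" "vol ?F = ennreal t" "0 \<le> s" "0 \<le> t"
    proof -
      have "vol (cell m y) < top" by (simp only: emeasure_cell ennreal_less_top)
      then have "vol E + vol ?F < top"
        unfolding calculation .
      then show ?thesis using that by (cases "vol E"; cases "vol ?F") auto
    qed
    ultimately have "vol (cell m y) = ennreal (s + t)" by simp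
    moreover have two: "2 * ennreal r = ennreal (2 * r)" if "0 \<le> r" for r
      using that by (simp add: ennreal_mult)
    ultimately have "2 * s \<le> s + t"
      using that(4) st by (simp add: two del: ennreal_plus)
    then have "vol (cell m y) \<le> 2 * vol ?F"
      using \<open>vol (cell m y) = ennreal (s + t)\<close> st by (simp add: two ennreal_leI del: ennreal_plus)
    then have "emeasure W (cell m y) \<le> ennreal \<Lambda> * emeasure W ?F"
      using that F by (intro half) auto
    then have "x + z \<le> \<Lambda> * z"
      unfolding add xz using xz La by (simp add: ennreal_mult[symmetric] flip: ennreal_plus)
    then have "(x + z) / \<Lambda> \<le> z" using La by (simp add: field_simps)
    then have "x \<le> (1 - 1 / \<Lambda>) * (x + z)" by (simp add: algebra_simps add_divide_distrib)
    then show ?thesis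
      unfolding add xz using xz La by (simp add: ennreal_mult[symmetric] flip: ennreal_plus)
  qed
  let ?h = "\<lambda>z. \<bar>f z - average root f\<bar>"
  have hW: "?h \<in> borel_measurable W"
    by (subst measurable_cong_sets[OF W(1) refl]) measurable
  have rW: "root \<in> sets W" using W(1) by simp
  have "(\<integral>\<^sup>+z\<in>root. ennreal (?h z powr q) \<partial>W)
      \<le> (\<Sum>k. ennreal ((real (Suc k) * lam) powr q) * emeasure W {x \<in> root. real k * lam < ?h x})"
    by (intro nn_integral_powr_le_level_sets hW rW q lam) auto
  also have "\<dots> \<le> (\<Sum>k. ennreal ((real (Suc k) * lam) powr q) * (ennreal (1 - 1 / \<Lambda>) ^ k * emeasure W root))"
  proof (intro suminf_le summableI mult_left_mono)
    fix k
    show "emeasure W {x \<in> root. real k * lam < ?h x} \<le> ennreal (1 - 1 / \<Lambda>) ^ k * emeasure W root"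
      unfolding lam_def by (rule weighted_John_Nirenberg[OF f A osc W(1,2) half' cell_self])
  qed auto
  also have "\<dots> = (\<Sum>k. (ennreal (lam powr q) * emeasure W root)
      * (ennreal (real (Suc k) powr q) * ennreal (1 - 1 / \<Lambda>) ^ k))"
    using lam by (simp only: powr_mult of_nat_0_le_iff less_imp_le ennreal_mult powr_ge_zero mult_ac)
  also have "\<dots> = (ennreal (lam powr q) * emeasure W root)
      * (\<Sum>k. ennreal (real (Suc k) powr q) * ennreal (1 - 1 / \<Lambda>) ^ k)"
    by (rule ennreal_suminf_cmult)
  also have "\<dots> \<le> (ennreal (lam powr q) * emeasure W root) * ennreal (moment_const q * (1 / \<Lambda>) powr - (q + 2))"
    using La by (intro mult_left_mono powr_geometric_series_le q) auto
  also have "\<dots> = ennreal (moment_const q * \<Lambda> powr (q + 2) * lam powr q) * emeasure W root"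
  proof -
    have "(1 / \<Lambda>) powr - (q + 2) = \<Lambda> powr (q + 2)"
      using La powr_minus[of "1 / \<Lambda>" "q + 2"] by (simp add: powr_divide)
    then show ?thesis
      using moment_const_pos[OF q] by (simp add: ennreal_mult mult_ac)
  qed
  finally show ?thesis by (simp add: lam_def)
qed

end

section \<open>Growth of the critical radius\<close>

lemma divide_ennreal_real: "0 < m \<Longrightarrow> t / ennreal m = t * ennreal (1 / m)"
  by (simp add: divide_ennreal_def inverse_ennreal inverse_eq_divide)

lemma epowr_divide_real:
  assumes "0 < m" "0 < a" shows "(t / ennreal m) epowr a = t epowr a * ennreal (m powr - a)"
  using assms by (simp add: divide_ennreal_real epowr_mult epowr_ennreal powr_divide powr_minus_divide)

lemma measure_ball_conv:
  fixes x :: "real ^ 'n"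
  assumes "0 \<le> r"
  shows "measure lebesgue (ball x r) = measure lebesgue (ball (0 :: real ^ 'n) 1) * r ^ CARD('n)"
  using content_ball_conv_unit_ball[OF assms, of x] by (simp add: mult.commute)

lemma measure_unit_ball_pos: "0 < measure lebesgue (ball (0 :: real ^ 'n) 1)"
  using content_ball_pos[of 1 "0 :: real ^ 'n"] by simp

lemma measure_ball_pos: "0 < r \<Longrightarrow> 0 < measure lebesgue (ball (x :: real ^ 'n) r)"
  using content_ball_pos[of r x] by simp

lemma emeasure_ball_eq: "vol (ball x r) = ennreal (measure lebesgue (ball x r))"
  by (simp add: emeasure_eq_measure2)

lemma geometric_scale:
  fixes \<eta> r R :: real
  assumes \<eta>: "0 < \<eta>" "\<eta> < 1" and r: "0 < r" "r \<le> R"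
  defines "t \<equiv> ln (R / r) / ln (1 / \<eta>)"
  obtains n where "r \<le> \<eta> ^ n * R" "\<eta> ^ Suc n * R \<le> r" "real n \<le> t" "t \<le> real (Suc n)"
proof -
  define n where "n = nat \<lfloor>t\<rfloor>"
  have l: "0 < ln (1 / \<eta>)" "0 \<le> ln (R / r)" using \<eta> r by auto
  then have "0 \<le> t" by (simp add: t_def)
  then have n: "real n \<le> t" "t \<le> real (Suc n)" unfolding n_def by linarith+
  have lnp: "ln ((1 / \<eta>) ^ m) = real m * ln (1 / \<eta>)" for m using \<eta> by (simp add: ln_realpow)
  have "ln ((1 / \<eta>) ^ n) \<le> ln (R / r)" "ln (R / r) \<le> ln ((1 / \<eta>) ^ Suc n)"
    unfolding lnp using n l by (simp_all add: t_def field_simps del: of_nat_Suc)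
  then have "(1 / \<eta>) ^ n \<le> R / r" "R / r \<le> (1 / \<eta>) ^ Suc n"
    using r \<eta> by (simp_all add: ln_le_cancel_iff)
  then have "r \<le> \<eta> ^ n * R" "\<eta> ^ Suc n * R \<le> r"
    using r \<eta> by (simp_all add: field_simps power_divide)
  then show ?thesis using n by (rule that)
qed

lemma powr_growth_of_geometric_growth:
  fixes \<phi> :: "real \<Rightarrow> real"
  assumes mono: "\<And>s t. 0 < s \<Longrightarrow> s \<le> t \<Longrightarrow> \<phi> s \<le> \<phi> t" and nn: "\<And>t. 0 \<le> \<phi> t"
    and \<eta>: "0 < \<eta>" "\<eta> < 1" and K: "1 \<le> K"
    and step: "\<And>t. 0 < t \<Longrightarrow> \<phi> t \<le> K * \<phi> (\<eta> * t)" and r: "0 < r" "r \<le> R"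
  shows "\<phi> R \<le> K * (R / r) powr (ln K / ln (1 / \<eta>)) * \<phi> r"
proof -
  obtain n where n: "\<eta> ^ Suc n * R \<le> r" "real n \<le> ln (R / r) / ln (1 / \<eta>)"
    using geometric_scale[OF \<eta> r] by metis
  have "\<phi> R \<le> K ^ k * \<phi> (\<eta> ^ k * R)" for k
  proof (induction k)
    case (Suc k)
    have "K ^ k * \<phi> (\<eta> ^ k * R) \<le> K ^ k * (K * \<phi> (\<eta> * (\<eta> ^ k * R)))"
      using K \<eta> r by (intro mult_left_mono step) auto
    then show ?case using Suc by (simp add: mult_ac)
  qed simp
  then have "\<phi> R \<le> K ^ Suc n * \<phi> (\<eta> ^ Suc n * R)" .
  also have "\<dots> \<le> K ^ Suc n * \<phi> r"
    using K \<eta> r n by (intro mult_left_mono mono) auto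
  also have "K ^ Suc n \<le> K * (R / r) powr (ln K / ln (1 / \<eta>))"
  proof -
    have "K ^ n = K powr real n" using K by (simp add: powr_realpow)
    also have "\<dots> \<le> K powr (ln (R / r) / ln (1 / \<eta>))" using n K by (intro powr_mono) auto
    also have "\<dots> = (R / r) powr (ln K / ln (1 / \<eta>))"
      using K r by (simp add: powr_def mult.commute)
    finally show ?thesis using K by simp
  qed
  then have "K ^ Suc n * \<phi> r \<le> K * (R / r) powr (ln K / ln (1 / \<eta>)) * \<phi> r"
    by (intro mult_right_mono nn)
  finally show ?thesis .
qed

lemma powr_decay_of_geometric_decay:
  fixes \<phi> :: "real \<Rightarrow> real"
  assumes mono: "\<And>s t. 0 < s \<Longrightarrow> s \<le> t \<Longrightarrow> \<phi> s \<le> \<phi> t" and nn: "\<And>t. 0 \<le> \<phi> t"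
    and \<eta>: "0 < \<eta>" "\<eta> < 1" and g: "0 < \<gamma>" "\<gamma> < 1"
    and step: "\<And>t. 0 < t \<Longrightarrow> \<phi> (\<eta> * t) \<le> \<gamma> * \<phi> t" and r: "0 < r" "r \<le> R"
  shows "\<phi> r \<le> (1 / \<gamma>) * (r / R) powr (ln (1 / \<gamma>) / ln (1 / \<eta>)) * \<phi> R"
proof -
  obtain n where n: "r \<le> \<eta> ^ n * R" "ln (R / r) / ln (1 / \<eta>) \<le> real (Suc n)"
    using geometric_scale[OF \<eta> r] by metis
  have it: "\<phi> (\<eta> ^ k * R) \<le> \<gamma> ^ k * \<phi> R" for k
  proof (induction k)
    case (Suc k)
    have "\<phi> (\<eta> * (\<eta> ^ k * R)) \<le> \<gamma> * \<phi> (\<eta> ^ k * R)" using \<eta> r by (intro step) auto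
    also have "\<dots> \<le> \<gamma> * (\<gamma> ^ k * \<phi> R)" using g Suc by (intro mult_left_mono) auto
    finally show ?case by (simp add: mult_ac)
  qed simp
  have "\<phi> r \<le> \<phi> (\<eta> ^ n * R)" using r n by (intro mono) auto
  also have "\<dots> \<le> \<gamma> ^ n * \<phi> R" by (rule it)
  also have "\<gamma> ^ n \<le> (1 / \<gamma>) * (r / R) powr (ln (1 / \<gamma>) / ln (1 / \<eta>))"
  proof -
    have "\<gamma> ^ n = \<gamma> powr real n" using g by (simp add: powr_realpow)
    also have "\<dots> \<le> \<gamma> powr (ln (R / r) / ln (1 / \<eta>) - 1)" using n g by (intro powr_mono') auto
    also have "\<dots> = (1 / \<gamma>) * \<gamma> powr (ln (R / r) / ln (1 / \<eta>))" using g by (simp add: powr_diff)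
    also have "\<gamma> powr (ln (R / r) / ln (1 / \<eta>)) = (r / R) powr (ln (1 / \<gamma>) / ln (1 / \<eta>))"
      using g r \<eta> by (simp add: powr_def ln_div field_simps)
    finally show ?thesis .
  qed
  then have "\<gamma> ^ n * \<phi> R \<le> (1 / \<gamma>) * (r / R) powr (ln (1 / \<gamma>) / ln (1 / \<eta>)) * \<phi> R"
    by (intro mult_right_mono nn)
  finally show ?thesis .
qed

text \<open>For \<open>s = \<infinity>\<close> the bound \<open>V \<le> C |B|\<^sup>-\<^sup>1 \<integral>\<^sub>B V\<close> almost everywhere on \<open>B\<close> gives the condition for the
  exponent \<open>d/2\<close>; for a finite \<open>s\<close> the condition is only cleared of denominators.\<close>

lemma reverse_Holder_finite:
  fixes V :: "real ^ 'n \<Rightarrow> real"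
  assumes d: "CARD('n) \<ge> 3" and V: "\<And>x. 0 \<le> V x" "V \<in> borel_measurable lebesgue"
    and s: "ennreal (real CARD('n) / 2) \<le> s" and RH: "reverse_Holder s V"
  obtains \<sigma> C where "real CARD('n) / 2 \<le> \<sigma>" "0 < C"
    "\<And>x r. 0 < r \<Longrightarrow> (\<integral>\<^sup>+y\<in>ball x r. ennreal (V y) epowr \<sigma> \<partial>lebesgue) epowr (1 / \<sigma>)
        * vol (ball x r) epowr (1 - 1 / \<sigma>)
        \<le> ennreal C * (\<integral>\<^sup>+y\<in>ball x r. ennreal (V y) \<partial>lebesgue)"
proof -
  have "\<exists>\<sigma> C. real CARD('n) / 2 \<le> \<sigma> \<and> 0 < C \<and> (\<forall>x r. 0 < r \<longrightarrow>
      eaverage (ball x r) (\<lambda>y. ennreal (V y) epowr \<sigma>) epowr (1 / \<sigma>)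
      \<le> ennreal C * eaverage (ball x r) (\<lambda>y. ennreal (V y)))"
  proof (cases "s = top")
    case True
    obtain C where C: "0 < C" "\<And>x r. 0 < r \<Longrightarrow> esssup (lebesgue_on (ball x r)) (\<lambda>y. ennreal (V y))
        \<le> ennreal C * eaverage (ball x r) (\<lambda>y. ennreal (V y))"
      using RH True unfolding reverse_Holder_def by auto
    let ?\<sigma> = "real CARD('n) / 2"
    have sig: "0 < ?\<sigma>" using d by simp
    have "eaverage (ball x r) (\<lambda>y. ennreal (V y) epowr ?\<sigma>) epowr (1 / ?\<sigma>)
        \<le> ennreal C * eaverage (ball x r) (\<lambda>y. ennreal (V y))" (is "_ \<le> ?K") if r: "0 < r" for x r
    proof (intro epowr_le_rootI sig)
      let ?B = "ball x r"
      have "AE y in lebesgue_on ?B. ennreal (V y) \<le> esssup (lebesgue_on ?B) (\<lambda>y. ennreal (V y))"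
        by (rule esssup_AE)
      then have "AE y in lebesgue. y \<in> ?B \<longrightarrow> ennreal (V y) \<le> ?K"
        using C(2)[OF r, of x] by (subst (asm) AE_restrict_space_iff) (auto elim: eventually_mono)
      then have "(\<integral>\<^sup>+y\<in>?B. ennreal (V y) epowr ?\<sigma> \<partial>lebesgue) \<le> (\<integral>\<^sup>+y\<in>?B. ?K epowr ?\<sigma> \<partial>lebesgue)"
        using sig by (intro nn_integral_mono_AE) (auto simp: indicator_def epowr_mono elim!: eventually_mono)
      also have "\<dots> = ?K epowr ?\<sigma> * vol ?B"
        by (simp add: nn_integral_cmult_indicator)
      finally have "eaverage ?B (\<lambda>y. ennreal (V y) epowr ?\<sigma>)
          \<le> ?K epowr ?\<sigma> * vol ?B / vol ?B"
        unfolding eaverage_def by (rule divide_right_mono_ennreal)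
      also have "\<dots> = ?K epowr ?\<sigma>"
        using measure_ball_pos[OF r, of x] unfolding emeasure_ball_eq
        by (intro mult_divide_eq_ennreal) auto
      finally show "eaverage ?B (\<lambda>y. ennreal (V y) epowr ?\<sigma>) \<le> ?K epowr ?\<sigma>" .
    qed
    then show ?thesis using C(1) by blast
  next
    case False
    have "real CARD('n) / 2 \<le> enn2real s" using s False by (cases s) auto
    then show ?thesis using RH False unfolding reverse_Holder_def by auto
  qed
  then obtain \<sigma> C where \<sigma>: "real CARD('n) / 2 \<le> \<sigma>" and C: "0 < C" "\<And>x r. 0 < r \<Longrightarrow>
      eaverage (ball x r) (\<lambda>y. ennreal (V y) epowr \<sigma>) epowr (1 / \<sigma>)
      \<le> ennreal C * eaverage (ball x r) (\<lambda>y. ennreal (V y))"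
    by blast
  have \<sigma>1: "1 < \<sigma>" using \<sigma> d by simp
  show ?thesis
  proof (rule that[of \<sigma> C])
    fix x :: "real ^ 'n" and r :: real assume r: "0 < r"
    let ?B = "ball x r"
    let ?m = "measure lebesgue ?B"
    let ?I = "(\<integral>\<^sup>+y\<in>?B. ennreal (V y) epowr \<sigma> \<partial>lebesgue)" and ?J = "(\<integral>\<^sup>+y\<in>?B. ennreal (V y) \<partial>lebesgue)"
    have m: "0 < ?m" "vol ?B = ennreal ?m"
      using measure_ball_pos[OF r] emeasure_ball_eq by auto
    have "?I epowr (1 / \<sigma>) * ennreal (?m powr - (1 / \<sigma>)) \<le> ennreal C * (?J * ennreal (1 / ?m))"
    proof -
      have "(?I / ennreal ?m) epowr (1 / \<sigma>) \<le> ennreal C * (?J / ennreal ?m)"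
        using C(2)[OF r, of x] unfolding eaverage_def m(2) .
      moreover have "(?I / ennreal ?m) epowr (1 / \<sigma>) = ?I epowr (1 / \<sigma>) * ennreal (?m powr - (1 / \<sigma>))"
        using \<sigma>1 by (intro epowr_divide_real m(1)) auto
      moreover have "?J / ennreal ?m = ?J * ennreal (1 / ?m)"
        by (rule divide_ennreal_real[OF m(1)])
      ultimately show ?thesis by (simp only:)
    qed
    then have "?I epowr (1 / \<sigma>) * ennreal (?m powr - (1 / \<sigma>)) * ennreal ?m
        \<le> ennreal C * (?J * ennreal (1 / ?m)) * ennreal ?m"
      by (rule mult_right_mono) simp
    moreover have "ennreal (1 / ?m) * ennreal ?m = 1" using m by (simp add: ennreal_mult[symmetric])
    moreover have "ennreal (?m powr - (1 / \<sigma>)) * ennreal ?m = ennreal ?m epowr (1 - 1 / \<sigma>)"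
    proof -
      have "?m powr - (1 / \<sigma>) * ?m = ?m powr (1 - 1 / \<sigma>)"
        using m(1) powr_add[of ?m "- (1 / \<sigma>)" 1] by simp
      then show ?thesis
        using \<sigma>1 m(1) by (simp add: epowr_ennreal ennreal_mult[symmetric])
    qed
    ultimately show "?I epowr (1 / \<sigma>) * vol ?B epowr (1 - 1 / \<sigma>) \<le> ennreal C * ?J"
      unfolding m(2) by (simp add: mult.assoc)
  qed (use C \<sigma> in auto)
qed

text \<open>Reverse Hoelder weights double, and so does \<open>\<mu> = V\<^sup>\<sigma> dx\<close>.  In \<open>\<real>\<^sup>d\<close> a doubling measure also
  satisfies a reverse doubling condition, because a ball and a disjoint translate of it lie in the
  tripled ball; hence \<open>\<mu>(B(x,r))\<close> decays like a power of \<open>r\<close>.  This is where the borderline exponent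
  \<open>\<sigma> = d/2\<close> gains over the exponent \<open>d - 2\<close> that Hoelder's inequality alone would give.\<close>

lemma reverse_Holder_growth_decay:
  fixes V :: "real ^ 'n \<Rightarrow> real"
  assumes d: "CARD('n) \<ge> 3" and V: "\<And>x. 0 \<le> V x" "locally_integrable V"
    and s: "ennreal (real CARD('n) / 2) \<le> s" and RH: "reverse_Holder s V"
  defines "I x r \<equiv> (LINT y:ball x r|lebesgue. V y)"
  obtains D N \<epsilon> where "1 \<le> D" "0 \<le> N" "0 < \<epsilon>"
    "\<And>x r R. 0 < r \<Longrightarrow> r \<le> R \<Longrightarrow> I x R \<le> D * (R / r) powr N * I x r"
    "\<And>x r R. 0 < r \<Longrightarrow> r \<le> R \<Longrightarrow> I x r \<le> D * (r / R) powr (real CARD('n) - 2 + \<epsilon>) * I x R"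
proof -
  note [measurable] = locally_integrable_measurable[OF V(2)]
  obtain \<sigma> C0 where \<sigma>: "real CARD('n) / 2 \<le> \<sigma>" and C0: "0 < C0"
    "\<And>x r. 0 < r \<Longrightarrow> (\<integral>\<^sup>+y\<in>ball x r. ennreal (V y) epowr \<sigma> \<partial>lebesgue) epowr (1 / \<sigma>)
        * vol (ball x r) epowr (1 - 1 / \<sigma>)
        \<le> ennreal C0 * (\<integral>\<^sup>+y\<in>ball x r. ennreal (V y) \<partial>lebesgue)"
    by (rule reverse_Holder_finite[OF d V(1) locally_integrable_measurable[OF V(2)] s RH]) (rule that)
  define C where "C = max C0 1"
  define \<kappa> where "\<kappa> = 1 - 1 / \<sigma>"
  have \<sigma>1: "1 < \<sigma>" using \<sigma> d by simp
  then have \<kappa>: "0 < \<kappa>" "\<kappa> < 1" by (auto simp: \<kappa>_def)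
  have C: "1 \<le> C" by (simp add: C_def)
  define \<nu> where "\<nu> = density lebesgue (\<lambda>y. ennreal (V y))"
  define \<mu> where "\<mu> = density lebesgue (\<lambda>y. ennreal (V y) epowr \<sigma>)"
  define b where "b = measure lebesgue (ball (0 :: real ^ 'n) 1)"
  have b: "0 < b" using measure_unit_ball_pos by (simp add: b_def)
  have mb: "measure lebesgue (ball x r) = b * r ^ CARD('n)" if "0 < r" for x :: "real ^ 'n" and r
    using measure_ball_conv[of r x] that by (simp add: b_def)
  have sets [simp]: "sets \<nu> = sets lebesgue" "sets \<mu> = sets lebesgue"
    by (simp_all add: \<nu>_def \<mu>_def)
  have \<nu>E: "emeasure \<nu> E = (\<integral>\<^sup>+y\<in>E. ennreal (V y) \<partial>lebesgue)"
    "emeasure \<mu> E = (\<integral>\<^sup>+y\<in>E. ennreal (V y) epowr \<sigma> \<partial>lebesgue)" if "E \<in> sets lebesgue" for E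
    using that by (simp_all add: \<nu>_def \<mu>_def emeasure_density)
  have emI: "emeasure \<nu> (ball x r) = ennreal (I x r)" for x r
  proof -
    have "V absolutely_integrable_on ball x r" by (intro locally_integrable_bounded V(2)) auto
    from nn_set_integral_abs_eq[OF this] show ?thesis
      using V(1) by (simp add: \<nu>E I_def)
  qed
  have I_nn: "0 \<le> I x r" for x r
    unfolding I_def set_lebesgue_integral_def by (intro integral_nonneg_AE) (auto simp: V)
  have I_eq: "I x r = measure \<nu> (ball x r)" for x r
    using emI[of x r] I_nn[of x r] by (simp add: measure_def)
  have fin\<nu>: "ball x r \<in> fmeasurable \<nu>" for x r
    using emI[of x r] by (auto simp: fmeasurable_def)
  have RHe: "emeasure \<mu> (ball x r) epowr (1 / \<sigma>) * ennreal (measure lebesgue (ball x r) powr \<kappa>)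
      \<le> ennreal C * ennreal (I x r)" if "0 < r" for x r
  proof -
    have "emeasure \<mu> (ball x r) epowr (1 / \<sigma>) * ennreal (measure lebesgue (ball x r) powr \<kappa>)
      \<le> ennreal C0 * ennreal (I x r)"
      using C0(2)[OF that, of x] measure_ball_pos[OF that, of x] \<kappa>
      by (simp add: \<nu>E[symmetric] emI emeasure_ball_eq epowr_ennreal flip: \<kappa>_def)
    also have "\<dots> \<le> ennreal C * ennreal (I x r)"
      by (intro mult_right_mono ennreal_leI) (auto simp: C_def)
    finally show ?thesis .
  qed
  have fin\<mu>: "ball x r \<in> fmeasurable \<mu>" for x r
  proof (cases "0 < r")
    case True
    have "emeasure \<mu> (ball x r) \<noteq> top"
    proof
      assume "emeasure \<mu> (ball x r) = top"
      then have "top \<le> ennreal C * ennreal (I x r)"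
        using RHe[OF True, of x] measure_ball_pos[OF True, of x] \<sigma>1 by (simp add: ennreal_top_mult)
      then show False by (simp add: ennreal_mult_eq_top_iff top_unique)
    qed
    then show ?thesis by (simp add: fmeasurable_def top.not_eq_extremum)
  qed (simp add: fmeasurable_def ball_empty)
  define m where "m x r = measure \<mu> (ball x r)" for x r
  have emm: "emeasure \<mu> (ball x r) = ennreal (m x r)" and m_nn: "0 \<le> m x r" for x r
    using emeasure_eq_measure2[OF fin\<mu>] by (auto simp: m_def)
  have RHr: "m x r powr (1 / \<sigma>) * (b * r ^ CARD('n)) powr \<kappa> \<le> C * I x r" if "0 < r" for x r
    using RHe[OF that, of x] \<sigma>1 C m_nn I_nn mb[OF that, of x]
    by (simp add: emm epowr_ennreal ennreal_mult[symmetric])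
  have Hoelder: "emeasure \<nu> E \<le> ennreal (measure lebesgue E powr \<kappa> * measure \<mu> E powr (1 / \<sigma>))"
    if E: "E \<in> sets lebesgue" "E \<subseteq> ball x r" for E x r
  proof -
    have "E \<in> fmeasurable \<mu>" using fmeasurableI2[OF fin\<mu> E(2)] E(1) by simp
    moreover have "E \<in> lmeasurable" using fmeasurableI2[OF lmeasurable_ball E(2)] E(1) by simp
    ultimately have em: "emeasure \<mu> E = ennreal (measure \<mu> E)" "vol E = ennreal (measure lebesgue E)"
      by (simp_all add: emeasure_eq_measure2)
    have "emeasure \<nu> E = (\<integral>\<^sup>+y\<in>E. (ennreal (V y) epowr \<sigma>) epowr (1 / \<sigma>) * 1 epowr (1 - 1 / \<sigma>) \<partial>lebesgue)"
      using \<sigma>1 by (simp add: \<nu>E E epowr_epowr)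
    also have "\<dots> \<le> (\<integral>\<^sup>+y\<in>E. ennreal (V y) epowr \<sigma> \<partial>lebesgue) epowr (1 / \<sigma>) * (\<integral>\<^sup>+y\<in>E. 1 \<partial>lebesgue) epowr (1 - 1 / \<sigma>)"
      using \<sigma>1 E by (intro Hoelder_nn_set_integral) auto
    also have "\<dots> = emeasure \<mu> E epowr (1 / \<sigma>) * vol E epowr \<kappa>"
      using E by (simp add: \<nu>E \<kappa>_def)
    also have "\<dots> = ennreal (measure lebesgue E powr \<kappa> * measure \<mu> E powr (1 / \<sigma>))"
      using \<sigma>1 \<kappa> by (simp add: em epowr_ennreal ennreal_mult mult.commute)
    finally show ?thesis .
  qed
  have Hb: "I x r \<le> (b * r ^ CARD('n)) powr \<kappa> * m x r powr (1 / \<sigma>)" if "0 < r" for x r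
    using Hoelder[of "ball x r" x r] mb[OF that, of x] by (simp add: emI m_def)
  have I_mono: "I x r \<le> I y t" if "ball x r \<subseteq> ball y t" for x y r t
    unfolding I_eq using that fin\<nu> by (intro measure_mono_fmeasurable) auto
  have m_mono: "m x r \<le> m y t" if "ball x r \<subseteq> ball y t" for x y r t
    unfolding m_def using that fin\<mu> by (intro measure_mono_fmeasurable) auto
  \<comment> \<open>A thin outer shell of a ball carries at most half of its measure, since its Lebesgue measure
    is the proportion \<open>\<tau>\<close> of that of the ball and \<open>C \<tau>\<^bsup>\<kappa>\<^esup> \<le> 1/2\<close>.\<close>
  define \<tau> where "\<tau> = (1 / (2 * C)) powr (1 / \<kappa>)"
  define \<eta> where "\<eta> = root CARD('n) (1 - \<tau>)"
  have \<tau>: "0 < \<tau>" "\<tau> < 1" "\<tau> powr \<kappa> = 1 / (2 * C)"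
  proof -
    show "0 < \<tau>" using C by (simp add: \<tau>_def)
    have "(1 / (2 * C)) powr (1 / \<kappa>) < 1 powr (1 / \<kappa>)"
      using C \<kappa> by (intro powr_less_mono2) auto
    then show "\<tau> < 1" by (simp add: \<tau>_def)
    show "\<tau> powr \<kappa> = 1 / (2 * C)" using \<kappa> C by (simp add: \<tau>_def powr_powr)
  qed
  have \<eta>: "0 < \<eta>" "\<eta> < 1" "\<eta> ^ CARD('n) = 1 - \<tau>"
    using \<tau> d by (auto simp: \<eta>_def)
  have shell: "I x t \<le> 2 * I x (\<eta> * t)" if t: "0 < t" for x t
  proof -
    let ?E = "ball x t - ball x (\<eta> * t)"
    have sub: "ball x (\<eta> * t) \<subseteq> ball x t" using \<eta> t by (intro subset_ball) auto
    have E: "?E \<in> sets lebesgue" by simp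
    have lE: "measure lebesgue ?E = b * t ^ CARD('n) * \<tau>"
    proof -
      have "measure lebesgue ?E = measure lebesgue (ball x t) - measure lebesgue (ball x (\<eta> * t))"
        using sub emeasure_lborel_ball_finite[of x t] by (intro measure_Diff) auto
      also have "\<dots> = b * t ^ CARD('n) - b * (\<eta> * t) ^ CARD('n)" using t \<eta> by (simp only: mb mult_pos_pos)
      finally show ?thesis using \<eta>(3) by (simp add: power_mult_distrib algebra_simps)
    qed
    have "emeasure \<nu> ?E \<le> ennreal (measure lebesgue ?E powr \<kappa> * measure \<mu> ?E powr (1 / \<sigma>))"
      by (rule Hoelder[OF E]) auto
    also have "measure lebesgue ?E powr \<kappa> * measure \<mu> ?E powr (1 / \<sigma>)
        \<le> (b * t ^ CARD('n) * \<tau>) powr \<kappa> * m x t powr (1 / \<sigma>)"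
    proof -
      have "measure \<mu> ?E \<le> m x t"
        unfolding m_def by (intro measure_mono_fmeasurable fin\<mu>) auto
      then show ?thesis
        unfolding lE using \<sigma>1 by (intro mult_left_mono powr_mono2) auto
    qed
    also have "\<dots> = \<tau> powr \<kappa> * (m x t powr (1 / \<sigma>) * (b * t ^ CARD('n)) powr \<kappa>)"
      using b t \<tau> by (simp add: powr_mult)
    also have "\<dots> \<le> \<tau> powr \<kappa> * (C * I x t)"
      by (intro mult_left_mono RHr t) auto
    also have "\<dots> = I x t / 2" using \<tau>(3) C by simp
    finally have 1: "emeasure \<nu> ?E \<le> ennreal (I x t / 2)" by (simp add: ennreal_leI)
    have "emeasure \<nu> (ball x t) = emeasure \<nu> (ball x (\<eta> * t)) + emeasure \<nu> ?E"
      using sub by (subst plus_emeasure) (auto simp: Un_absorb1)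
    then have "ennreal (I x t) \<le> ennreal (I x (\<eta> * t)) + ennreal (I x t / 2)"
      using 1 by (simp add: emI add_left_mono)
    then have "I x t \<le> I x (\<eta> * t) + I x t / 2"
      using I_nn by (simp flip: ennreal_plus)
    then show ?thesis by simp
  qed
  define N where "N = ln 2 / ln (1 / \<eta>)"
  have N: "0 \<le> N" using \<eta> by (simp add: N_def)
  have growth: "I x R \<le> 2 * (R / r) powr N * I x r" if "0 < r" "r \<le> R" for x r R
    unfolding N_def
    by (rule powr_growth_of_geometric_growth[where \<phi> = "I x"])
      (use that \<eta> shell I_nn in \<open>auto intro!: I_mono subset_ball\<close>)
  \<comment> \<open>Doubling of \<open>\<mu>\<close>, in the form needed to compare two balls of radii \<open>r\<close> and \<open>3r\<close>.\<close>
  define P where "P = (C * (2 * 3 powr N)) powr \<sigma>"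
  have P: "0 < P" using C by (simp add: P_def)
  have dbl: "m x (3 * r) \<le> P * m x r" if r: "0 < r" for x r
  proof -
    have "m x (3 * r) powr (1 / \<sigma>) * (b * r ^ CARD('n)) powr \<kappa>
        \<le> m x (3 * r) powr (1 / \<sigma>) * (b * (3 * r) ^ CARD('n)) powr \<kappa>"
      using b r \<kappa> by (intro mult_left_mono powr_mono2 power_mono) auto
    also have "\<dots> \<le> C * I x (3 * r)" using r by (intro RHr) auto
    also have "\<dots> \<le> C * (2 * 3 powr N * I x r)"
      using growth[of r "3 * r" x] r C by (intro mult_left_mono) auto
    also have "\<dots> \<le> C * (2 * 3 powr N * ((b * r ^ CARD('n)) powr \<kappa> * m x r powr (1 / \<sigma>)))"
      using C by (intro mult_left_mono Hb r) auto
    finally have "m x (3 * r) powr (1 / \<sigma>) * (b * r ^ CARD('n)) powr \<kappa>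
        \<le> (C * (2 * 3 powr N) * m x r powr (1 / \<sigma>)) * (b * r ^ CARD('n)) powr \<kappa>"
      by (simp add: mult_ac)
    then have "m x (3 * r) powr (1 / \<sigma>) \<le> C * (2 * 3 powr N) * m x r powr (1 / \<sigma>)"
      using b r by (subst (asm) mult_le_cancel_right_pos) auto
    then have "(m x (3 * r) powr (1 / \<sigma>)) powr \<sigma> \<le> (C * (2 * 3 powr N) * m x r powr (1 / \<sigma>)) powr \<sigma>"
      using \<sigma>1 by (intro powr_mono2) auto
    then show ?thesis
      using \<sigma>1 C m_nn by (simp add: powr_powr powr_mult P_def)
  qed
  obtain e :: "real ^ 'n" where e: "norm e = 1" using vector_choose_size[of 1] by auto
  have rdbl: "m x (1 / 3 * t) \<le> P / (1 + P) * m x t" if t: "0 < t" for x t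
  proof -
    define r where "r = t / 3"
    have r: "0 < r" "t = 3 * r" using t by (auto simp: r_def)
    let ?y = "x + (2 * r) *\<^sub>R e"
    have dxy: "dist x ?y = 2 * r" using e r by (simp add: dist_norm)
    have sub: "ball x r \<subseteq> ball ?y (3 * r)" "ball ?y r \<subseteq> ball x (3 * r)" "ball x r \<subseteq> ball x (3 * r)"
    proof -
      show "ball x r \<subseteq> ball ?y (3 * r)" "ball ?y r \<subseteq> ball x (3 * r)"
        using dxy by (auto simp: ball_subset_ball_iff dist_commute)
      show "ball x r \<subseteq> ball x (3 * r)" using r by (intro subset_ball) auto
    qed
    have dis: "ball x r \<inter> ball ?y r = {}"
    proof (rule ccontr)
      assume "ball x r \<inter> ball ?y r \<noteq> {}"
      then obtain z where "dist x z < r" "dist ?y z < r" by auto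
      then show False using dxy dist_triangle2[of x ?y z] by linarith
    qed
    have "m x r + m ?y r = measure \<mu> (ball x r \<union> ball ?y r)"
      unfolding m_def using dis fin\<mu> by (subst measure_Un2) (auto simp: Diff_triv Int_commute)
    also have "\<dots> \<le> m x (3 * r)"
      unfolding m_def using sub fin\<mu> by (intro measure_mono_fmeasurable) auto
    finally have 1: "m x r + m ?y r \<le> m x (3 * r)" .
    have "m x r \<le> m ?y (3 * r)" using sub by (intro m_mono)
    also have "\<dots> \<le> P * m ?y r" using r by (intro dbl)
    finally have "m x r \<le> P * (m x (3 * r) - m x r)" using 1 P by (smt (verit) mult_left_mono)
    then have "m x r * (1 + P) \<le> P * m x (3 * r)" by (simp add: algebra_simps)
    then have "m x r \<le> P / (1 + P) * m x (3 * r)" using P by (simp add: field_simps)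
    then show ?thesis using r by simp
  qed
  define \<gamma> where "\<gamma> = P / (1 + P)"
  have \<gamma>: "0 < \<gamma>" "\<gamma> < 1" using P by (auto simp: \<gamma>_def)
  define \<delta> where "\<delta> = ln (1 / \<gamma>) / ln (1 / (1 / 3 :: real))"
  have \<delta>: "0 < \<delta>" using \<gamma> by (auto simp: \<delta>_def intro!: divide_pos_pos)
  have decay\<mu>: "m x r \<le> (1 / \<gamma>) * (r / R) powr \<delta> * m x R" if "0 < r" "r \<le> R" for x r R
    unfolding \<delta>_def
    by (rule powr_decay_of_geometric_decay[where \<phi> = "m x"])
      (use that \<gamma> rdbl m_nn in \<open>auto simp: \<gamma>_def intro!: m_mono subset_ball\<close>)
  define D where "D = max 2 (C * (1 / \<gamma>) powr (1 / \<sigma>))"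
  have decay: "I x r \<le> D * (r / R) powr (real CARD('n) - 2 + \<delta> / \<sigma>) * I x R" if r: "0 < r" "r \<le> R" for x r R
  proof -
    let ?q = "r / R"
    have q: "0 < ?q" "?q \<le> 1" using r by auto
    have R: "0 < R" using r by simp
    have "I x r \<le> (b * r ^ CARD('n)) powr \<kappa> * m x r powr (1 / \<sigma>)" by (rule Hb[OF r(1)])
    also have "\<dots> \<le> (b * r ^ CARD('n)) powr \<kappa> * ((1 / \<gamma>) * ?q powr \<delta> * m x R) powr (1 / \<sigma>)"
      using decay\<mu>[OF r] m_nn \<sigma>1 by (intro mult_left_mono powr_mono2) auto
    also have "b * r ^ CARD('n) = ?q ^ CARD('n) * (b * R ^ CARD('n))"
      using R by (simp add: power_divide)
    also have "(?q ^ CARD('n) * (b * R ^ CARD('n))) powr \<kappa> * ((1 / \<gamma>) * ?q powr \<delta> * m x R) powr (1 / \<sigma>)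
        = (1 / \<gamma>) powr (1 / \<sigma>) * ?q powr (CARD('n) * \<kappa> + \<delta> / \<sigma>) * (m x R powr (1 / \<sigma>) * (b * R ^ CARD('n)) powr \<kappa>)"
    proof -
      have "(h ^ CARD('n) * B) powr \<kappa> * (g * h powr \<delta> * M) powr (1 / \<sigma>)
          = g powr (1 / \<sigma>) * h powr (CARD('n) * \<kappa> + \<delta> / \<sigma>) * (M powr (1 / \<sigma>) * B powr \<kappa>)"
        if "0 < h" "0 < B" "0 < g" "0 \<le> M" for h B g M :: real
        using that by (simp add: powr_mult powr_powr powr_add powr_realpow[symmetric] mult_ac)
      from this[OF q(1), of "b * R ^ CARD('n)" "1 / \<gamma>" "m x R"]
      show ?thesis using b R \<gamma> m_nn by (simp only: mult_pos_pos zero_less_power zero_less_divide_1_iff)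
    qed
    also have "\<dots> \<le> (1 / \<gamma>) powr (1 / \<sigma>) * ?q powr (CARD('n) * \<kappa> + \<delta> / \<sigma>) * (C * I x R)"
      by (intro mult_left_mono RHr R) auto
    also have "\<dots> \<le> (1 / \<gamma>) powr (1 / \<sigma>) * ?q powr (real CARD('n) - 2 + \<delta> / \<sigma>) * (C * I x R)"
    proof -
      have "real CARD('n) / \<sigma> \<le> 2" using \<sigma> \<sigma>1 by (simp add: field_simps)
      then have "real CARD('n) - 2 + \<delta> / \<sigma> \<le> CARD('n) * \<kappa> + \<delta> / \<sigma>"
        by (simp add: \<kappa>_def algebra_simps)
      then show ?thesis
        using q C I_nn by (intro mult_left_mono mult_right_mono powr_mono') auto
    qed
    also have "\<dots> = C * (1 / \<gamma>) powr (1 / \<sigma>) * ?q powr (real CARD('n) - 2 + \<delta> / \<sigma>) * I x R"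
      by simp
    also have "\<dots> \<le> D * ?q powr (real CARD('n) - 2 + \<delta> / \<sigma>) * I x R"
      using I_nn by (intro mult_right_mono) (auto simp: D_def)
    finally show ?thesis .
  qed
  have "I x R \<le> D * (R / r) powr N * I x r" if "0 < r" "r \<le> R" for x r R
  proof -
    have "2 * (R / r) powr N * I x r \<le> D * (R / r) powr N * I x r"
      using I_nn by (intro mult_right_mono) (auto simp: D_def)
    then show ?thesis using growth[OF that, of x] by linarith
  qed
  then show ?thesis
    using decay N \<delta> \<sigma>1 by (intro that[of D N "\<delta> / \<sigma>"]) (auto simp: D_def)
qed

text \<open>The power decay makes \<open>r\<^bsup>2-d\<^esup> \<integral>\<^bsub>B(y,r)\<^esub> V\<close> small at small scales and large at large scales, so
  \<open>\<rho>\<close> is positive and finite.  If \<open>|x - y| < r\<close>, the quantity at \<open>y\<close> and scale \<open>r + \<rho>(x)\<close> is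
  controlled, by doubling, by a power of \<open>1 + r/\<rho>(x)\<close>; a scale smaller by another such power
  is then admissible in the supremum that defines \<open>\<rho>(y)\<close>.\<close>

lemma critical_radius_comparison:
  fixes V :: "real ^ 'n \<Rightarrow> real"
  assumes d: "CARD('n) \<ge> 3" and V: "\<And>x. 0 \<le> V x" "locally_integrable V"
    and nz: "\<not> (AE x in lebesgue. V x = 0)"
    and s: "ennreal (real CARD('n) / 2) \<le> s" and RH: "reverse_Holder s V"
  defines "\<rho> \<equiv> critical_radius V"
  obtains K M where "1 \<le> K" "1 \<le> M" "\<And>x. 0 < \<rho> x"
    "\<And>x y r. 0 < r \<Longrightarrow> dist x y < r \<Longrightarrow> 1 + r / \<rho> y \<le> K * (1 + r / \<rho> x) powr M"
proof -
  define I where "I x r = (LINT y:ball x r|lebesgue. V y)" for x r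
  define k where "k = real CARD('n) - 2"
  obtain D N \<epsilon> where D: "1 \<le> D" and N: "0 \<le> N" and e: "0 < \<epsilon>"
    and growth: "\<And>x r R. 0 < r \<Longrightarrow> r \<le> R \<Longrightarrow> I x R \<le> D * (R / r) powr N * I x r"
    and decay: "\<And>x r R. 0 < r \<Longrightarrow> r \<le> R \<Longrightarrow> I x r \<le> D * (r / R) powr (k + \<epsilon>) * I x R"
    by (rule reverse_Holder_growth_decay[OF d V s RH, folded I_def k_def]) (rule that)
  have k: "0 < k" "r ^ (CARD('n) - 2) = r powr k" if "0 < r" for r
  proof -
    show "0 < k" using d by (simp add: k_def)
    have "k = real (CARD('n) - 2)" using d by (simp add: k_def)
    then show "r ^ (CARD('n) - 2) = r powr k" using that by (simp add: powr_realpow)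
  qed
  define S where "S x = {r. 0 < r \<and> I x r \<le> r powr k}" for x
  have \<rho>: "\<rho> x = Sup (S x)" for x
  proof -
    have "{r. 0 < r \<and> 1 / r ^ (CARD('n) - 2) * (LINT y:ball x r|lebesgue. V y) \<le> 1} = S x"
      unfolding S_def I_def[symmetric] by (auto simp: k field_simps)
    then show ?thesis by (simp add: \<rho>_def critical_radius_def)
  qed
  have absint: "V absolutely_integrable_on ball x r" for x r
    by (intro locally_integrable_bounded V(2)) auto
  have I_nn: "0 \<le> I x r" for x r
    unfolding I_def set_lebesgue_integral_def by (intro integral_nonneg_AE) (auto simp: V)
  have I_mono: "I x r \<le> I y t" if "ball x r \<subseteq> ball y t" for x y r t
    unfolding I_def set_lebesgue_integral_def
    using absint[of x r] absint[of y t] that V(1)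
    by (intro integral_mono) (auto simp: set_integrable_def indicator_def)
  have pos: "\<exists>R>0. 0 < I x R" for x
  proof (rule ccontr)
    assume "\<not> (\<exists>R>0. 0 < I x R)"
    then have I0: "I x (real (Suc n)) = 0" for n
      using I_nn[of x] by (metis less_le of_nat_0_less_iff zero_less_Suc)
    have "AE y in lebesgue. indicator (ball x (real (Suc n))) y *\<^sub>R V y = 0" for n
      using I0[of n] absint[of x "real (Suc n)"] V(1) unfolding I_def set_lebesgue_integral_def set_integrable_def
      by (subst (asm) integral_nonneg_eq_0_iff_AE) auto
    then have "AE y in lebesgue. \<forall>n. indicator (ball x (real (Suc n))) y *\<^sub>R V y = 0"
      by (subst AE_all_countable) auto
    then have "AE y in lebesgue. V y = 0"
    proof eventually_elim
      case (elim y)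
      obtain n where "dist x y < real n" using reals_Archimedean2 by blast
      then have "y \<in> ball x (real (Suc n))" by simp
      then show ?case using elim[rule_format, of n] by simp
    qed
    then show False using nz by blast
  qed
  have bdd: "bdd_above (S x)" for x
  proof -
    obtain R0 where R0: "0 < R0" "0 < I x R0" using pos by blast
    define c where "c = I x R0 / (D * R0 powr (k + \<epsilon>))"
    have c: "0 < c" using R0 D by (simp add: c_def)
    have "R \<le> max R0 ((1 / c) powr (1 / \<epsilon>))" if R: "R \<in> S x" for R
    proof (cases "R \<le> R0")
      case False
      then have R': "0 < R" "R0 \<le> R" "I x R \<le> R powr k" using R by (auto simp: S_def)
      have "I x R0 \<le> D * (R0 / R) powr (k + \<epsilon>) * R powr k"
        using decay[OF R0(1) R'(2), of x] R'(3) D by (smt (verit) mult_left_mono powr_ge_zero mult_nonneg_nonneg)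
      also have "\<dots> = D * R0 powr (k + \<epsilon>) / R powr \<epsilon>"
        using R0 R' by (simp add: powr_divide powr_add)
      finally have "R powr \<epsilon> * I x R0 \<le> D * R0 powr (k + \<epsilon>)"
        using R' by (simp add: field_simps)
      then have "c * R powr \<epsilon> \<le> 1"
        using D R0 by (simp add: c_def field_simps)
      then have "R powr \<epsilon> \<le> 1 / c" using c by (simp add: field_simps)
      then have "(R powr \<epsilon>) powr (1 / \<epsilon>) \<le> (1 / c) powr (1 / \<epsilon>)"
        using e by (intro powr_mono2) auto
      then show ?thesis using e R' by (simp add: powr_powr)
    qed auto
    then show ?thesis by (auto simp: bdd_above_def)
  qed
  \<comment> \<open>At the scale \<open>t\<close> given by \<open>(t/R)\<^sup>\<epsilon> = 1/(D m)\<close> the decay compensates both constants.\<close>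
  have lower: "R * (D * m) powr (- (1 / \<epsilon>)) \<in> S x" "R * (D * m) powr (- (1 / \<epsilon>)) \<le> \<rho> x"
    if m: "1 \<le> m" "0 < R" "I x R \<le> m * R powr k" for x R m
  proof -
    define t where "t = R * (D * m) powr (- (1 / \<epsilon>))"
    have Dm: "1 \<le> D * m" using D m by (metis mult_mono' mult_1 order_trans zero_le_one)
    have q: "t / R = (D * m) powr (- (1 / \<epsilon>))" using m by (simp add: t_def)
    have "(D * m) powr (- (1 / \<epsilon>)) \<le> (D * m) powr 0"
      using Dm e by (intro powr_mono) auto
    then have q1: "t / R \<le> 1" using Dm q by (auto split: if_splits)
    have "0 < t" unfolding t_def by (intro mult_pos_pos) (use D m in auto)
    then have t: "0 < t" "t \<le> R" using m q1 by auto
    have "I x t \<le> D * (t / R) powr (k + \<epsilon>) * I x R" by (rule decay[OF t])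
    also have "\<dots> \<le> D * (t / R) powr (k + \<epsilon>) * (m * R powr k)"
      using m D by (intro mult_left_mono) auto
    also have "\<dots> = (D * m) * (t / R) powr \<epsilon> * ((t / R) powr k * R powr k)"
      using t m by (simp add: powr_add mult_ac)
    also have "(t / R) powr \<epsilon> = 1 / (D * m)"
      unfolding q powr_powr using e Dm by (simp add: powr_minus_divide)
    also have "(t / R) powr k * R powr k = t powr k"
      using t m by (simp add: powr_divide)
    finally have "t \<in> S x" using t D m by (auto simp: S_def)
    then show "R * (D * m) powr (- (1 / \<epsilon>)) \<in> S x" "R * (D * m) powr (- (1 / \<epsilon>)) \<le> \<rho> x"
      unfolding \<rho> t_def[symmetric] by (auto intro: cSup_upper bdd)
  qed
  have \<rho>pos: "0 < \<rho> x" and Sne: "S x \<noteq> {}" for x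
  proof -
    have *: "I x 1 \<le> max 1 (I x 1) * 1 powr k" by simp
    have "D * max 1 (I x 1) \<noteq> 0" using D by auto
    then have p: "0 < (D * max 1 (I x 1)) powr (- (1 / \<epsilon>))" by (subst powr_gt_zero)
    have l: "1 * (D * max 1 (I x 1)) powr (- (1 / \<epsilon>)) \<in> S x"
      "1 * (D * max 1 (I x 1)) powr (- (1 / \<epsilon>)) \<le> \<rho> x"
      by (rule lower[OF _ _ *]; simp)+
    show "0 < \<rho> x" using p l(2) by linarith
    show "S x \<noteq> {}" using l(1) by blast
  qed
  define Q where "Q = D * (D * 4 powr N)"
  have Q: "1 \<le> D * 4 powr N" "1 \<le> Q"
  proof -
    have "1 \<le> 4 powr N" using N by (simp add: ge_one_powr_ge_zero)
    then show "1 \<le> D * 4 powr N" using D by (metis mult_mono' mult_1 order_trans zero_le_one)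
    then show "1 \<le> Q" unfolding Q_def using D by (metis mult_mono' mult_1 order_trans zero_le_one)
  qed
  define K where "K = 1 + Q powr (1 / \<epsilon>)"
  define M where "M = max 1 (N / \<epsilon>)"
  have main: "1 + r / \<rho> y \<le> K * (1 + r / \<rho> x) powr M" if r: "0 < r" "dist x y < r" for x y r
  proof -
    define R where "R = \<rho> x"
    have R: "0 < R" using \<rho>pos by (simp add: R_def)
    define u where "u = 1 + r / R"
    have l: "1 \<le> u" using r R by (simp add: u_def)
    \<comment> \<open>Any admissible radius above half of the supremum can represent it, up to a factor \<open>2\<close>.\<close>
    obtain R' where R': "R' \<in> S x" "R / 2 < R'"
      using less_cSup_iff[OF Sne bdd, of "R / 2" x] R by (auto simp: R_def \<rho>)
    have R'': "0 < R'" "I x R' \<le> R' powr k" "R' \<le> R"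
      using R'(1) cSup_upper[OF R'(1) bdd] by (auto simp: S_def R_def \<rho>)
    define T where "T = r + R"
    have T: "0 < T" "R \<le> T" "r \<le> T" "T / R = u" using r R by (auto simp: T_def u_def field_simps)
    have "I y T \<le> I x (2 * T)"
      using r R by (intro I_mono) (auto simp: ball_subset_ball_iff T_def dist_commute)
    also have "\<dots> \<le> D * (2 * T / R') powr N * I x R'"
      using R'' T by (intro growth) auto
    also have "\<dots> \<le> D * (4 * u) powr N * T powr k"
    proof (intro mult_mono)
      have "2 * T / R' \<le> 2 * T / (R / 2)" using R' T R by (intro divide_left_mono) auto
      also have "\<dots> = 4 * u" using T(4) by simp
      finally show "(2 * T / R') powr N \<le> (4 * u) powr N"
        using N T R'' by (intro powr_mono2) auto
      show "I x R' \<le> T powr k"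
        using R'' T k[of 1] powr_mono2[of k R' T] by auto
    qed (use D I_nn in auto)
    also have "\<dots> = (D * 4 powr N * u powr N) * T powr k"
      using l by (simp add: powr_mult)
    finally have *: "I y T \<le> (D * 4 powr N * u powr N) * T powr k" .
    have "1 \<le> u powr N" using l N by (simp add: ge_one_powr_ge_zero)
    then have "1 \<le> D * 4 powr N * u powr N"
      using Q(1) by (metis mult_mono' mult_1 order_trans zero_le_one)
    then have "T * (D * (D * 4 powr N * u powr N)) powr (- (1 / \<epsilon>)) \<le> \<rho> y"
      using T * by (intro lower(2))
    moreover have "(D * (D * 4 powr N * u powr N)) powr (- (1 / \<epsilon>)) = 1 / (Q powr (1 / \<epsilon>) * u powr (N / \<epsilon>))"
    proof -
      have eq: "D * (D * 4 powr N * u powr N) = Q * u powr N" by (simp add: Q_def)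
      show ?thesis
        unfolding eq using Q(2) l e by (simp add: powr_minus_divide powr_mult powr_powr)
    qed
    ultimately have "T * (1 / (Q powr (1 / \<epsilon>) * u powr (N / \<epsilon>))) \<le> \<rho> y" by simp
    then have "T \<le> \<rho> y * (Q powr (1 / \<epsilon>) * u powr (N / \<epsilon>))"
      using Q(2) l by (simp add: field_simps)
    then have "r / \<rho> y \<le> Q powr (1 / \<epsilon>) * u powr (N / \<epsilon>)"
      using T \<rho>pos[of y] by (simp add: divide_le_eq mult.commute)
    also have "\<dots> \<le> Q powr (1 / \<epsilon>) * u powr M"
      using l by (intro mult_left_mono powr_mono) (auto simp: M_def)
    finally have "r / \<rho> y \<le> Q powr (1 / \<epsilon>) * u powr M" .
    then have "1 + r / \<rho> y \<le> u powr M + Q powr (1 / \<epsilon>) * u powr M"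
    proof -
      have "1 \<le> u powr M" using l by (intro ge_one_powr_ge_zero) (auto simp: M_def)
      then show ?thesis using \<open>r / \<rho> y \<le> Q powr (1 / \<epsilon>) * u powr M\<close> by linarith
    qed
    then show ?thesis by (simp add: K_def u_def R_def distrib_right)
  qed
  show ?thesis
    by (rule that[of K M]) (use \<rho>pos main in \<open>auto simp: K_def M_def\<close>)
qed

section \<open>The weight condition as an inequality for test functions\<close>

text \<open>The lower limit is approached by a sequence from below, which leaves countably many
  exceptional null sets.\<close>

lemma AE_essinf_le: "AE x in M. essinf M f \<le> f x"
proof (cases "essinf M f = 0")
  case False
  then obtain u where u: "\<And>n. u n < essinf M f" "u \<longlonglongrightarrow> essinf M f"
    using approx_from_below_dense_linorder[of 0 "essinf M f"] by (auto simp: less_le)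
  have "AE x in M. u n < f x" for n
    using less_LiminfD[OF u(1)[unfolded essinf_def]] by (simp add: essinf_def)
  then have "AE x in M. \<forall>n. u n < f x" by (subst AE_all_countable) auto
  then show ?thesis
    by eventually_elim (rule LIMSEQ_le_const2[OF u(2)], auto intro: less_imp_le)
qed auto

lemma ball_lebesgue [measurable]: "ball (x :: 'a::euclidean_space) r \<in> sets lebesgue"
  by simp

lemma weight_measurable: "weight w \<Longrightarrow> w \<in> borel_measurable lebesgue"
  by (auto simp: weight_def intro: locally_integrable_measurable)

text \<open>The form in which the \<open>A\<^bsub>p,q\<^esub>\<close> condition is used.\<close>

locale A_weight =
  fixes \<omega> \<rho> :: "real ^ 'n \<Rightarrow> real" and p q C \<theta> :: real
  assumes \<omega>_nn: "0 \<le> \<omega> x" and \<omega>_measurable [measurable]: "\<omega> \<in> borel_measurable lebesgue"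
    and \<omega>_nonzero: "\<not> (AE x in lebesgue. \<omega> x = 0)"
    and p: "1 \<le> p" and pq: "p < q" and C_pos: "0 < C"
    and test_function: "\<And>x r g. 0 < r \<Longrightarrow> g \<in> borel_measurable lebesgue \<Longrightarrow>
     (\<integral>\<^sup>+y\<in>ball x r. g y \<partial>lebesgue) * wpow \<omega> q (ball x r) epowr (1 / q)
       \<le> ennreal (C * (1 + r / \<rho> x) powr \<theta>) * ennreal (measure lebesgue (ball x r) powr (1 / q + 1 - 1 / p))
          * (\<integral>\<^sup>+y\<in>ball x r. (g y * ennreal (\<omega> y)) epowr p \<partial>lebesgue) epowr (1 / p)"

text \<open>Hoelder's inequality for \<open>g = (g \<omega>) \<omega>\<^sup>-\<^sup>1\<close> combines with the \<open>A\<^bsub>p,q\<^esub>\<close> condition into one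
  inequality that no longer mentions \<open>\<omega>\<^bsup>-p'\<^esup>\<close> and has the same form for \<open>p = 1\<close> and \<open>p > 1\<close>.
  If \<open>\<omega>\<close> vanishes on a part of the ball of positive measure, then \<open>\<omega>\<^bsup>-p'\<^esup>\<close> has infinite integral
  and the \<open>A\<^bsub>p,q\<^esub>\<close> condition forces \<open>\<omega>\<^sup>q(B) = 0\<close>.\<close>

lemma A_class_imp_A_weight:
  fixes \<omega> :: "real ^ 'n \<Rightarrow> real"
  assumes w: "\<omega> \<in> A_class \<rho> \<theta> p q" and pq: "1 \<le> p" "p < q"
  obtains C where "A_weight \<omega> \<rho> p q C \<theta>"
proof -
  have wt: "weight \<omega>" using w by (simp add: A_class_def)
  have nn: "0 \<le> \<omega> x" for x using wt by (simp add: weight_def)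
  note [measurable] = weight_measurable[OF wt]
  obtain C where C: "0 < C" and *: "\<And>x0 r. r > 0 \<Longrightarrow>
        (if p = 1 then
           eaverage (ball x0 r) (\<lambda>x. ennreal (\<omega> x) epowr q) epowr (1 / q)
           \<le> ennreal (C * (1 + r / \<rho> x0) powr \<theta>)
               * essinf (lebesgue_on (ball x0 r)) (\<lambda>x. ennreal (\<omega> x))
         else
           eaverage (ball x0 r) (\<lambda>x. ennreal (\<omega> x) epowr q) epowr (1 / q)
             * eaverage (ball x0 r) (\<lambda>x. ennreal (\<omega> x) epowr (- (p / (p - 1))))
                 epowr (1 / (p / (p - 1)))
           \<le> ennreal (C * (1 + r / \<rho> x0) powr \<theta>))"
    using w unfolding A_class_def by blast
  show ?thesis
  proof (rule that[of C], unfold_locales)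
    fix x :: "real ^ 'n" and r :: real and g :: "real ^ 'n \<Rightarrow> ennreal"
    assume r: "0 < r" and g [measurable]: "g \<in> borel_measurable lebesgue"
    let ?B = "ball x r" and ?c = "ennreal (C * (1 + r / \<rho> x) powr \<theta>)"
    let ?m = "measure lebesgue (ball x r)"
    let ?W = "wpow \<omega> q ?B" and ?k = "ennreal (?m powr (1 / q + 1 - 1 / p))"
    let ?G = "\<integral>\<^sup>+y\<in>?B. g y \<partial>lebesgue"
      and ?N = "(\<integral>\<^sup>+y\<in>?B. (g y * ennreal (\<omega> y)) epowr p \<partial>lebesgue) epowr (1 / p)"
    have q: "0 < q" "0 < 1 / q" using pq by auto
    have m: "0 < ?m" "vol ?B = ennreal ?m"
      using measure_ball_pos[OF r] emeasure_ball_eq by auto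
    have avW: "eaverage ?B (\<lambda>x. ennreal (\<omega> x) epowr q) epowr (1 / q) = ?W epowr (1 / q) * ennreal (?m powr - (1 / q))"
      unfolding eaverage_def wpow_def m(2) by (rule epowr_divide_real[OF m(1) q(2)])
    have cancel: "ennreal (?m powr - a) * ennreal (?m powr a) = 1" for a
      using m(1) by (simp add: ennreal_mult[symmetric] powr_minus)
    show "?G * ?W epowr (1 / q)
       \<le> ?c * ?k
          * ?N"
    proof (cases "p = 1")
      case True
      let ?e = "essinf (lebesgue_on ?B) (\<lambda>x. ennreal (\<omega> x))"
      have "?W epowr (1 / q) * ennreal (?m powr - (1 / q)) \<le> ?c * ?e"
        using *[OF r, of x] True by (simp only: avW if_True refl)
      then have "?W epowr (1 / q) * ennreal (?m powr - (1 / q)) * ennreal (?m powr (1 / q))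
          \<le> ?c * ?e * ennreal (?m powr (1 / q))"
        by (rule mult_right_mono) simp
      then have W: "?W epowr (1 / q) \<le> ?c * ennreal (?m powr (1 / q)) * ?e"
        by (simp only: mult.assoc cancel mult_1_right) (simp only: mult_ac)
      have "AE y in lebesgue_on ?B. ?e \<le> ennreal (\<omega> y)" by (rule AE_essinf_le)
      then have AEe: "AE y in lebesgue. y \<in> ?B \<longrightarrow> ?e \<le> ennreal (\<omega> y)"
        by (subst (asm) AE_restrict_space_iff) auto
      have "?G * ?e = (\<integral>\<^sup>+y\<in>?B. g y * ?e \<partial>lebesgue)"
        by (subst nn_integral_multc[symmetric]) (auto simp: mult_ac)
      also have "\<dots> \<le> (\<integral>\<^sup>+y\<in>?B. g y * ennreal (\<omega> y) \<partial>lebesgue)"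
        using AEe by (intro nn_integral_mono_AE) (auto simp: indicator_def mult_left_mono elim!: eventually_mono)
      finally have G: "?G * ?e \<le> (\<integral>\<^sup>+y\<in>?B. g y * ennreal (\<omega> y) \<partial>lebesgue)" .
      have "?G * ?W epowr (1 / q)
          \<le> ?G * (?c * ennreal (?m powr (1 / q)) * ?e)"
        using W by (rule mult_left_mono) simp
      also have "\<dots> = ?c * ennreal (?m powr (1 / q)) * (?G * ?e)"
        by (simp only: mult_ac)
      also have "\<dots> \<le> ?c * ennreal (?m powr (1 / q)) * (\<integral>\<^sup>+y\<in>?B. g y * ennreal (\<omega> y) \<partial>lebesgue)"
        using G by (rule mult_left_mono) simp
      finally show ?thesis using True by simp
    next
      case False
      then have p: "1 < p" using pq by simp
      define p' where "p' = p / (p - 1)"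
      have p': "0 < p'" "1 / p' = 1 - 1 / p" "0 < 1 / p'"
        using p by (auto simp: p'_def field_simps)
      let ?P = "\<integral>\<^sup>+y\<in>?B. ennreal (\<omega> y) epowr (- p') \<partial>lebesgue"
      have avP: "eaverage ?B (\<lambda>x. ennreal (\<omega> x) epowr (- p')) epowr (1 / p') = ?P epowr (1 / p') * ennreal (?m powr - (1 / p'))"
        unfolding eaverage_def m(2) by (rule epowr_divide_real[OF m(1) p'(3)])
      have "?W epowr (1 / q) * ennreal (?m powr - (1 / q)) * (?P epowr (1 / p') * ennreal (?m powr - (1 / p'))) \<le> ?c"
        using *[OF r, of x] False by (simp only: avW avP p'_def[symmetric] if_False)
      then have "?W epowr (1 / q) * ennreal (?m powr - (1 / q)) * (?P epowr (1 / p') * ennreal (?m powr - (1 / p')))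
           * (ennreal (?m powr (1 / q)) * ennreal (?m powr (1 / p')))
          \<le> ?c * (ennreal (?m powr (1 / q)) * ennreal (?m powr (1 / p')))"
        by (rule mult_right_mono) simp
      also have "?W epowr (1 / q) * ennreal (?m powr - (1 / q)) * (?P epowr (1 / p') * ennreal (?m powr - (1 / p')))
           * (ennreal (?m powr (1 / q)) * ennreal (?m powr (1 / p')))
          = ?W epowr (1 / q) * ?P epowr (1 / p') * (ennreal (?m powr - (1 / q)) * ennreal (?m powr (1 / q)))
             * (ennreal (?m powr - (1 / p')) * ennreal (?m powr (1 / p')))"
        by (simp only: mult_ac)
      also have "\<dots> = ?P epowr (1 / p') * ?W epowr (1 / q)"
        by (simp only: cancel mult_1_right) (rule mult.commute)
      also have "ennreal (?m powr (1 / q)) * ennreal (?m powr (1 / p')) = ?k"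
        unfolding p'(2) by (simp add: ennreal_mult[symmetric] powr_add[symmetric] add_diff_eq)
      finally have PW: "?P epowr (1 / p') * ?W epowr (1 / q) \<le> ?c * ?k" .
      show ?thesis
      proof (cases "?W = 0")
        case True
        then show ?thesis using q by simp
      next
        case False
        have "?P \<noteq> top"
        proof
          assume "?P = top"
          then have "top \<le> ?c * ?k"
            using PW p' q False by (simp add: ennreal_top_mult epowr_eq_0_iff)
          then show False by (simp add: top_unique ennreal_mult_eq_top_iff)
        qed
        then have "AE y in lebesgue. ennreal (\<omega> y) epowr (- p') * indicator ?B y \<noteq> \<infinity>"
          by (intro nn_integral_PInf_AE) auto
        then have pos: "AE y in lebesgue. y \<in> ?B \<longrightarrow> 0 < \<omega> y"
        proof eventually_elim
          case (elim y)
          show ?case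
          proof
            assume "y \<in> ?B"
            then have "ennreal (\<omega> y) epowr (- p') \<noteq> top" using elim by simp
            then have "\<omega> y \<noteq> 0" using p'(1) by (auto simp: epowr_def)
            then show "0 < \<omega> y" using nn[of y] by simp
          qed
        qed
        have "?G
            = (\<integral>\<^sup>+y\<in>?B. ((g y * ennreal (\<omega> y)) epowr p) epowr (1 / p)
                 * (ennreal (\<omega> y) epowr (- p')) epowr (1 - 1 / p) \<partial>lebesgue)"
        proof (rule nn_integral_cong_AE)
          show "AE y in lebesgue. g y * indicator ?B y = ((g y * ennreal (\<omega> y)) epowr p) epowr (1 / p)
                 * (ennreal (\<omega> y) epowr (- p')) epowr (1 - 1 / p) * indicator ?B y"
            using pos
          proof eventually_elim
            case (elim y)
            show ?case
            proof (cases "y \<in> ?B")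
              case True
              then have o: "0 < \<omega> y" using elim by blast
              have "(ennreal (\<omega> y) epowr (- p')) epowr (1 - 1 / p) = ennreal (\<omega> y powr (- p' * (1 / p')))"
                using o p by (simp add: epowr_ennreal_pos powr_powr p'(2))
              also have "- p' * (1 / p') = -1" using p'(1) by simp
              finally have 1: "(ennreal (\<omega> y) epowr (- p')) epowr (1 - 1 / p) = ennreal (1 / \<omega> y)"
                using o by (simp add: powr_minus_divide)
              have "ennreal (\<omega> y) * ennreal (1 / \<omega> y) = 1"
                using o by (simp add: ennreal_mult[symmetric])
              then show ?thesis
                using p by (simp add: 1 epowr_epowr mult.assoc)
            qed auto
          qed
        qed
        also have "\<dots> \<le> ?N * ?P epowr (1 - 1 / p)"
          using p by (intro Hoelder_nn_set_integral) auto
        finally have "?G * ?W epowr (1 / q)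
            \<le> ?N * ?P epowr (1 - 1 / p) * ?W epowr (1 / q)"
          by (rule mult_right_mono) simp
        also have "\<dots> = (?P epowr (1 / p') * ?W epowr (1 / q))
            * ?N"
          unfolding p'(2) by (simp only: mult_ac)
        also have "\<dots> \<le> ?c * ?k
            * ?N"
          by (rule mult_right_mono[OF PW]) simp
        finally show ?thesis .
      qed
    qed
  qed (use C wt pq weight_measurable[OF wt] in \<open>auto simp: weight_def\<close>)
qed

context A_weight
begin

lemma q: "1 < q" "0 < q" "0 < 1 / q"
  using p pq by auto

abbreviation W :: "(real ^ 'n) set \<Rightarrow> ennreal" where "W \<equiv> wpow \<omega> q"

abbreviation Wq :: "(real ^ 'n) set \<Rightarrow> ennreal" where "Wq S \<equiv> W S epowr (1 / q)"

abbreviation weighted_norm :: "real \<Rightarrow> (real ^ 'n \<Rightarrow> ennreal) \<Rightarrow> (real ^ 'n) set \<Rightarrow> ennreal" where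
  "weighted_norm a g S \<equiv> (\<integral>\<^sup>+y\<in>S. (g y * ennreal (\<omega> y)) epowr a \<partial>lebesgue) epowr (1 / a)"

abbreviation wosc_root :: "(real ^ 'n \<Rightarrow> real) \<Rightarrow> (real ^ 'n) set \<Rightarrow> ennreal" where
  "wosc_root f S \<equiv> wosc \<omega> f q S epowr (1 / q)"

lemma test_function_q:
  assumes r: "0 < r" and g [measurable]: "g \<in> borel_measurable lebesgue"
  shows "(\<integral>\<^sup>+y\<in>ball x r. g y \<partial>lebesgue) * Wq (ball x r)
       \<le> ennreal (C * (1 + r / \<rho> x) powr \<theta> * measure lebesgue (ball x r))
          * weighted_norm q g (ball x r)"
proof -
  let ?c = "C * (1 + r / \<rho> x) powr \<theta>" and ?m = "measure lebesgue (ball x r)"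
  have m: "0 < ?m" using measure_ball_pos[OF r] .
  have a: "0 < 1 / p - 1 / q" using p pq by (simp add: field_simps)
  have "weighted_norm p g (ball x r)
      \<le> vol (ball x r) epowr (1 / p - 1 / q)
        * weighted_norm q g (ball x r)"
    using p pq by (intro power_mean_nn_set_integral) auto
  also have "vol (ball x r) epowr (1 / p - 1 / q) = ennreal (?m powr (1 / p - 1 / q))"
    unfolding emeasure_ball_eq using m a by (intro epowr_ennreal) auto
  finally have "ennreal ?c * ennreal (?m powr (1 / q + 1 - 1 / p))
        * weighted_norm p g (ball x r)
      \<le> ennreal ?c * ennreal (?m powr (1 / q + 1 - 1 / p)) * (ennreal (?m powr (1 / p - 1 / q))
        * weighted_norm q g (ball x r))"
    by (rule mult_left_mono) simp
  also have "\<dots> = ennreal (?c * ?m) * weighted_norm q g (ball x r)"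
  proof -
    have "?m powr (1 / q + 1 - 1 / p) * ?m powr (1 / p - 1 / q) = ?m"
      using m by (simp add: powr_add[symmetric])
    then have "ennreal (?m powr (1 / q + 1 - 1 / p)) * ennreal (?m powr (1 / p - 1 / q)) = ennreal ?m"
      by (simp add: ennreal_mult[symmetric])
    moreover have "ennreal (?c * ?m) = ennreal ?c * ennreal ?m"
      using C_pos by (intro ennreal_mult) auto
    ultimately show ?thesis by (simp only: mult.assoc[symmetric]) (simp only: mult.assoc)
  qed
  finally show ?thesis using test_function[OF r g, of x] by (rule order_trans[rotated])
qed

lemma W_mono: "A \<subseteq> B \<Longrightarrow> W A \<le> W B"
  unfolding wpow_def by (intro nn_integral_mono) (auto simp: indicator_def)

lemma indicator_test_integrals:
  assumes [measurable]: "F \<in> sets lebesgue" and "F \<subseteq> B" and a: "0 < a"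
  shows "(\<integral>\<^sup>+y\<in>B. indicator F y \<partial>lebesgue) = vol F"
    and "(\<integral>\<^sup>+y\<in>B. (indicator F y * ennreal (\<omega> y)) epowr a \<partial>lebesgue) = wpow \<omega> a F"
proof -
  have "(\<integral>\<^sup>+y\<in>B. indicator F y \<partial>lebesgue) = (\<integral>\<^sup>+y. indicator F y \<partial>lebesgue)"
    using assms by (intro nn_integral_cong) (auto simp: indicator_def)
  then show "(\<integral>\<^sup>+y\<in>B. indicator F y \<partial>lebesgue) = vol F" by simp
  show "(\<integral>\<^sup>+y\<in>B. (indicator F y * ennreal (\<omega> y)) epowr a \<partial>lebesgue) = wpow \<omega> a F"
    unfolding wpow_def using assms by (intro nn_integral_cong) (auto simp: indicator_def)
qed

text \<open>The test function \<open>1\<^sub>F\<close>.  This is the source of doubling, of the lower bound for the weight of large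
  subsets, and of the finiteness and positivity of \<open>W\<close>.\<close>

lemma W_fraction:
  assumes r: "0 < r" and F [measurable]: "F \<in> sets lebesgue" and sub: "F \<subseteq> ball x r"
  shows "vol F * Wq (ball x r)
       \<le> ennreal (C * (1 + r / \<rho> x) powr \<theta> * measure lebesgue (ball x r)) * Wq F"
proof -
  have "(indicator F :: _ \<Rightarrow> ennreal) \<in> borel_measurable lebesgue" by measurable
  from test_function_q[OF r this, of x] show ?thesis
    by (simp only: indicator_test_integrals[OF F sub q(2)])
qed

text \<open>Apply the previous bound to the part \<open>F\<close> of the ball on which \<open>\<omega> \<le> n\<close>, with \<open>n\<close> so large that
  \<open>F\<close> has positive measure; \<open>W F\<close> is then finite.\<close>

lemma W_ball_finite:
  assumes r: "0 < r"
  shows "W (ball x r) < top"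
proof -
  let ?F = "\<lambda>n. ball x r \<inter> {y \<in> space lebesgue. \<omega> y \<le> real n}"
  have F: "?F n \<in> sets lebesgue" for n by (intro sets.Int) measurable
  have "\<exists>n. ?F n \<notin> null_sets lebesgue"
  proof (rule ccontr)
    assume "\<nexists>n. ?F n \<notin> null_sets lebesgue"
    then have "(\<Union>n. ?F n) \<in> null_sets lebesgue" by (intro null_sets_UN) auto
    moreover have "(\<Union>n. ?F n) = ball x r" using real_arch_simple by auto
    ultimately have "vol (ball x r) = 0" by auto
    then show False using emeasure_ball_eq[of x r] measure_ball_pos[OF r, of x] by simp
  qed
  then obtain n where n: "?F n \<notin> null_sets lebesgue" by blast
  then have F0: "vol (?F n) \<noteq> 0" using F by (auto simp: null_sets_def)
  have "W (?F n) \<le> (\<integral>\<^sup>+y\<in>ball x r. ennreal (real n powr q) \<partial>lebesgue)"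
    unfolding wpow_def using \<omega>_nn q
    by (intro nn_integral_mono) (auto simp: indicator_def epowr_ennreal intro!: ennreal_leI powr_mono2)
  also have "\<dots> = ennreal (real n powr q * measure lebesgue (ball x r))"
    by (subst nn_integral_cmult_indicator) (simp_all add: emeasure_ball_eq ennreal_mult)
  finally have "W (?F n) \<noteq> top" by (auto simp: top_unique)
  then have "ennreal (C * (1 + r / \<rho> x) powr \<theta> * measure lebesgue (ball x r)) * Wq (?F n) \<noteq> top"
    using q by (simp add: ennreal_mult_eq_top_iff epowr_eq_top_iff)
  then have "vol (?F n) * Wq (ball x r) \<noteq> top"
    using W_fraction[OF r F[of n], of x] by (auto simp: top_unique)
  then show ?thesis
    using F0 q by (auto simp: ennreal_mult_eq_top_iff epowr_eq_top_iff top.not_eq_extremum)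
qed

text \<open>The set where \<open>\<omega> = 0\<close> carries no weight, so it is null in every ball of positive weight, and all
  sufficiently large balls around the origin have positive weight.\<close>

lemma \<omega>_pos_AE: "AE x in lebesgue. 0 < \<omega> x"
proof -
  have "\<exists>R>0. W (ball 0 R) \<noteq> 0"
  proof (rule ccontr)
    assume "\<not> (\<exists>R>0. W (ball 0 R) \<noteq> 0)"
    then have "W (ball 0 (real (Suc n))) = 0" for n by (metis of_nat_0_less_iff zero_less_Suc)
    then have "AE y in lebesgue. ennreal (\<omega> y) epowr q * indicator (ball 0 (real (Suc n))) y = 0" for n
      unfolding wpow_def by (subst (asm) nn_integral_0_iff_AE) auto
    then have "AE y in lebesgue. \<forall>n. ennreal (\<omega> y) epowr q * indicator (ball 0 (real (Suc n))) y = 0"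
      by (subst AE_all_countable) auto
    then have "AE y in lebesgue. \<omega> y = 0"
    proof eventually_elim
      case (elim y)
      obtain n where "dist 0 y < real n" using reals_Archimedean2 by blast
      then have "y \<in> ball 0 (real (Suc n))" by simp
      then show ?case using elim[rule_format, of n] q \<omega>_nn[of y]
        by (auto simp: epowr_eq_0_iff ennreal_eq_0_iff)
    qed
    then show False using \<omega>_nonzero by blast
  qed
  then obtain R where R: "0 < R" "W (ball 0 R) \<noteq> 0" by blast
  let ?Z = "\<lambda>n. ball 0 (max R (real n)) \<inter> {y \<in> space lebesgue. \<omega> y = 0}"
  have Z: "?Z n \<in> null_sets lebesgue" for n
  proof -
    let ?t = "max R (real n)"
    have Zs: "?Z n \<in> sets lebesgue" by (intro sets.Int) measurable
    have "W (?Z n) = (\<integral>\<^sup>+y. 0 \<partial>(lebesgue :: (real ^ 'n) measure))"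
      unfolding wpow_def using q by (intro nn_integral_cong) (auto simp: indicator_def)
    then have "W (?Z n) = 0" by simp
    moreover have "vol (?Z n) * Wq (ball 0 ?t)
        \<le> ennreal (C * (1 + ?t / \<rho> 0) powr \<theta> * measure lebesgue (ball (0 :: real ^ 'n) ?t)) * Wq (?Z n)"
      using R by (intro W_fraction Zs) auto
    moreover have "W (ball 0 ?t) \<noteq> 0"
      using W_mono[of "ball 0 R" "ball 0 ?t"] R(2) by (auto simp: subset_ball)
    ultimately have "vol (?Z n) = 0" using q by (simp add: epowr_eq_0_iff)
    then show ?thesis using Zs by (simp add: null_sets_def)
  qed
  then have "(\<Union>n. ?Z n) \<in> null_sets lebesgue" by (intro null_sets_UN) auto
  moreover have "{y \<in> space lebesgue. \<not> 0 < \<omega> y} \<subseteq> (\<Union>n. ?Z n)"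
  proof
    fix y assume y: "y \<in> {y \<in> space lebesgue. \<not> 0 < \<omega> y}"
    obtain n where "dist 0 y < real n" using reals_Archimedean2 by blast
    then show "y \<in> (\<Union>n. ?Z n)" using y \<omega>_nn[of y] by (auto intro!: exI[of _ n])
  qed
  ultimately show ?thesis by (rule AE_I')
qed

lemma wpow_pos:
  assumes [measurable]: "F \<in> sets lebesgue" and F: "vol F \<noteq> 0" and a: "0 < a"
  shows "wpow \<omega> a F \<noteq> 0"
proof
  assume "wpow \<omega> a F = 0"
  then have "AE y in lebesgue. ennreal (\<omega> y) epowr a * indicator F y = 0"
    unfolding wpow_def by (subst (asm) nn_integral_0_iff_AE) auto
  then have "AE y in lebesgue. y \<notin> F"
    using \<omega>_pos_AE
  proof eventually_elim
    case (elim y)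
    then show ?case using a by (auto simp: epowr_eq_0_iff indicator_def)
  qed
  then have "F \<in> null_sets lebesgue" by (simp add: AE_iff_null_sets)
  then show False using F by auto
qed

end

section \<open>Weighted and unweighted oscillation\<close>

lemma ennreal_mult_merge:
  assumes "0 \<le> a" "0 \<le> b" "a * b = c"
  shows "ennreal a * (ennreal b * t) = ennreal c * t"
  using assms by (metis ennreal_mult mult.assoc)

text \<open>The sets \<open>E(x,r)\<close> stand for cubes or balls, described by their measure and by a comparison
  with balls.  The constant \<open>CARD('n)\<close> in the upper inclusion is a convenient upper bound for the ratio
  of the half diagonal of a cube to its side.\<close>

locale weighted_shapes = A_weight \<omega> \<rho> p q C \<theta>
  for \<omega> \<rho> :: "real ^ 'n \<Rightarrow> real" and p q C \<theta> :: real +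
  fixes K M e \<beta> :: real and E :: "real ^ 'n \<Rightarrow> real \<Rightarrow> (real ^ 'n) set"
  assumes \<theta>: "0 \<le> \<theta>" and \<rho>_pos: "0 < \<rho> x" and K: "1 \<le> K" and M: "1 \<le> M"
    and \<rho>_comparison: "0 < r \<Longrightarrow> dist x y < r \<Longrightarrow> 1 + r / \<rho> y \<le> K * (1 + r / \<rho> x) powr M"
    and \<beta>: "0 \<le> \<beta>" and e: "0 < e"
    and shape_sets [measurable]: "E x r \<in> sets lebesgue"
    and shape_measure: "0 < r \<Longrightarrow> vol (E x r) = ennreal (e * r ^ CARD('n))"
    and shape_lower: "0 < r \<Longrightarrow> ball x (r / 2) \<subseteq> E x r"
    and shape_upper: "0 < r \<Longrightarrow> E x r \<subseteq> ball x (real CARD('n) * r)"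
begin

abbreviation scale :: "real ^ 'n \<Rightarrow> real \<Rightarrow> real" where "scale x r \<equiv> 1 + r / \<rho> x"

text \<open>The conditions of the theorem, cleared of denominators, with \<open>|E(x,r)|\<close> replaced by the multiple
  \<open>r\<^sup>d\<close> of it: for locally integrable \<open>f\<close>, \<open>osc_bound\<close> is membership
  in \<open>BMO\<close> or \<open>Lip\<^sub>\<beta>\<close>, and \<open>q_bound\<close> and \<open>p_bound\<close> are the two
  weighted conditions, normalized by \<open>\<omega>\<^sup>q(E)\<close> and \<open>\<omega>\<^sup>p(E)\<close>.\<close>

definition osc_bound :: "(real ^ 'n \<Rightarrow> real) \<Rightarrow> bool" where
  "osc_bound f \<longleftrightarrow> (\<exists>c>0. \<exists>N>0. \<forall>x r. 0 < r \<longrightarrow>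
     deviation f (average (E x r) f) (E x r)
       \<le> ennreal (c * scale x r powr N * (r ^ CARD('n) * r powr \<beta>)))"

definition q_bound :: "(real ^ 'n \<Rightarrow> real) \<Rightarrow> bool" where
  "q_bound f \<longleftrightarrow> (\<exists>c>0. \<exists>N>0. \<forall>x r. 0 < r \<longrightarrow>
     wosc_root f (E x r)
       \<le> ennreal (c * scale x r powr N * r powr \<beta>) * Wq (E x r))"

definition p_bound :: "(real ^ 'n \<Rightarrow> real) \<Rightarrow> bool" where
  "p_bound f \<longleftrightarrow> (\<exists>c>0. \<exists>N>0. \<forall>x r. 0 < r \<longrightarrow>
     wosc_root f (E x r)
       \<le> ennreal (c * scale x r powr N * r powr (\<beta> + CARD('n) / q - CARD('n) / p))
          * wpow \<omega> p (E x r) epowr (1 / p))"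

definition ball_const :: real where
  "ball_const = measure lebesgue (ball (0 :: real ^ 'n) 1)"

lemma ball_const_pos: "0 < ball_const"
  using measure_unit_ball_pos by (simp add: ball_const_def)

lemma measure_ball_eq: "0 < r \<Longrightarrow> measure lebesgue (ball (x :: real ^ 'n) r) = ball_const * r ^ CARD('n)"
  using measure_ball_conv[of r x] by (simp add: ball_const_def)

lemma scale_ge_1: "0 < r \<Longrightarrow> 1 \<le> 1 + r / \<rho> x"
  using \<rho>_pos[of x] by simp

lemma scale_dilate:
  assumes "1 \<le> t" "0 < r" shows "1 + t * r / \<rho> x \<le> t * scale x r"
  using assms by (simp add: distrib_left)

lemma scale_dilate_powr:
  assumes "1 \<le> t" "0 < r" "0 \<le> a"
  shows "(1 + t * r / \<rho> x) powr a \<le> t powr a * scale x r powr a"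
proof -
  have "0 \<le> 1 + t * r / \<rho> x" using assms \<rho>_pos[of x] by simp
  then have "(1 + t * r / \<rho> x) powr a \<le> (t * scale x r) powr a"
    using assms scale_dilate[OF assms(1,2), of x] by (intro powr_mono2) auto
  also have "\<dots> = t powr a * scale x r powr a"
    using assms scale_ge_1[OF assms(2), of x] by (simp add: powr_mult)
  finally show ?thesis .
qed

lemma card_ge_1: "1 \<le> real CARD('n)"
  using one_le_card_finite[where 'a = 'n] by simp

lemma shape_fmeasurable: "0 < r \<Longrightarrow> E x r \<in> lmeasurable"
  by (intro fmeasurableI shape_sets) (simp only: shape_measure ennreal_less_top infinity_ennreal_def)

lemma shape_measure_pos: "0 < r \<Longrightarrow> 0 < measure lebesgue (E x r)"
  using shape_measure[of r x] e by (simp add: measure_def)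

lemma W_shape_finite: "0 < r \<Longrightarrow> W (E x r) < top"
  using W_mono[OF shape_upper[of r x]] W_ball_finite[of "CARD('n) * r" x]
  by (meson card_ge_1 less_le_trans mult_pos_pos order_le_less_trans zero_less_one)

lemma W_shape_pos:
  assumes r: "0 < r" shows "W (E x r) \<noteq> 0"
proof (intro wpow_pos q shape_sets)
  show "vol (E x r) \<noteq> 0" unfolding shape_measure[OF r] using e r by simp
qed

lemma W_ball_pos: "0 < r \<Longrightarrow> W (ball x r) \<noteq> 0"
  using measure_ball_pos[of r x] by (intro wpow_pos q) (auto simp: emeasure_ball_eq)

lemma shape_integrable:
  assumes "locally_integrable f" shows "0 < r \<Longrightarrow> f absolutely_integrable_on E x r"
  using bounded_subset[OF bounded_ball shape_upper[of r x]]
  by (intro locally_integrable_bounded assms) auto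

text \<open>From the weighted to the unweighted oscillation: the test function is \<open>|f - f\<^sub>E|\<close>.\<close>

lemma q_bound_imp_osc_bound:
  assumes f: "locally_integrable f" and qb: "q_bound f"
  shows "osc_bound f"
proof -
  note [measurable] = locally_integrable_measurable[OF f]
  obtain c N where c: "0 < c" "0 < N" and *: "\<And>x r. 0 < r \<Longrightarrow> wosc_root f (E x r)
       \<le> ennreal (c * scale x r powr N * r powr \<beta>) * Wq (E x r)"
    using qb unfolding q_bound_def by blast
  let ?n = "real CARD('n)"
  define c' where "c' = C * ?n powr \<theta> * ball_const * ?n ^ CARD('n) * c"
  have c': "0 < c'"
    using C_pos c ball_const_pos card_ge_1 by (simp add: c'_def)
  have "deviation f (average (E x r) f) (E x r)
       \<le> ennreal (c' * scale x r powr (\<theta> + N) * (r ^ CARD('n) * r powr \<beta>))" (is "?I \<le> _")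
    if r: "0 < r" for x r
  proof -
    let ?B = "ball x (?n * r)"
    have nr: "0 < ?n * r" using r card_ge_1 by simp
    define u where "u = 1 + r / \<rho> x"
    have u: "1 \<le> u" unfolding u_def by (rule scale_ge_1[OF r])
    define g where "g y = ennreal \<bar>f y - average (E x r) f\<bar> * indicator (E x r) y" for y
    have [measurable]: "g \<in> borel_measurable lebesgue" unfolding g_def by measurable
    have 1: "(\<integral>\<^sup>+y\<in>?B. g y \<partial>lebesgue) = ?I"
      unfolding g_def using shape_upper[OF r, of x] by (intro nn_integral_cong) (auto simp: indicator_def)
    have 2: "(\<integral>\<^sup>+y\<in>?B. (g y * ennreal (\<omega> y)) epowr q \<partial>lebesgue) = wosc \<omega> f q (E x r)"
      unfolding g_def wosc_def using shape_upper[OF r, of x] q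
      by (intro nn_integral_cong) (auto simp: indicator_def epowr_mult)
    have "?I * Wq ?B
        \<le> ennreal (C * (1 + ?n * r / \<rho> x) powr \<theta> * measure lebesgue ?B) * wosc_root f (E x r)"
      using test_function_q[OF nr, of g x] by (simp add: 1 2)
    also have "\<dots> \<le> ennreal (C * (?n powr \<theta> * u powr \<theta>) * (ball_const * (?n * r) ^ CARD('n)))
        * (ennreal (c * u powr N * r powr \<beta>) * Wq ?B)"
    proof (intro mult_mono ennreal_leI)
      show "(1 + ?n * r / \<rho> x) powr \<theta> \<le> ?n powr \<theta> * u powr \<theta>"
        unfolding u_def by (intro scale_dilate_powr card_ge_1 r \<theta>)
      show "measure lebesgue ?B \<le> ball_const * (?n * r) ^ CARD('n)"
        using measure_ball_eq[OF nr, of x] by simp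
      have "Wq (E x r) \<le> Wq ?B"
        using q by (intro epowr_mono W_mono shape_upper r) auto
      then show "wosc_root f (E x r) \<le> ennreal (c * u powr N * r powr \<beta>) * Wq ?B"
        using *[OF r, of x] unfolding u_def by (meson mult_left_mono order_trans zero_le)
    qed (use C_pos in auto)
    also have "\<dots> = ennreal (c' * u powr (\<theta> + N) * (r ^ CARD('n) * r powr \<beta>)) * Wq ?B"
    proof -
      have "C * (?n powr \<theta> * u powr \<theta>) * (ball_const * (?n * r) ^ CARD('n)) * (c * u powr N * r powr \<beta>)
          = c' * u powr (\<theta> + N) * (r ^ CARD('n) * r powr \<beta>)"
        by (simp add: c'_def powr_add power_mult_distrib)
      moreover have "0 \<le> C * (?n powr \<theta> * u powr \<theta>) * (ball_const * (?n * r) ^ CARD('n))"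
        using C_pos r ball_const_pos by simp
      ultimately show ?thesis using c by (intro ennreal_mult_merge) auto
    qed
    finally have "Wq ?B * ?I \<le> Wq ?B * ennreal (c' * u powr (\<theta> + N) * (r ^ CARD('n) * r powr \<beta>))"
      by (simp only: mult.commute)
    moreover have "Wq ?B \<noteq> 0" "Wq ?B \<noteq> top"
      using W_ball_pos[OF nr, of x] W_ball_finite[OF nr, of x] q by (auto simp: epowr_eq_0_iff epowr_eq_top_iff)
    ultimately show ?thesis
      by (simp add: ennreal_mult_le_mult_iff u_def)
  qed
  then show ?thesis
    unfolding osc_bound_def using c' c \<theta> by (intro exI[of _ c'] conjI exI[of _ "\<theta> + N"]) auto
qed

lemma p_bound_imp_q_bound:
  assumes pb: "p_bound f"
  shows "q_bound f"
proof -
  obtain c N where c: "0 < c" "0 < N" and *: "\<And>x r. 0 < r \<Longrightarrow> wosc_root f (E x r)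
       \<le> ennreal (c * scale x r powr N * r powr (\<beta> + CARD('n) / q - CARD('n) / p))
          * wpow \<omega> p (E x r) epowr (1 / p)"
    using pb unfolding p_bound_def by blast
  let ?a = "1 / p - 1 / q"
  have a: "0 < ?a" using p pq by (simp add: field_simps)
  define c' where "c' = c * e powr ?a"
  have c': "0 < c'" using c e by (simp add: c'_def)
  have "wosc_root f (E x r)
       \<le> ennreal (c' * scale x r powr N * r powr \<beta>) * Wq (E x r)"
    if r: "0 < r" for x r
  proof -
    let ?u = "1 + r / \<rho> x"
    have "wpow \<omega> p (E x r) epowr (1 / p) \<le> vol (E x r) epowr ?a * Wq (E x r)"
      unfolding wpow_def using p pq by (intro power_mean_nn_set_integral) auto
    also have "vol (E x r) epowr ?a = ennreal (e powr ?a * r powr (CARD('n) * ?a))"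
      unfolding shape_measure[OF r] using e r a
      by (simp add: epowr_ennreal powr_mult powr_realpow[symmetric] powr_powr)
    finally have "wosc_root f (E x r)
        \<le> ennreal (c * ?u powr N * r powr (\<beta> + CARD('n) / q - CARD('n) / p))
          * (ennreal (e powr ?a * r powr (CARD('n) * ?a)) * Wq (E x r))"
      using *[OF r, of x] by (meson mult_left_mono order_trans zero_le)
    also have "\<dots> = ennreal (c' * ?u powr N * r powr \<beta>) * Wq (E x r)"
    proof -
      have "r powr (\<beta> + CARD('n) / q - CARD('n) / p) * r powr (CARD('n) * ?a) = r powr \<beta>"
        using r by (simp add: powr_add[symmetric] algebra_simps)
      then have "c * ?u powr N * r powr (\<beta> + CARD('n) / q - CARD('n) / p) * (e powr ?a * r powr (CARD('n) * ?a))
          = c' * ?u powr N * r powr \<beta>"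
        by (simp only: c'_def mult_ac)
      then show ?thesis using c by (intro ennreal_mult_merge) auto
    qed
    finally show ?thesis .
  qed
  then show ?thesis
    unfolding q_bound_def using c' c by blast
qed

text \<open>Conversely \<open>\<omega>\<close> satisfies a reverse Hoelder inequality between the exponents \<open>p\<close> and \<open>q\<close>: take
  the test function \<open>1\<^sub>E\<close>.\<close>

lemma q_bound_imp_p_bound:
  assumes qb: "q_bound f"
  shows "p_bound f"
proof -
  obtain c N where c: "0 < c" "0 < N" and *: "\<And>x r. 0 < r \<Longrightarrow> wosc_root f (E x r)
       \<le> ennreal (c * scale x r powr N * r powr \<beta>) * Wq (E x r)"
    using qb unfolding q_bound_def by blast
  let ?n = "real CARD('n)" and ?k = "1 / q + 1 - 1 / p"
  define c1 where "c1 = C * ?n powr \<theta> * (ball_const * ?n ^ CARD('n)) powr ?k / e"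
  have c1: "0 < c1" using C_pos e ball_const_pos card_ge_1 by (simp add: c1_def)
  have "wosc_root f (E x r)
       \<le> ennreal (c * c1 * scale x r powr (N + \<theta>) * r powr (\<beta> + ?n / q - ?n / p))
          * wpow \<omega> p (E x r) epowr (1 / p)"
    if r: "0 < r" for x r
  proof -
    let ?B = "ball x (?n * r)"
    have nr: "0 < ?n * r" using r card_ge_1 by simp
    define u where "u = 1 + r / \<rho> x"
    have u: "1 \<le> u" unfolding u_def by (rule scale_ge_1[OF r])
    let ?P = "wpow \<omega> p (E x r) epowr (1 / p)"
    have "(indicator (E x r) :: _ \<Rightarrow> ennreal) \<in> borel_measurable lebesgue" by measurable
    note test = test_function[OF nr this, of x]
    have "0 < p" using p by simp
    have "ennreal (e * r ^ CARD('n)) * Wq ?B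
        \<le> ennreal (C * (1 + ?n * r / \<rho> x) powr \<theta>) * ennreal (measure lebesgue ?B powr ?k) * ?P"
      using test
      unfolding indicator_test_integrals[OF shape_sets shape_upper[OF r] \<open>0 < p\<close>] shape_measure[OF r] .
    also have "\<dots> \<le> ennreal (C * (?n powr \<theta> * u powr \<theta>)) * ennreal (measure lebesgue ?B powr ?k) * ?P"
      unfolding u_def using C_pos
      by (intro mult_right_mono ennreal_leI mult_left_mono scale_dilate_powr card_ge_1 r \<theta>) auto
    finally have "ennreal (e * r ^ CARD('n)) * Wq (E x r)
        \<le> ennreal (C * (?n powr \<theta> * u powr \<theta>)) * ennreal (measure lebesgue ?B powr ?k) * ?P"
      using q by (meson W_mono shape_upper[OF r] epowr_mono mult_left_mono order_trans zero_le)
    then have "ennreal (1 / (e * r ^ CARD('n))) * (ennreal (e * r ^ CARD('n)) * Wq (E x r))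
        \<le> ennreal (1 / (e * r ^ CARD('n)))
          * (ennreal (C * (?n powr \<theta> * u powr \<theta>)) * ennreal (measure lebesgue ?B powr ?k) * ?P)"
      by (rule mult_left_mono) simp
    also have "ennreal (1 / (e * r ^ CARD('n))) * (ennreal (e * r ^ CARD('n)) * Wq (E x r))
        = Wq (E x r)"
      using e r by (simp add: mult.assoc[symmetric] ennreal_mult[symmetric])
    also have "ennreal (1 / (e * r ^ CARD('n)))
          * (ennreal (C * (?n powr \<theta> * u powr \<theta>)) * ennreal (measure lebesgue ?B powr ?k) * ?P)
        = ennreal (c1 * u powr \<theta> * r powr (?n / q - ?n / p)) * ?P"
    proof -
      have "measure lebesgue ?B = (ball_const * ?n ^ CARD('n)) * r powr ?n"
        using r by (simp add: measure_ball_eq[OF nr] power_mult_distrib powr_realpow)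
      then have 1: "measure lebesgue ?B powr ?k = (ball_const * ?n ^ CARD('n)) powr ?k * r powr (?n * ?k)"
        using ball_const_pos by (simp add: powr_mult powr_powr)
      have 2: "1 / (e * r ^ CARD('n)) = (1 / e) * r powr (- ?n)"
        using r by (simp add: powr_minus powr_realpow field_simps)
      have 3: "r powr (?n / q - ?n / p) = r powr (- ?n) * r powr (?n * ?k)"
        by (simp add: powr_add[symmetric] algebra_simps)
      have "1 / (e * r ^ CARD('n)) * (C * (?n powr \<theta> * u powr \<theta>) * measure lebesgue ?B powr ?k)
          = c1 * u powr \<theta> * r powr (?n / q - ?n / p)"
        unfolding c1_def 1 2 3 by (simp only: divide_inverse mult_ac mult_1_left)
      moreover have "0 \<le> 1 / (e * r ^ CARD('n))" using e r by simp
      moreover have "ennreal (C * (?n powr \<theta> * u powr \<theta>)) * ennreal (measure lebesgue ?B powr ?k)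
          = ennreal (C * (?n powr \<theta> * u powr \<theta>) * measure lebesgue ?B powr ?k)"
        using C_pos by (intro ennreal_mult[symmetric]) auto
      ultimately show ?thesis
        using C_pos by (simp only:) (intro ennreal_mult_merge; simp)
    qed
    finally have 1: "Wq (E x r) \<le> ennreal (c1 * u powr \<theta> * r powr (?n / q - ?n / p)) * ?P" .
    have "wosc_root f (E x r)
        \<le> ennreal (c * u powr N * r powr \<beta>) * (ennreal (c1 * u powr \<theta> * r powr (?n / q - ?n / p)) * ?P)"
      using *[OF r, of x] 1 unfolding u_def by (meson mult_left_mono order_trans zero_le)
    also have "\<dots> = ennreal (c * c1 * u powr (N + \<theta>) * r powr (\<beta> + ?n / q - ?n / p)) * ?P"
    proof -
      have 4: "r powr (\<beta> + ?n / q - ?n / p) = r powr \<beta> * r powr (?n / q - ?n / p)"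
        by (simp add: powr_add[symmetric] add_diff_eq)
      have "c * u powr N * r powr \<beta> * (c1 * u powr \<theta> * r powr (?n / q - ?n / p))
          = c * c1 * u powr (N + \<theta>) * r powr (\<beta> + ?n / q - ?n / p)"
        unfolding 4 powr_add by (simp only: mult_ac)
      then show ?thesis using c c1 by (intro ennreal_mult_merge) auto
    qed
    finally show ?thesis unfolding u_def .
  qed
  then show ?thesis
    unfolding p_bound_def using c c1 \<theta> by (intro exI[of _ "c * c1"] conjI exI[of _ "N + \<theta>"]) auto
qed

text \<open>The dyadic subcubes used below contain a point \<open>y\<close> within \<open>4 d\<^sup>2 r\<close> of \<open>x\<close>, and the
  sets \<open>E(y,t)\<close> and balls around \<open>y\<close> that cover them have \<open>t \<le> 8 d\<^sup>2 r\<close>.\<close>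

lemma scale_nearby:
  assumes r: "0 < r" and y: "dist x y < 4 * (real CARD('n))\<^sup>2 * r" and t: "t \<le> 8 * (real CARD('n))\<^sup>2 * r"
  shows "1 + t / \<rho> y \<le> 2 * K * (4 * (real CARD('n))\<^sup>2) powr M * scale x r powr M"
proof -
  let ?k = "4 * (real CARD('n))\<^sup>2"
  have k: "1 \<le> ?k" using card_ge_1 one_le_power[of "real CARD('n)" 2] by linarith
  have s: "0 < ?k * r" using k r by simp
  have "t / \<rho> y \<le> (2 * (?k * r)) / \<rho> y"
    using t \<rho>_pos[of y] by (intro divide_right_mono) auto
  then have "1 + t / \<rho> y \<le> 2 * (1 + ?k * r / \<rho> y)" using \<rho>_pos[of y] by simp
  also have "\<dots> \<le> 2 * (K * (1 + ?k * r / \<rho> x) powr M)"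
    using \<rho>_comparison[OF s y] by simp
  also have "\<dots> \<le> 2 * (K * (?k powr M * scale x r powr M))"
    using K M scale_dilate_powr[OF k r, of M x] by (intro mult_left_mono) auto
  finally show ?thesis by (simp only: mult.assoc)
qed

lemma oscillation_subset_le:
  assumes f: "locally_integrable f" and t: "0 < t"
    and S: "S \<in> lmeasurable" "S \<subseteq> E y t" "0 < measure lebesgue S"
  shows "deviation f (average S f) S
           \<le> 2 * deviation f (average (E y t) f) (E y t)"
proof -
  note [measurable] = locally_integrable_measurable[OF f]
  have Ss [measurable]: "S \<in> sets lebesgue" using S(1) by simp
  let ?c = "average (E y t) f"
  have "f absolutely_integrable_on S"
    using set_integrable_subset[OF shape_integrable[OF f t, of y]] Ss S(2) by simp
  then have av: "ennreal \<bar>average S f - ?c\<bar> * vol S \<le> deviation f ?c S"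
    by (intro average_diff_le S(1,3))
  have "deviation f (average S f) S
      \<le> (\<integral>\<^sup>+z. ennreal \<bar>f z - ?c\<bar> * indicator S z + ennreal \<bar>average S f - ?c\<bar> * indicator S z \<partial>lebesgue)"
    by (intro nn_integral_mono) (auto simp: indicator_def simp flip: ennreal_plus intro!: ennreal_leI)
  also have "\<dots> = deviation f ?c S + ennreal \<bar>average S f - ?c\<bar> * vol S"
    by (subst nn_integral_add) (auto simp: nn_integral_cmult_indicator)
  also have "\<dots> \<le> 2 * deviation f ?c S"
    using av by (simp add: mult_2 add_left_mono)
  also have "\<dots> \<le> 2 * deviation f ?c (E y t)"
    using S(2) by (intro mult_left_mono nn_integral_mono) (auto simp: indicator_def)
  finally show ?thesis .
qed

text \<open>\<open>W_fraction\<close> solved for the weight of the ball.  It is applied to large subsets of dyadic cells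
  and to \<open>E(x,r)\<close> inside a ball that contains the whole root cell.\<close>

lemma W_ball_le_of_fraction:
  assumes R: "0 < R" and F: "F \<in> sets lebesgue" "F \<subseteq> ball y R" and k: "0 \<le> k"
    and le: "ennreal (R ^ CARD('n)) \<le> ennreal k * vol F" and Y: "1 + R / \<rho> y \<le> Y"
  shows "Wq (ball y R) \<le> ennreal (C * Y powr \<theta> * ball_const * k) * Wq F"
proof -
  let ?B = "Wq (ball y R)" and ?F = "Wq F" and ?d = "ennreal (R ^ CARD('n))"
  have "?d * ?B \<le> ennreal k * vol F * ?B"
    by (rule mult_right_mono[OF le]) simp
  also have "\<dots> = ennreal k * (vol F * ?B)" by (simp only: mult.assoc)
  also have "\<dots> \<le> ennreal k * (ennreal (C * (1 + R / \<rho> y) powr \<theta> * measure lebesgue (ball y R)) * ?F)"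
    by (intro mult_left_mono W_fraction R F) auto
  also have "\<dots> \<le> ennreal k * (ennreal (C * Y powr \<theta> * (ball_const * R ^ CARD('n))) * ?F)"
    unfolding measure_ball_eq[OF R] using C_pos ball_const_pos R \<rho>_pos[of y] \<theta> Y
    by (intro mult_left_mono mult_right_mono ennreal_leI powr_mono2) auto
  also have "\<dots> = ?d * (ennreal (C * Y powr \<theta> * ball_const * k) * ?F)"
  proof -
    have "?d * (ennreal (C * Y powr \<theta> * ball_const * k) * ?F)
        = ennreal (k * (C * Y powr \<theta> * (ball_const * R ^ CARD('n)))) * ?F"
      using R C_pos k ball_const_pos by (intro ennreal_mult_merge) auto
    moreover have "ennreal k * (ennreal (C * Y powr \<theta> * (ball_const * R ^ CARD('n))) * ?F)
        = ennreal (k * (C * Y powr \<theta> * (ball_const * R ^ CARD('n)))) * ?F"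
      using R C_pos k ball_const_pos by (intro ennreal_mult_merge) auto
    ultimately show ?thesis by simp
  qed
  finally show ?thesis
    using R by (subst (asm) ennreal_mult_le_mult_iff) auto
qed

text \<open>From the unweighted to the weighted oscillation.  On a dyadic cube of side length comparable to
  \<open>r\<close> around \<open>E(x,r)\<close> the scale function \<open>1 + t/\<rho>(y)\<close> of all relevant subcubes is at most
  \<open>Y = K\<^sub>1 (1 + r/\<rho>(x))\<^sup>M\<close>.  So on this cube \<open>f\<close> has dyadic mean oscillation at most a power of \<open>Y\<close>
  times \<open>r\<^sup>\<beta>\<close>, \<open>\<omega>\<^sup>q\<close> satisfies the halving condition with a power of \<open>Y\<close>, and the weighted
  John--Nirenberg inequality multiplies such powers only.\<close>

lemma osc_bound_imp_q_bound:
  assumes f: "locally_integrable f" and ob: "osc_bound f"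
  shows "q_bound f"
proof -
  note [measurable] = locally_integrable_measurable[OF f]
  obtain c N where c: "0 < c" "0 < N" and osc: "\<And>x r. 0 < r \<Longrightarrow>
     deviation f (average (E x r) f) (E x r)
       \<le> ennreal (c * scale x r powr N * (r ^ CARD('n) * r powr \<beta>))"
    using ob unfolding osc_bound_def by blast
  define n where "n = real CARD('n)"
  have n: "1 \<le> n" unfolding n_def by (rule card_ge_1)
  define d where "d = CARD('n)"
  define ub where "ub = ball_const"
  have ub: "0 < ub" using ball_const_pos by (simp add: ub_def)
  define K1 where "K1 = 2 * K * (4 * n\<^sup>2) powr M"
  define A0 where "A0 = 2 * c * (4 * n) ^ d * (8 * n\<^sup>2) powr \<beta>"
  define C3 where "C3 = max 1 (C * ub * (2 * (2 * n) ^ d))"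
  define C5 where "C5 = C * (4 * n\<^sup>2) powr \<theta> * ub * ((4 * n\<^sup>2) ^ d / e)"
  define mc where "mc = moment_const q powr (1 / q)"
  define c' where "c' = 2 * 2 powr (1 / q) * (A0 * K1 powr N)
    * (mc * (C3 * K1 powr \<theta>) powr (q + 2) * 2 ^ (d + 1) * C5 + (2 * n) ^ d / e)"
  define N' where "N' = M * N + M * \<theta> * (q + 2) + \<theta>"
  have n2: "1 \<le> 4 * n\<^sup>2" "1 \<le> n\<^sup>2" "n \<le> n\<^sup>2"
  proof -
    show "n \<le> n\<^sup>2" using n by (simp add: power2_eq_square)
    then show "1 \<le> n\<^sup>2" "1 \<le> 4 * n\<^sup>2" using n by auto
  qed
  have K1: "1 \<le> K1"
  proof -
    have "1 \<le> (4 * n\<^sup>2) powr M" using n2 M by (intro ge_one_powr_ge_zero) auto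
    then have "1 * 1 \<le> (2 * K) * (4 * n\<^sup>2) powr M" using K by (intro mult_mono) auto
    then show ?thesis by (simp add: K1_def)
  qed
  have coeffs: "0 < A0" "1 \<le> C3" "0 < C5" "0 < mc"
    using c n n2 C_pos ub e moment_const_pos[OF q(2)] by (auto simp: A0_def C3_def C5_def mc_def)
  have main: "wosc_root f (E x r)
       \<le> ennreal (c' * scale x r powr N' * r powr \<beta>) * Wq (E x r)"
    if r: "0 < r" for x r
  proof -
    define u where "u = 1 + r / \<rho> x"
    have u: "1 \<le> u" unfolding u_def by (rule scale_ge_1[OF r])
    \<comment> \<open>\<open>Y\<close> bounds the scales of all subcubes.  The root of the grid is the cube with centre \<open>x\<close> and
      side \<open>L = 2 d r\<close>, which contains the ball of radius \<open>d r\<close> and hence \<open>E(x,r)\<close>.\<close>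
    define Y where "Y = K1 * u powr M"
    have Y: "1 \<le> Y"
      using mult_mono[of 1 K1 1 "u powr M"] K1 u M by (simp add: Y_def ge_one_powr_ge_zero)
    define L where "L = 2 * n * r"
    define a where "a = (\<chi> i. x $ i - n * r)"
    have L: "0 < L" using n r by (simp add: L_def)
    interpret dyadic_grid a L by standard (rule L)
    have root_iff: "y \<in> root \<longleftrightarrow> (\<forall>i. x $ i - n * r \<le> y $ i \<and> y $ i < x $ i + n * r)" for y
    proof -
      have "corner 0 a = a" by (simp add: corner_def vec_eq_iff)
      then show ?thesis unfolding cell_iff by (simp add: a_def L_def algebra_simps)
    qed
    have x_root: "x \<in> root" using n r by (simp add: root_iff)
    have ball_root: "ball x (n * r) \<subseteq> root"
    proof
      fix y assume "y \<in> ball x (n * r)"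
      then have y: "norm (y - x) < n * r" by (simp add: dist_norm norm_minus_commute)
      have "\<bar>y $ i - x $ i\<bar> < n * r" for i
        using component_le_norm_cart[of "y - x" i] y by simp
      then show "y \<in> root" unfolding root_iff by (auto simp: abs_less_iff) (smt (verit))+
    qed
    have E_root: "E x r \<subseteq> root" using shape_upper[OF r, of x] ball_root by (auto simp: n_def)
    have near: "dist x y < 4 * n\<^sup>2 * r" if "y \<in> root" for y
    proof -
      have "dist x y \<le> n * L" using cell_dist[OF x_root that] by (simp add: n_def)
      also have "\<dots> < 4 * n\<^sup>2 * r" using n r by (simp add: L_def power2_eq_square)
      finally show ?thesis .
    qed
    have scale: "1 + t / \<rho> y \<le> Y" if "y \<in> root" "t \<le> 8 * n\<^sup>2 * r" for y t
      using scale_nearby[OF r near[OF that(1), unfolded n_def] that(2)[unfolded n_def]]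
      by (simp add: Y_def K1_def u_def n_def)
    define A where "A = A0 * Y powr N * r powr \<beta>"
    have A: "0 < A" using coeffs Y r by (simp add: A_def)
    have side: "0 < L / 2 ^ m" "L / 2 ^ m \<le> L" for m
      using L by (auto simp: field_simps)
    have cell_ball: "cell m y \<subseteq> ball y (2 * n * (L / 2 ^ m))" for m y
    proof
      fix z assume "z \<in> cell m y"
      then have "dist y z \<le> n * (L / 2 ^ m)" using cell_dist[of y m y z] by (simp add: n_def)
      also have "\<dots> < 2 * n * (L / 2 ^ m)"
      proof -
        have "0 < n * (L / 2 ^ m)" using n by (intro mult_pos_pos side) auto
        moreover have "w < 2 * w" if "0 < w" for w :: real using that by simp
        ultimately show ?thesis unfolding mult.assoc by blast
      qed
      finally show "z \<in> ball y (2 * n * (L / 2 ^ m))" by simp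
    qed
    have oscA: "deviation f (average (cell m y) f) (cell m y)
        \<le> ennreal A * vol (cell m y)" if y: "y \<in> root" for m y
    proof -
      define t where "t = L / 2 ^ m"
      have t: "0 < t" "t \<le> L" unfolding t_def by (rule side)+
      define T where "T = 4 * n * t"
      have T: "0 < T" "T \<le> 8 * n\<^sup>2 * r"
      proof -
        show "0 < T" using n t by (simp add: T_def)
        have "T \<le> 4 * n * L" unfolding T_def using n t by (intro mult_left_mono) auto
        then show "T \<le> 8 * n\<^sup>2 * r" by (simp add: L_def power2_eq_square)
      qed
      have T2: "T / 2 = 2 * n * t" by (simp add: T_def)
      have "cell m y \<subseteq> E y T"
        by (rule order_trans[OF cell_ball[of m y, folded t_def] shape_lower[OF T(1), unfolded T2]])
      then have "deviation f (average (cell m y) f) (cell m y)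
          \<le> 2 * deviation f (average (E y T) f) (E y T)"
        using side[of m] by (intro oscillation_subset_le f T(1) cell_lmeasurable) (auto simp: measure_cell)
      also have "\<dots> \<le> 2 * ennreal (c * (1 + T / \<rho> y) powr N * (T ^ CARD('n) * T powr \<beta>))"
        by (intro mult_left_mono osc T(1)) simp
      also have "\<dots> = ennreal (2 * (c * (1 + T / \<rho> y) powr N * (T ^ CARD('n) * T powr \<beta>)))"
        using c T(1) by (subst ennreal_mult) auto
      also have "\<dots> \<le> ennreal (2 * (c * Y powr N * (T ^ CARD('n) * (8 * n\<^sup>2 * r) powr \<beta>)))"
      proof -
        have "(1 + T / \<rho> y) powr N \<le> Y powr N"
          using c T(1) scale[OF y T(2)] \<rho>_pos[of y] by (intro powr_mono2) auto
        moreover have "T powr \<beta> \<le> (8 * n\<^sup>2 * r) powr \<beta>"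
          using T \<beta> by (intro powr_mono2) auto
        ultimately show ?thesis
          using c T(1) by (intro ennreal_leI mult_left_mono mult_mono) auto
      qed
      also have "2 * (c * Y powr N * (T ^ CARD('n) * (8 * n\<^sup>2 * r) powr \<beta>)) = A * t ^ CARD('n)"
        using n r unfolding T_def power_mult_distrib[of "4 * n" t]
        by (simp add: A_def A0_def d_def powr_mult)
      finally show ?thesis
        using A t(1) unfolding emeasure_cell t_def[symmetric] by (simp add: ennreal_mult)
    qed
    define \<Lambda> where "\<Lambda> = (C3 * Y powr \<theta>) powr q"
    have CY: "1 \<le> C3 * Y powr \<theta>"
      using mult_mono[of 1 C3 1 "Y powr \<theta>"] coeffs Y \<theta> by (simp add: ge_one_powr_ge_zero)
    have La: "1 \<le> \<Lambda>" unfolding \<Lambda>_def using CY q by (intro ge_one_powr_ge_zero) auto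
    have half: "W (cell m y) \<le> ennreal \<Lambda> * W F"
      if y: "y \<in> root" and F: "F \<in> sets lebesgue" "F \<subseteq> cell m y"
        "vol (cell m y) \<le> 2 * vol F" for m y F
    proof -
      define t where "t = L / 2 ^ m"
      have t: "0 < t" "t \<le> L" unfolding t_def by (rule side)+
      define R where "R = 2 * n * t"
      have R: "0 < R" using n t by (simp add: R_def)
      have cR: "cell m y \<subseteq> ball y R" unfolding R_def t_def by (rule cell_ball)
      have R8: "R \<le> 8 * n\<^sup>2 * r"
      proof -
        have "R \<le> 2 * n * L" unfolding R_def using n t by (intro mult_left_mono) auto
        also have "2 * n * L \<le> 8 * n\<^sup>2 * r"
        proof -
          have "0 \<le> n * n * r" using n r by simp
          then show ?thesis by (simp add: L_def power2_eq_square mult.assoc)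
        qed
        finally show ?thesis .
      qed
      have "ennreal (R ^ CARD('n)) = ennreal ((2 * n) ^ d) * vol (cell m y)"
        using n t(1) unfolding R_def power_mult_distrib[of "2 * n" t] emeasure_cell t_def[symmetric]
        by (simp add: d_def ennreal_mult)
      also have "\<dots> \<le> ennreal ((2 * n) ^ d) * (2 * vol F)"
        by (intro mult_left_mono F) simp
      also have "\<dots> = ennreal (2 * (2 * n) ^ d) * vol F"
        using n by (simp add: ennreal_mult mult_ac)
      finally have fr: "ennreal (R ^ CARD('n)) \<le> ennreal (2 * (2 * n) ^ d) * vol F" .
      have "Wq (ball y R)
          \<le> ennreal (C * Y powr \<theta> * ball_const * (2 * (2 * n) ^ d)) * Wq F"
        using n cR F by (intro W_ball_le_of_fraction[OF R F(1) _ _ fr scale[OF y R8]]) auto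
      also have "\<dots> \<le> ennreal (C3 * Y powr \<theta>) * Wq F"
      proof -
        have "C * ub * (2 * (2 * n) ^ d) * Y powr \<theta> \<le> C3 * Y powr \<theta>"
          by (intro mult_right_mono) (auto simp: C3_def)
        then show ?thesis by (intro mult_right_mono ennreal_leI) (auto simp: ub_def mult_ac)
      qed
      finally have "Wq (cell m y) \<le> ennreal (C3 * Y powr \<theta>) * Wq F"
        using q W_mono[OF cR] by (meson epowr_mono order_trans)
      then have "W (cell m y) \<le> (ennreal (C3 * Y powr \<theta>) * Wq F) epowr q"
        by (rule epowr_root_le_iff[OF q(2)])
      also have "\<dots> = ennreal \<Lambda> * W F"
        using q CY by (simp add: epowr_mult epowr_epowr epowr_ennreal \<Lambda>_def)
      finally show ?thesis .
    qed
    define Wm where "Wm = density lebesgue (\<lambda>y. ennreal (\<omega> y) epowr q)"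
    have Wm_eq: "emeasure Wm S = W S" if "S \<in> sets lebesgue" for S
      using that by (simp add: Wm_def wpow_def emeasure_density)
    let ?s = "4 * n\<^sup>2 * r"
    have s: "0 < ?s" using n2 r by (intro mult_pos_pos) auto
    have root_ball: "root \<subseteq> ball x ?s" using near by auto
    have W_root: "W root < top"
      using W_mono[OF root_ball] W_ball_finite[OF s, of x] by (rule le_less_trans)
    have "(\<integral>\<^sup>+z\<in>root. ennreal (\<bar>f z - average root f\<bar> powr q) \<partial>Wm)
        \<le> ennreal (moment_const q * \<Lambda> powr (q + 2) * (2 ^ (CARD('n) + 1) * A) powr q) * emeasure Wm root"
    proof (rule weighted_oscillation_le[OF f A q(2) La oscA])
      show "sets Wm = sets lebesgue" by (simp add: Wm_def)
      show "null_sets lebesgue \<subseteq> null_sets Wm"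
        unfolding Wm_def absolutely_continuous_def[symmetric]
        by (intro absolutely_continuousI_density) measurable
      show "emeasure Wm root < top" using W_root by (simp add: Wm_eq)
      show "emeasure Wm (cell m y) \<le> ennreal \<Lambda> * emeasure Wm F"
        if "y \<in> root" "F \<in> sets lebesgue" "F \<subseteq> cell m y" "vol (cell m y) \<le> 2 * vol F" for m y F
        using half[OF that] that by (simp add: Wm_eq)
    qed
    also have "(\<integral>\<^sup>+z\<in>root. ennreal (\<bar>f z - average root f\<bar> powr q) \<partial>Wm)
        = (\<integral>\<^sup>+z\<in>root. ennreal \<bar>f z - average root f\<bar> epowr q * ennreal (\<omega> z) epowr q \<partial>lebesgue)" (is "_ = ?I")
      unfolding Wm_def using q by (subst nn_integral_density) (auto simp: epowr_ennreal mult_ac)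
    finally have I: "?I \<le> ennreal (moment_const q * \<Lambda> powr (q + 2) * (2 ^ (d + 1) * A) powr q) * W root"
      by (simp add: Wm_eq d_def)
    have Wr: "Wq root \<le> ennreal (C5 * u powr \<theta>) * Wq (E x r)"
    proof -
      have "Wq root \<le> Wq (ball x ?s)"
        using q by (intro epowr_mono W_mono root_ball) auto
      also have "\<dots> \<le> ennreal (C * (4 * n\<^sup>2 * u) powr \<theta> * ball_const * ((4 * n\<^sup>2) ^ d / e)) * Wq (E x r)"
      proof (intro W_ball_le_of_fraction s shape_sets)
        show "E x r \<subseteq> ball x ?s" using E_root root_ball by blast
        show "0 \<le> (4 * n\<^sup>2) ^ d / e" using e by simp
        show "ennreal (?s ^ CARD('n)) \<le> ennreal ((4 * n\<^sup>2) ^ d / e) * vol (E x r)"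
          using e r by (simp add: shape_measure[OF r] ennreal_mult[symmetric] d_def power_mult_distrib)
        show "1 + ?s / \<rho> x \<le> 4 * n\<^sup>2 * u"
          unfolding u_def by (rule scale_dilate[OF n2(1) r])
      qed
      also have "C * (4 * n\<^sup>2 * u) powr \<theta> * ball_const * ((4 * n\<^sup>2) ^ d / e) = C5 * u powr \<theta>"
        using u by (simp add: C5_def powr_mult ub_def)
      finally show ?thesis .
    qed
    let ?J = "mc * (C3 * Y powr \<theta>) powr (q + 2) * (2 ^ (d + 1) * A) * (C5 * u powr \<theta>)"
    have I_root: "?I epowr (1 / q)
        \<le> ennreal (?J) * Wq (E x r)"
    proof -
      have "?I epowr (1 / q) \<le> (ennreal (moment_const q * \<Lambda> powr (q + 2) * (2 ^ (d + 1) * A) powr q) * W root) epowr (1 / q)"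
        using I q by (intro epowr_mono) auto
      also have "\<dots> = ennreal ((moment_const q * \<Lambda> powr (q + 2) * (2 ^ (d + 1) * A) powr q) powr (1 / q)) * Wq root"
        using q moment_const_pos[OF q(2)] by (simp add: epowr_mult epowr_ennreal)
      also have "(moment_const q * \<Lambda> powr (q + 2) * (2 ^ (d + 1) * A) powr q) powr (1 / q)
          = mc * (C3 * Y powr \<theta>) powr (q + 2) * (2 ^ (d + 1) * A)"
      proof -
        have "\<Lambda> powr (q + 2) = ((C3 * Y powr \<theta>) powr (q + 2)) powr q"
          unfolding \<Lambda>_def powr_powr by (simp only: mult.commute)
        then show ?thesis
          using q(2) moment_const_pos[OF q(2)] A by (simp add: powr_mult powr_powr mc_def del: power_Suc)
      qed
      also have "ennreal (mc * (C3 * Y powr \<theta>) powr (q + 2) * (2 ^ (d + 1) * A)) * Wq root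
          \<le> ennreal (mc * (C3 * Y powr \<theta>) powr (q + 2) * (2 ^ (d + 1) * A))
             * (ennreal (C5 * u powr \<theta>) * Wq (E x r))"
        by (intro mult_left_mono Wr) simp
      also have "\<dots> = ennreal (?J) * Wq (E x r)"
        using coeffs A by (intro ennreal_mult_merge) auto
      finally show ?thesis .
    qed
    \<comment> \<open>It remains to replace the average over the root by the average over \<open>E(x,r)\<close>.\<close>
    define D where "D = \<bar>average (E x r) f - average root f\<bar>"
    have D: "D \<le> A * ((2 * n) ^ d / e)"
    proof -
      have "ennreal D * vol (E x r) \<le> deviation f (average root f) (E x r)"
        unfolding D_def by (intro average_diff_le shape_fmeasurable shape_measure_pos shape_integrable f r)
      also have "\<dots> \<le> deviation f (average root f) root"
        using E_root by (intro nn_integral_mono) (auto simp: indicator_def)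
      also have "\<dots> \<le> ennreal A * vol root" by (intro oscA) simp
      finally have "ennreal (D * (e * r ^ d)) \<le> ennreal (A * L ^ d)"
        using e r A L by (simp add: shape_measure[OF r] emeasure_cell d_def ennreal_mult D_def)
      then have "D * (e * r ^ d) \<le> A * L ^ d"
        using A L by (subst (asm) ennreal_le_iff) auto
      also have "L ^ d = (2 * n) ^ d * r ^ d" by (simp only: L_def power_mult_distrib)
      finally have "D * e \<le> A * (2 * n) ^ d" using r by (simp add: mult.assoc[symmetric])
      then show ?thesis using e by (simp add: field_simps)
    qed
    have D0: "0 \<le> D" by (simp add: D_def)
    have "wosc \<omega> f q (E x r) \<le> ennreal (2 powr q) * (?I + ennreal D epowr q * W (E x r))"
    proof -
      let ?g = "\<lambda>z. ennreal \<bar>f z - average root f\<bar> epowr q"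
      have "wosc \<omega> f q (E x r)
          \<le> (\<integral>\<^sup>+z. ennreal (2 powr q) * (?g z * ennreal (\<omega> z) epowr q * indicator root z
               + ennreal D epowr q * (ennreal (\<omega> z) epowr q * indicator (E x r) z)) \<partial>lebesgue)"
        unfolding wosc_def
      proof (intro nn_integral_mono)
        fix z
        let ?w = "ennreal (\<omega> z) epowr q"
        show "ennreal \<bar>f z - average (E x r) f\<bar> epowr q * ?w * indicator (E x r) z
          \<le> ennreal (2 powr q) * (?g z * ?w * indicator root z
               + ennreal D epowr q * (?w * indicator (E x r) z))"
        proof (cases "z \<in> E x r")
          case True
          then have "z \<in> root" using E_root by blast
          have "ennreal \<bar>f z - average (E x r) f\<bar> \<le> ennreal \<bar>f z - average root f\<bar> + ennreal D"
            by (simp add: D_def flip: ennreal_plus)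
          then have "ennreal \<bar>f z - average (E x r) f\<bar> epowr q \<le> (ennreal \<bar>f z - average root f\<bar> + ennreal D) epowr q"
            using q by (intro epowr_mono) auto
          also have "\<dots> \<le> ennreal (2 powr q) * (?g z + ennreal D epowr q)"
            by (rule add_epowr_le[OF q(2)])
          finally have "ennreal \<bar>f z - average (E x r) f\<bar> epowr q * ?w
             \<le> ennreal (2 powr q) * (?g z + ennreal D epowr q) * ?w"
            by (rule mult_right_mono) simp
          then show ?thesis
            using True \<open>z \<in> root\<close> by (simp add: distrib_right mult.assoc)
        qed simp
      qed
      also have "\<dots> = ennreal (2 powr q) * (?I + ennreal D epowr q * W (E x r))"
        by (simp add: nn_integral_cmult nn_integral_add wpow_def)
      finally show ?thesis .
    qed
    then have "wosc_root f (E x r) \<le> (ennreal (2 powr q) * (?I + ennreal D epowr q * W (E x r))) epowr (1 / q)"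
      using q by (intro epowr_mono) auto
    also have "\<dots> = 2 * (?I + ennreal D epowr q * W (E x r)) epowr (1 / q)"
      using q by (simp add: epowr_mult epowr_ennreal powr_powr)
    also have "\<dots> \<le> 2 * (ennreal (2 powr (1 / q)) * (?I epowr (1 / q) + (ennreal D epowr q * W (E x r)) epowr (1 / q)))"
      by (intro mult_left_mono add_epowr_le q) simp
    also have "(ennreal D epowr q * W (E x r)) epowr (1 / q) = ennreal D * Wq (E x r)"
      using q by (simp add: epowr_mult epowr_epowr)
    also have "2 * (ennreal (2 powr (1 / q)) * (?I epowr (1 / q) + ennreal D * Wq (E x r)))
        \<le> 2 * (ennreal (2 powr (1 / q)) *
           (ennreal (?J) * Wq (E x r)
            + ennreal (A * ((2 * n) ^ d / e)) * Wq (E x r)))"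
      by (intro mult_left_mono add_mono I_root mult_right_mono ennreal_leI D) auto
    also have "\<dots> = ennreal (2 * (2 powr (1 / q) *
           (?J + A * ((2 * n) ^ d / e))))
          * Wq (E x r)"
    proof -
      have "2 * (ennreal b * (ennreal s * w + ennreal t * w)) = ennreal (2 * (b * (s + t))) * w"
        if "0 \<le> b" "0 \<le> s" "0 \<le> t" for b s t and w :: ennreal
      proof -
        have "ennreal (2 * (b * (s + t))) = 2 * (ennreal b * (ennreal s + ennreal t))"
          using that by (simp add: ennreal_mult)
        then show ?thesis by (simp add: distrib_right mult.assoc)
      qed
      moreover have "0 \<le> ?J"
        using coeffs A by simp
      moreover have "0 \<le> A * ((2 * n) ^ d / e)" using A e n by simp
      ultimately show ?thesis by simp
    qed
    also have "\<dots> \<le> ennreal (c' * u powr N' * r powr \<beta>) * Wq (E x r)"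
    proof (intro mult_right_mono ennreal_leI)
      have YN: "Y powr N = K1 powr N * u powr (M * N)"
        using K1 u by (simp add: Y_def powr_mult powr_powr)
      have CYq: "(C3 * Y powr \<theta>) powr (q + 2) = (C3 * K1 powr \<theta>) powr (q + 2) * u powr (M * \<theta> * (q + 2))"
        using K1 u coeffs by (simp add: Y_def powr_mult powr_powr mult.assoc)
      let ?a = "mc * (C3 * K1 powr \<theta>) powr (q + 2) * 2 ^ (d + 1) * C5" and ?b = "(2 * n) ^ d / e"
      let ?v = "u powr (M * \<theta> * (q + 2) + \<theta>)"
      have v: "1 \<le> ?v"
        using u M \<theta> q by (intro ge_one_powr_ge_zero) auto
      have "2 * (2 powr (1 / q) *
           (?J + A * ?b))
          = 2 * 2 powr (1 / q) * A * (?a * ?v + ?b)"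
        unfolding CYq powr_add[of u "M * \<theta> * (q + 2)" \<theta>] by (simp only: distrib_left mult_ac)
      also have "\<dots> \<le> 2 * 2 powr (1 / q) * A * (?a * ?v + ?b * ?v)"
      proof -
        have "?b * 1 \<le> ?b * ?v" using v e n by (intro mult_left_mono) auto
        then show ?thesis using A by (intro mult_left_mono) auto
      qed
      also have "\<dots> = c' * u powr N' * r powr \<beta>"
        unfolding A_def YN c'_def N'_def add.assoc powr_add[of u "M * N"]
        by (simp only: distrib_right[symmetric]) (simp only: mult_ac)
      finally show "2 * (2 powr (1 / q) *
           (?J + A * ?b))
          \<le> c' * u powr N' * r powr \<beta>" .
    qed simp
    finally show ?thesis unfolding u_def .
  qed
  have "0 < c'"
    unfolding c'_def using coeffs K1 n e
    by (intro mult_pos_pos add_pos_pos divide_pos_pos) auto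
  moreover have "0 < N'" using M c \<theta> q by (auto simp: N'_def intro!: add_pos_nonneg)
  ultimately show ?thesis unfolding q_bound_def using main by blast
qed

lemma osc_bound_iff_q_bound: "locally_integrable f \<Longrightarrow> osc_bound f \<longleftrightarrow> q_bound f"
  using osc_bound_imp_q_bound q_bound_imp_osc_bound by blast

lemma q_bound_iff_p_bound: "q_bound f \<longleftrightarrow> p_bound f"
  using q_bound_imp_p_bound p_bound_imp_q_bound by blast

end

section \<open>Normalized forms of the conditions\<close>

text \<open>All conditions are bounds by \<open>C (1 + r/\<rho>(x))\<^sup>N\<close> with unspecified \<open>C\<close>, so a change of normalization
  by a positive constant \<open>k\<close> does not affect them.\<close>

lemma ex_bound_rescale:
  fixes \<rho> :: "'a \<Rightarrow> real"
  assumes k: "0 < k" and \<rho>: "\<And>x. 0 < \<rho> x"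
    and PQ: "\<And>x r t. 0 < r \<Longrightarrow> 0 < t \<Longrightarrow> P x r t \<longleftrightarrow> Q x r (k * t)"
  shows "(\<exists>C>0. \<exists>N>0. \<forall>x r. 0 < r \<longrightarrow> P x r (C * (1 + r / \<rho> x) powr N))
     \<longleftrightarrow> (\<exists>c>0. \<exists>N>0. \<forall>x r. 0 < r \<longrightarrow> Q x r (c * (1 + r / \<rho> x) powr N))"
proof -
  have pos: "0 < c * (1 + r / \<rho> x) powr N" if "0 < c" "0 < r" for c r N x
    using that \<rho>[of x] by (simp add: add_pos_pos less_imp_neq[symmetric])
  show ?thesis
  proof
    assume "\<exists>C>0. \<exists>N>0. \<forall>x r. 0 < r \<longrightarrow> P x r (C * (1 + r / \<rho> x) powr N)"
    then obtain C N where C: "0 < C" "0 < N" "\<forall>x r. 0 < r \<longrightarrow> P x r (C * (1 + r / \<rho> x) powr N)" by blast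
    have "Q x r (k * C * (1 + r / \<rho> x) powr N)" if "0 < r" for x r
    proof -
      have "P x r (C * (1 + r / \<rho> x) powr N)" using C(3) that by blast
      then show ?thesis using PQ[OF that pos[OF C(1) that]] unfolding mult.assoc by blast
    qed
    then show "\<exists>c>0. \<exists>N>0. \<forall>x r. 0 < r \<longrightarrow> Q x r (c * (1 + r / \<rho> x) powr N)"
      using C k by (intro exI[of _ "k * C"] conjI exI[of _ N]) auto
  next
    assume "\<exists>c>0. \<exists>N>0. \<forall>x r. 0 < r \<longrightarrow> Q x r (c * (1 + r / \<rho> x) powr N)"
    then obtain c N where c: "0 < c" "0 < N" "\<forall>x r. 0 < r \<longrightarrow> Q x r (c * (1 + r / \<rho> x) powr N)" by blast
    have ck: "0 < c / k" using c k by simp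
    have "P x r (c / k * (1 + r / \<rho> x) powr N)" if "0 < r" for x r
    proof -
      have "k * (c / k * (1 + r / \<rho> x) powr N) = c * (1 + r / \<rho> x) powr N" using k by simp
      moreover have "Q x r (c * (1 + r / \<rho> x) powr N)" using c(3) that by blast
      ultimately show ?thesis using PQ[OF that pos[OF ck that]] by metis
    qed
    then show "\<exists>C>0. \<exists>N>0. \<forall>x r. 0 < r \<longrightarrow> P x r (C * (1 + r / \<rho> x) powr N)"
      using c ck by (intro exI[of _ "c / k"] conjI exI[of _ N]) auto
  qed
qed

lemma ennreal_mult_le_iff_divide:
  assumes "0 < k" "0 \<le> t"
  shows "s * ennreal k \<le> ennreal t \<longleftrightarrow> s \<le> ennreal (t / k)"
proof -
  have "s * ennreal k \<le> ennreal t \<longleftrightarrow> ennreal k * s \<le> ennreal k * ennreal (t / k)"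
    using assms by (simp add: ennreal_mult[symmetric] mult.commute)
  also have "\<dots> \<longleftrightarrow> s \<le> ennreal (t / k)"
    using assms by (intro ennreal_mult_le_mult_iff) auto
  finally show ?thesis .
qed

lemma SUP_weighted_finite_iff:
  fixes \<rho> :: "'a \<Rightarrow> real" and H :: "'a \<Rightarrow> real \<Rightarrow> ennreal"
  assumes \<rho>: "\<And>x. 0 < \<rho> x"
  shows "(SUP (x, r) \<in> UNIV \<times> {0<..}. ennreal ((1 + r / \<rho> x) powr (- \<theta>)) * H x r) < top
     \<longleftrightarrow> (\<exists>c>0. \<forall>x r. 0 < r \<longrightarrow> H x r \<le> ennreal (c * (1 + r / \<rho> x) powr \<theta>))"
proof -
  have pos: "0 < (1 + r / \<rho> x) powr (- \<theta>)" if "0 < r" for r x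
    using that \<rho>[of x] by (simp add: add_pos_pos less_imp_neq[symmetric])
  have eq: "ennreal ((1 + r / \<rho> x) powr (- \<theta>)) * H x r \<le> ennreal c
      \<longleftrightarrow> H x r \<le> ennreal (c * (1 + r / \<rho> x) powr \<theta>)" if "0 < r" "0 \<le> c" for r x c
  proof -
    have "c / (1 + r / \<rho> x) powr (- \<theta>) = c * (1 + r / \<rho> x) powr \<theta>"
      by (simp add: powr_minus field_simps)
    then show ?thesis
      using ennreal_mult_le_iff_divide[OF pos[OF that(1), of x] that(2), of "H x r"] by (simp add: mult.commute)
  qed
  let ?S = "SUP (x, r) \<in> UNIV \<times> {0<..}. ennreal ((1 + r / \<rho> x) powr (- \<theta>)) * H x r"
  have S: "?S \<le> ennreal c \<longleftrightarrow> (\<forall>x r. 0 < r \<longrightarrow> H x r \<le> ennreal (c * (1 + r / \<rho> x) powr \<theta>))"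
    if "0 \<le> c" for c
    using eq that by (auto simp: SUP_le_iff)
  show ?thesis
  proof
    assume "?S < top"
    then obtain c where c: "0 \<le> c" "?S = ennreal c" by (cases ?S) auto
    then have "?S \<le> ennreal (c + 1)" by (simp add: ennreal_leI)
    then show "\<exists>c>0. \<forall>x r. 0 < r \<longrightarrow> H x r \<le> ennreal (c * (1 + r / \<rho> x) powr \<theta>)"
      using S[of "c + 1"] c by (intro exI[of _ "c + 1"]) auto
  next
    assume "\<exists>c>0. \<forall>x r. 0 < r \<longrightarrow> H x r \<le> ennreal (c * (1 + r / \<rho> x) powr \<theta>)"
    then obtain c where c: "0 < c" "\<forall>x r. 0 < r \<longrightarrow> H x r \<le> ennreal (c * (1 + r / \<rho> x) powr \<theta>)" by blast
    then have "?S \<le> ennreal c" using S[of c] by simp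
    then show "?S < top" by (rule order_le_less_trans) simp
  qed
qed

context weighted_shapes
begin

lemma shape_epowr:
  assumes r: "0 < r"
  shows "vol (E x r) epowr a = ennreal (e powr a * r powr (real CARD('n) * a))"
  unfolding shape_measure[OF r] using e r
  by (simp add: epowr_ennreal_pos powr_mult powr_realpow[symmetric] powr_powr)

lemma osc_bound_iff:
  "osc_bound f \<longleftrightarrow> (\<exists>\<theta>>0. (SUP (x, r) \<in> UNIV \<times> {0<..}. ennreal (scale x r powr (- \<theta>))
      * (deviation f (average (E x r) f) (E x r)
          / vol (E x r) epowr (1 + \<beta> / real CARD('n)))) < top)"
proof -
  let ?n = "real CARD('n)"
  define H where "H x r = deviation f (average (E x r) f) (E x r)" for x r
  define k where "k = e powr (1 + \<beta> / ?n)"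
  have k: "0 < k" using e by (simp add: k_def)
  have "(H x r / vol (E x r) epowr (1 + \<beta> / ?n) \<le> ennreal t)
      \<longleftrightarrow> H x r \<le> ennreal (k * t * (r ^ CARD('n) * r powr \<beta>))" if r: "0 < r" "0 < t" for x r t
  proof -
    let ?m = "k * (r ^ CARD('n) * r powr \<beta>)"
    have m: "0 < ?m" using k r by simp
    have "?n * (1 + \<beta> / ?n) = ?n + \<beta>" using card_ge_1 by (simp add: distrib_left)
    then have "r powr (?n * (1 + \<beta> / ?n)) = r ^ CARD('n) * r powr \<beta>"
      using r by (simp add: powr_add powr_realpow)
    then have "vol (E x r) epowr (1 + \<beta> / ?n) = ennreal ?m"
      unfolding shape_epowr[OF r(1)] k_def by (simp only:)
    then have "H x r / vol (E x r) epowr (1 + \<beta> / ?n) = H x r * ennreal (1 / ?m)"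
      using divide_ennreal_real[OF m] by (simp only:)
    also have "\<dots> \<le> ennreal t \<longleftrightarrow> H x r \<le> ennreal (t / (1 / ?m))"
      using m r by (intro ennreal_mult_le_iff_divide) auto
    also have "t / (1 / ?m) = k * t * (r ^ CARD('n) * r powr \<beta>)" by simp
    finally show ?thesis .
  qed
  from ex_bound_rescale[where \<rho> = \<rho> and P = "\<lambda>x r t. H x r / vol (E x r) epowr (1 + \<beta> / ?n) \<le> ennreal t"
      and Q = "\<lambda>x r t. H x r \<le> ennreal (t * (r ^ CARD('n) * r powr \<beta>))", OF k \<rho>_pos this]
  have rescaled: "(\<exists>c>0. \<exists>N>0. \<forall>x r. 0 < r \<longrightarrow>
        H x r \<le> ennreal (c * scale x r powr N * (r ^ CARD('n) * r powr \<beta>)))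
     \<longleftrightarrow> (\<exists>c>0. \<exists>N>0. \<forall>x r. 0 < r \<longrightarrow>
        H x r / vol (E x r) epowr (1 + \<beta> / ?n) \<le> ennreal (c * scale x r powr N))"
    by (rule sym)
  have swap: "(\<exists>c>0. \<exists>N>0. A N c) \<longleftrightarrow> (\<exists>N>0. \<exists>c>0. A N c)" for A :: "real \<Rightarrow> real \<Rightarrow> bool"
    by blast
  show ?thesis
    unfolding osc_bound_def H_def[symmetric] SUP_weighted_finite_iff[where \<rho> = \<rho>, OF \<rho>_pos]
    by (rule trans[OF rescaled swap])
qed

lemma q_bound_iff:
  "q_bound f \<longleftrightarrow> (\<exists>c>0. \<exists>N>0. \<forall>x r. 0 < r \<longrightarrow>
     1 / vol (E x r) epowr (\<beta> / real CARD('n))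
       * (1 / W (E x r) * wosc \<omega> f q (E x r)) epowr (1 / q) \<le> ennreal (c * scale x r powr N))"
proof -
  let ?n = "real CARD('n)"
  define k where "k = e powr (\<beta> / ?n)"
  have k: "0 < k" using e by (simp add: k_def)
  have "(1 / vol (E x r) epowr (\<beta> / ?n) * (1 / W (E x r) * wosc \<omega> f q (E x r)) epowr (1 / q) \<le> ennreal t)
      \<longleftrightarrow> wosc_root f (E x r) \<le> ennreal (k * t * r powr \<beta>) * Wq (E x r)"
    if r: "0 < r" "0 < t" for x r t
  proof -
    let ?o = "wosc_root f (E x r)"
    obtain w where w: "W (E x r) = ennreal w" "0 < w"
      using W_shape_pos[OF r(1), of x] W_shape_finite[OF r(1), of x] by (cases "W (E x r)") (auto simp: less_le)
    have wq: "Wq (E x r) = ennreal (w powr (1 / q))"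
      using w q by (simp add: epowr_ennreal)
    have "1 / W (E x r) * wosc \<omega> f q (E x r) = wosc \<omega> f q (E x r) * ennreal (1 / w)"
      unfolding w(1) divide_ennreal_real[OF w(2)] by (simp add: mult.commute)
    then have o: "(1 / W (E x r) * wosc \<omega> f q (E x r)) epowr (1 / q) = ?o * ennreal (1 / w powr (1 / q))"
      using q w by (simp add: epowr_mult epowr_ennreal powr_divide)
    have km: "0 < k * r powr \<beta>" using k r by simp
    have m: "vol (E x r) epowr (\<beta> / ?n) = ennreal (k * r powr \<beta>)"
      unfolding shape_epowr[OF r(1)] k_def using card_ge_1 by simp
    have "1 / vol (E x r) epowr (\<beta> / ?n) * (1 / W (E x r) * wosc \<omega> f q (E x r)) epowr (1 / q)
        = ?o * ennreal (1 / (k * r powr \<beta> * w powr (1 / q)))"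
    proof -
      have "1 * ennreal a * (t * ennreal b) = t * ennreal (a * b)" if "0 \<le> a" "0 \<le> b" for a b t
        using that by (simp add: ennreal_mult mult_ac)
      from this[of "1 / (k * r powr \<beta>)" "1 / w powr (1 / q)" ?o] show ?thesis
        unfolding o m divide_ennreal_real[OF km] using km by simp
    qed
    also have "\<dots> \<le> ennreal t \<longleftrightarrow> ?o \<le> ennreal (t / (1 / (k * r powr \<beta> * w powr (1 / q))))"
      using km w r by (intro ennreal_mult_le_iff_divide) auto
    also have "ennreal (t / (1 / (k * r powr \<beta> * w powr (1 / q)))) = ennreal (k * t * r powr \<beta>) * Wq (E x r)"
      unfolding wq using k r by (simp add: ennreal_mult[symmetric] mult_ac)
    finally show ?thesis .
  qed
  from ex_bound_rescale[where \<rho> = \<rho> and P = "\<lambda>x r t. 1 / vol (E x r) epowr (\<beta> / ?n)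
        * (1 / W (E x r) * wosc \<omega> f q (E x r)) epowr (1 / q) \<le> ennreal t"
      and Q = "\<lambda>x r t. wosc_root f (E x r) \<le> ennreal (t * r powr \<beta>) * Wq (E x r)",
      OF k \<rho>_pos this]
  show ?thesis unfolding q_bound_def by simp
qed

lemma p_bound_iff:
  "p_bound f \<longleftrightarrow> (\<exists>c>0. \<exists>N>0. \<forall>x r. 0 < r \<longrightarrow>
     vol (E x r) epowr (1 / p - 1 / q - \<beta> / real CARD('n)) / wpow \<omega> p (E x r) epowr (1 / p)
       * wosc_root f (E x r) \<le> ennreal (c * scale x r powr N))"
proof -
  let ?n = "real CARD('n)" and ?a = "1 / p - 1 / q - \<beta> / real CARD('n)"
  define k where "k = e powr (- ?a)"
  have k: "0 < k" using e by (simp add: k_def)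
  have "(vol (E x r) epowr ?a / wpow \<omega> p (E x r) epowr (1 / p) * wosc_root f (E x r) \<le> ennreal t)
      \<longleftrightarrow> wosc_root f (E x r)
        \<le> ennreal (k * t * r powr (\<beta> + ?n / q - ?n / p)) * wpow \<omega> p (E x r) epowr (1 / p)"
    if r: "0 < r" "0 < t" for x r t
  proof -
    let ?o = "wosc_root f (E x r)"
    have "vol (E x r) \<noteq> 0"
      unfolding shape_measure[OF r(1)] using e r by simp
    then have "wpow \<omega> p (E x r) \<noteq> 0"
      using p by (intro wpow_pos shape_sets) auto
    have "wpow \<omega> p (E x r) epowr (1 / p)
        \<le> vol (E x r) epowr (1 / p - 1 / q) * Wq (E x r)"
      unfolding wpow_def using p pq by (intro power_mean_nn_set_integral) auto
    also have "\<dots> < top"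
    proof -
      have "Wq (E x r) \<noteq> top"
        using W_shape_finite[OF r(1), of x] q by (simp add: epowr_eq_top_iff)
      then show ?thesis
        unfolding shape_epowr[OF r(1)] by (simp add: ennreal_mult_less_top less_top)
    qed
    finally have "wpow \<omega> p (E x r) epowr (1 / p) < top" .
    moreover have "wpow \<omega> p (E x r) epowr (1 / p) \<noteq> 0"
      using \<open>wpow \<omega> p (E x r) \<noteq> 0\<close> p by (simp add: epowr_eq_0_iff)
    ultimately obtain w where w: "wpow \<omega> p (E x r) epowr (1 / p) = ennreal w" "0 < w"
      by (cases "wpow \<omega> p (E x r) epowr (1 / p)") (auto simp: less_le)
    let ?b = "e powr ?a * r powr (?n * ?a)"
    have b: "0 < ?b" using e r by simp
    have "vol (E x r) epowr ?a / wpow \<omega> p (E x r) epowr (1 / p) * ?o = ?o * ennreal (?b / w)"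
      unfolding w(1) divide_ennreal_real[OF w(2)] shape_epowr[OF r(1)] using b w
      by (simp add: ennreal_mult[symmetric] mult_ac)
    also have "\<dots> \<le> ennreal t \<longleftrightarrow> ?o \<le> ennreal (t / (?b / w))"
      using b w r by (intro ennreal_mult_le_iff_divide) auto
    also have "t / (?b / w) = k * t * r powr (\<beta> + ?n / q - ?n / p) * w"
    proof -
      have "- (?n * ?a) = \<beta> + ?n / q - ?n / p"
        using card_ge_1 by (simp add: right_diff_distrib)
      then have "r powr (\<beta> + ?n / q - ?n / p) = 1 / r powr (?n * ?a)"
        by (metis powr_minus_divide)
      moreover have "k = 1 / e powr ?a" unfolding k_def by (rule powr_minus_divide)
      ultimately show ?thesis using b w by (simp add: field_simps)
    qed
    also have "ennreal (k * t * r powr (\<beta> + ?n / q - ?n / p) * w)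
        = ennreal (k * t * r powr (\<beta> + ?n / q - ?n / p)) * wpow \<omega> p (E x r) epowr (1 / p)"
      unfolding w(1) using k r w by (intro ennreal_mult) auto
    finally show ?thesis .
  qed
  from ex_bound_rescale[where \<rho> = \<rho> and P = "\<lambda>x r t. vol (E x r) epowr ?a / wpow \<omega> p (E x r) epowr (1 / p)
        * wosc_root f (E x r) \<le> ennreal t"
      and Q = "\<lambda>x r t. wosc_root f (E x r)
        \<le> ennreal (t * r powr (\<beta> + ?n / q - ?n / p)) * wpow \<omega> p (E x r) epowr (1 / p)",
      OF k \<rho>_pos this]
  show ?thesis unfolding p_bound_def by simp
qed

end

lemma cube_iff: "y \<in> cube x r \<longleftrightarrow> (\<forall>i. \<bar>y $ i - x $ i\<bar> < r / 2)"
proof -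
  have "x $ i - r / 2 < y $ i \<and> y $ i < x $ i + r / 2 \<longleftrightarrow> \<bar>y $ i - x $ i\<bar> < r / 2" for i
    by arith
  then show ?thesis by (simp add: cube_def mem_box_cart)
qed

lemma cube_lebesgue: "cube x r \<in> sets lebesgue"
  by (simp add: cube_def)

lemma emeasure_cube:
  fixes x :: "real ^ 'n"
  assumes "0 < r"
  shows "vol (cube x r) = ennreal (r ^ CARD('n))"
proof -
  have "(\<chi> i. x $ i + r / 2) = (\<chi> i. x $ i - r / 2) + (\<chi> i. r)" by (simp add: vec_eq_iff)
  then show ?thesis unfolding cube_def using emeasure_lebesgue_cube(2)[OF assms] by metis
qed

lemma ball_subset_cube: "ball x (r / 2) \<subseteq> cube x r"
proof
  fix y assume "y \<in> ball x (r / 2)"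
  then have "norm (y - x) < r / 2" by (simp add: dist_norm norm_minus_commute)
  moreover have "\<bar>y $ i - x $ i\<bar> \<le> norm (y - x)" for i
    using component_le_norm_cart[of "y - x" i] by simp
  ultimately show "y \<in> cube x r"
    unfolding cube_iff using order_le_less_trans by blast
qed

lemma cube_subset_ball:
  fixes x :: "real ^ 'n"
  assumes "0 < r" shows "cube x r \<subseteq> ball x (real CARD('n) * r)"
proof
  fix y assume "y \<in> cube x r"
  then have "\<bar>(y - x) $ i\<bar> \<le> r / 2" for i by (auto simp: cube_iff less_imp_le)
  then have "(\<Sum>i\<in>UNIV. \<bar>(y - x) $ i\<bar>) \<le> of_nat (card (UNIV :: 'n set)) * (r / 2)"
    by (intro sum_bounded_above) auto
  then have "norm (y - x) \<le> real CARD('n) * (r / 2)" using norm_le_l1_cart[of "y - x"] by simp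
  also have "\<dots> < real CARD('n) * r" using assms by simp
  finally show "y \<in> ball x (real CARD('n) * r)" by (simp add: dist_norm norm_minus_commute)
qed

theorem corollary3p8:
  fixes V \<omega> f :: "real ^ 'n \<Rightarrow> real"
    and s :: ennreal
    and p q :: real
    and \<rho> :: "real ^ 'n \<Rightarrow> real"
  assumes "CARD('n) \<ge> 3"
    and "\<And>x. 0 \<le> V x"
    and "locally_integrable V"
    and "\<not> (AE x in lebesgue. V x = 0)"
    and "ennreal (real CARD('n) / 2) \<le> s"
    and "reverse_Holder s V"
    and "\<rho> = critical_radius V"
    and "1 \<le> p" and "p < q"
    and "\<omega> \<in> A_class_infty \<rho> p q"
    and "locally_integrable f"
  shows
    "((\<exists>C>0. \<exists>N>0. \<forall>x0 r. r > 0 \<longrightarrow>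
         (1 / wpow \<omega> q (cube x0 r) * wosc \<omega> f q (cube x0 r)) epowr (1 / q)
           \<le> ennreal (C * (1 + r / \<rho> x0) powr N))
      \<longleftrightarrow> f \<in> BMO_infty \<rho>)
   \<and> ((\<exists>C>0. \<exists>N>0. \<forall>x0 r. r > 0 \<longrightarrow>
         emeasure lebesgue (cube x0 r) epowr (1 / p - 1 / q)
             / wpow \<omega> p (cube x0 r) epowr (1 / p)
             * wosc \<omega> f q (cube x0 r) epowr (1 / q)
           \<le> ennreal (C * (1 + r / \<rho> x0) powr N))
      \<longleftrightarrow> f \<in> BMO_infty \<rho>)
   \<and> (\<forall>\<beta>. 0 < \<beta> \<and> \<beta> < 1 \<longrightarrow>
        ((\<exists>C>0. \<exists>N>0. \<forall>x0 r. r > 0 \<longrightarrow>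
            1 / emeasure lebesgue (ball x0 r) epowr (\<beta> / real CARD('n))
              * (1 / wpow \<omega> q (ball x0 r) * wosc \<omega> f q (ball x0 r)) epowr (1 / q)
            \<le> ennreal (C * (1 + r / \<rho> x0) powr N))
         \<longleftrightarrow> f \<in> Lip_infty \<rho> \<beta>)
      \<and> ((\<exists>C>0. \<exists>N>0. \<forall>x0 r. r > 0 \<longrightarrow>
            emeasure lebesgue (ball x0 r) epowr (1 / p - 1 / q - \<beta> / real CARD('n))
                / wpow \<omega> p (ball x0 r) epowr (1 / p)
                * wosc \<omega> f q (ball x0 r) epowr (1 / q)
            \<le> ennreal (C * (1 + r / \<rho> x0) powr N))
         \<longleftrightarrow> f \<in> Lip_infty \<rho> \<beta>))"
proof -
  obtain K M where KM: "1 \<le> K" "1 \<le> M" "\<And>x. 0 < \<rho> x"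
    "\<And>x y r. 0 < r \<Longrightarrow> dist x y < r \<Longrightarrow> 1 + r / \<rho> y \<le> K * (1 + r / \<rho> x) powr M"
    by (rule critical_radius_comparison[OF assms(1-6), folded assms(7)]) (rule that)
  obtain \<theta> where \<theta>: "0 < \<theta>" "\<omega> \<in> A_class \<rho> \<theta> p q"
    using assms(10) by (auto simp: A_class_infty_def)
  obtain C where A: "A_weight \<omega> \<rho> p q C \<theta>"
    by (rule A_class_imp_A_weight[OF \<theta>(2) assms(8,9)])
  interpret cubes: weighted_shapes \<omega> \<rho> p q C \<theta> K M 1 0 cube
  proof (intro weighted_shapes.intro weighted_shapes_axioms.intro A)
    fix x :: "real ^ 'n" and r :: real assume r: "0 < r"
    show "emeasure lebesgue (cube x r) = ennreal (1 * r ^ CARD('n))"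
      using emeasure_cube[OF r, of x] by (simp only: mult_1_left)
    show "cube x r \<subseteq> ball x (real CARD('n) * r)" by (rule cube_subset_ball[OF r])
  qed (use KM \<theta>(1) in \<open>simp_all add: cube_lebesgue ball_subset_cube\<close>)
  have balls: "weighted_shapes \<omega> \<rho> p q C \<theta> K M (measure lebesgue (ball (0 :: real ^ 'n) 1)) \<beta> ball"
    if "0 < \<beta>" for \<beta>
  proof (intro weighted_shapes.intro weighted_shapes_axioms.intro A)
    fix x :: "real ^ 'n" and r :: real assume r: "0 < r"
    show "emeasure lebesgue (ball x r) = ennreal (measure lebesgue (ball (0 :: real ^ 'n) 1) * r ^ CARD('n))"
      using measure_ball_conv[of r x] r by (simp add: emeasure_ball_eq)
    show "ball x (r / 2) \<subseteq> ball x r" using r by (intro subset_ball) auto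
    have "1 * r \<le> real CARD('n) * r" using r assms(1) by (intro mult_right_mono) auto
    then show "ball x r \<subseteq> ball x (real CARD('n) * r)" by (intro subset_ball) simp
  qed (use KM \<theta>(1) that measure_unit_ball_pos in auto)
  have "cubes.osc_bound f \<longleftrightarrow> f \<in> BMO_infty \<rho>"
    unfolding cubes.osc_bound_iff BMO_infty_def BMO_def eaverage_def using assms(11) by (simp add: Bex_def)
  moreover have "weighted_shapes.osc_bound \<rho> \<beta> ball f \<longleftrightarrow> f \<in> Lip_infty \<rho> \<beta>" if "0 < \<beta>" for \<beta>
    unfolding weighted_shapes.osc_bound_iff[OF balls[OF that]] Lip_infty_def Lip_def
    using assms(11) by (simp add: Bex_def)
  moreover note cubes.osc_bound_iff_q_bound[OF assms(11)] cubes.q_bound_iff_p_bound[of f]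
    cubes.q_bound_iff[of f] cubes.p_bound_iff[of f]
    weighted_shapes.osc_bound_iff_q_bound[OF balls assms(11)] weighted_shapes.q_bound_iff_p_bound[OF balls, of _ f]
    weighted_shapes.q_bound_iff[OF balls, of _ f] weighted_shapes.p_bound_iff[OF balls, of _ f]
  ultimately show ?thesis by simp
qed

end
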